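(* Let $F$ be a field of characteristic $2$, let $(V,q)$ be a (nondegenerate) quadratic space over $F$ and let $\tau\in O(V,q)$ be an involution such that $\mathrm{Res}(\tau)=\mathrm{Fix}(\tau)$. If $\varphi$ is the associated quadratic form of the Wall form $\omega_\tau$, i.e. $\varphi(v)=\omega_\tau(v,v)$ for $v\in\mathrm{Res}(\tau)$, then $\Phi(C(q),J_\tau)\simeq C(\varphi)\simeq C(q|_{\mathrm{Res}(\tau)})$ as $F$-algebras.
   Context: For a quadratic form $q:V\to F$ on a finite-dimensional vector space, the polar form is $\mathfrak{b}_q(u,v)=q(u+v)-q(u)-q(v)$. $(V,q)$ is called a quadratic space if $\mathfrak{b}_q$ is nondegenerate. An involution in $O(V,q)$ is an isometry $\tau$ with $\tau^2=\mathrm{id}$. For $\tau\in O(V,q)$: $\mathrm{Fix}(\tau)=\{x\in V\mid\tau(x)=x\}$ and $\mathrm{Res}(\tau)=\{\tau(x)-x\mid x\in V\}$. The Wall form of $\tau$ is the (well-defined, nondegenerate) bilinear form $\omega_\tau$ on $\mathrm{Res}(\tau)$ given by $\omega_\tau(\tau(x)-x,\tau(y)-y)=\mathfrak{b}_q(\tau(x)-x,y)$; it is symmetric if $\tau^2=\mathrm{id}$. For any (possibly degenerate) quadratic form $\psi$ on a vector space $U$, $C(\psi)$ denotes the Clifford algebra, i.e. the quotient of the tensor algebra of $U$ by the ideal generated by $u\otimes u-\psi(u)$, $u\in U$. $J_\tau$ is the $F$-linear involution of $C(q)$ with $J_\tau(v)=\tau(v)$ for $v\in V$. For a central simple $F$-algebra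 with involution of the first kind $(A,\sigma)$ put $\mathrm{Sym}(A,\sigma)=\{a\in A\mid\sigma(a)=a\}$. $(A,\sigma)$ is totally decomposable if it is isomorphic to a tensor product of quaternion algebras with involution (of the first kind). It is known that, when $\mathrm{Res}(\tau)=\mathrm{Fix}(\tau)$, $(C(q),J_\tau)$ is totally decomposable and $J_\tau$ is orthogonal. If $(A,\sigma)$ is totally decomposable of degree $2^n$ with $\sigma$ orthogonal over a field $F$ of characteristic $2$, it is known that there is, up to isomorphism, a unique subalgebra $S\subseteq\mathrm{Sym}(A,\sigma)$ such that (i) $x^2\in F$ for all $x\in S$; (ii) $\dim_FS=\deg_FA=2^n$; (iii) $S$ is self-centralizing, $C_A(S)=S$; (iv) $S$ is generated as an $F$-algebra by exactly $n$ elements. The isomorphism class of $S$ is denoted $\Phi(A,\sigma)$. *)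

theory Defs
  imports
    "HOL-Algebra.QuotRing"
    "HOL-Algebra.Subrings"
    "Jordan_Normal_Form.Missing_VectorSpace"
begin

text \<open>
  Vector spaces over \<open>F\<close> are modules in the sense of \<open>HOL-Algebra\<close> whose scalar ring is a field.
  Associative unital \<open>F\<close>-algebras use the same record, which also has the fields
  \<open>mult\<close> and \<open>one\<close>; these two fields are irrelevant for a record used only as a vector space.
\<close>

definition subalg :: "('f, 'm) ring_scheme \<Rightarrow> ('f, 'a) module \<Rightarrow> 'a set \<Rightarrow> bool" where
  "subalg F A S \<longleftrightarrow> subring S A \<and> (\<forall>c\<in>carrier F. \<forall>x\<in>S. c \<odot>\<^bsub>A\<^esub> x \<in> S)"

definition alg_generated :: "('f, 'm) ring_scheme \<Rightarrow> ('f, 'a) module \<Rightarrow> 'a set \<Rightarrow> 'a set" where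
  "alg_generated F A X = \<Inter>{S. subalg F A S \<and> X \<subseteq> S}"

definition alg_centralizer :: "('f, 'a) module \<Rightarrow> 'a set \<Rightarrow> 'a set" where
  "alg_centralizer A S = {a \<in> carrier A. \<forall>s\<in>S. a \<otimes>\<^bsub>A\<^esub> s = s \<otimes>\<^bsub>A\<^esub> a}"

definition alg_isomorphic ::
    "('f, 'm) ring_scheme \<Rightarrow> ('f, 'a) module \<Rightarrow> ('f, 'b) module \<Rightarrow> bool" where
  "alg_isomorphic F A B \<longleftrightarrow> (\<exists>h\<in>ring_iso A B. h \<in> module_hom F A B)"

text \<open>Finite-dimensionality is required because \<^const>\<open>vectorspace.dim\<close> is only meaningful then.\<close>

definition has_dim :: "('f, 'm) ring_scheme \<Rightarrow> ('f, 'a) module \<Rightarrow> nat \<Rightarrow> bool" where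
  "has_dim F W n \<longleftrightarrow> vectorspace.fin_dim F W \<and> vectorspace.dim F W = n"

text \<open>The degree of a central simple algebra is the square root of its dimension.\<close>

definition has_degree :: "('f, 'm) ring_scheme \<Rightarrow> ('f, 'a) module \<Rightarrow> nat \<Rightarrow> bool" where
  "has_degree F A d \<longleftrightarrow> has_dim F A (d ^ 2)"

text \<open>The quotient of an algebra by a two-sided ideal: the scalar action on cosets is added to
  the quotient ring, in the style of \<^const>\<open>rcoset_mult\<close>.\<close>

definition alg_quot :: "('f, 'a) module \<Rightarrow> 'a set \<Rightarrow> ('f, 'a set) module" where
  "alg_quot A I =
    \<lparr>carrier = carrier (A Quot I), mult = mult (A Quot I), one = one (A Quot I),
     zero = zero (A Quot I), add = add (A Quot I),
     smult = (\<lambda>c X. \<Union>x\<in>X. I +>\<^bsub>A\<^esub> (c \<odot>\<^bsub>A\<^esub> x))\<rparr>"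

text \<open>
  The free associative algebra on a set \<open>X\<close>: finitely supported functions on words over \<open>X\<close>
  with the Cauchy product along concatenation.
\<close>

definition free_alg :: "('f, 'm) ring_scheme \<Rightarrow> 'v set \<Rightarrow> ('f, 'v list \<Rightarrow> 'f) module" where
  "free_alg F X =
    \<lparr>carrier = {p. range p \<subseteq> carrier F \<and> (\<forall>w. w \<notin> lists X \<longrightarrow> p w = \<zero>\<^bsub>F\<^esub>)
                   \<and> finite {w. p w \<noteq> \<zero>\<^bsub>F\<^esub>}},
     mult = (\<lambda>p r w. \<Oplus>\<^bsub>F\<^esub>i\<in>{..length w}. p (take i w) \<otimes>\<^bsub>F\<^esub> r (drop i w)),
     one = (\<lambda>w. if w = [] then \<one>\<^bsub>F\<^esub> else \<zero>\<^bsub>F\<^esub>),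
     zero = (\<lambda>w. \<zero>\<^bsub>F\<^esub>),
     add = (\<lambda>p r w. p w \<oplus>\<^bsub>F\<^esub> r w),
     smult = (\<lambda>c p w. c \<otimes>\<^bsub>F\<^esub> p w)\<rparr>"

definition free_letter :: "('f, 'm) ring_scheme \<Rightarrow> 'v \<Rightarrow> 'v list \<Rightarrow> 'f" where
  "free_letter F u = (\<lambda>w. if w = [u] then \<one>\<^bsub>F\<^esub> else \<zero>\<^bsub>F\<^esub>)"

text \<open>
  The tensor algebra of \<open>U\<close> is the free algebra on the underlying set of \<open>U\<close> modulo the linearity
  of the letters. This ideal is homogeneous; its part of degree \<open>k\<close> consists of
  the multilinearity relations in the free module on \<open>U\<^sup>k\<close>, so the component of degree \<open>k\<close> of
  the quotient is the usual \<open>k\<close>-th tensor power of \<open>U\<close>.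
\<close>

definition tensor_ideal :: "('f, 'm) ring_scheme \<Rightarrow> ('f, 'v) module \<Rightarrow> ('v list \<Rightarrow> 'f) set" where
  "tensor_ideal F U = (let A = free_alg F (carrier U); l = free_letter F in
     genideal A
       ({l (u \<oplus>\<^bsub>U\<^esub> v) \<ominus>\<^bsub>A\<^esub> (l u \<oplus>\<^bsub>A\<^esub> l v) | u v. u \<in> carrier U \<and> v \<in> carrier U} \<union>
        {l (c \<odot>\<^bsub>U\<^esub> u) \<ominus>\<^bsub>A\<^esub> c \<odot>\<^bsub>A\<^esub> l u | c u. c \<in> carrier F \<and> u \<in> carrier U}))"

definition tensor_alg ::
    "('f, 'm) ring_scheme \<Rightarrow> ('f, 'v) module \<Rightarrow> ('f, ('v list \<Rightarrow> 'f) set) module" where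
  "tensor_alg F U = alg_quot (free_alg F (carrier U)) (tensor_ideal F U)"

definition tensor_in ::
    "('f, 'm) ring_scheme \<Rightarrow> ('f, 'v) module \<Rightarrow> 'v \<Rightarrow> ('v list \<Rightarrow> 'f) set" where
  "tensor_in F U u = tensor_ideal F U +>\<^bsub>free_alg F (carrier U)\<^esub> free_letter F u"

definition clifford_ideal ::
    "('f, 'm) ring_scheme \<Rightarrow> ('f, 'v) module \<Rightarrow> ('v \<Rightarrow> 'f) \<Rightarrow> ('v list \<Rightarrow> 'f) set set" where
  "clifford_ideal F U \<psi> = (let T = tensor_alg F U; t = tensor_in F U in
     genideal T {t u \<otimes>\<^bsub>T\<^esub> t u \<ominus>\<^bsub>T\<^esub> \<psi> u \<odot>\<^bsub>T\<^esub> \<one>\<^bsub>T\<^esub> | u. u \<in> carrier U})"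

definition clifford_alg ::
    "('f, 'm) ring_scheme \<Rightarrow> ('f, 'v) module \<Rightarrow> ('v \<Rightarrow> 'f) \<Rightarrow>
     ('f, ('v list \<Rightarrow> 'f) set set) module" where
  "clifford_alg F U \<psi> = alg_quot (tensor_alg F U) (clifford_ideal F U \<psi>)"

definition clifford_in ::
    "('f, 'm) ring_scheme \<Rightarrow> ('f, 'v) module \<Rightarrow> ('v \<Rightarrow> 'f) \<Rightarrow> 'v \<Rightarrow> ('v list \<Rightarrow> 'f) set set" where
  "clifford_in F U \<psi> u = clifford_ideal F U \<psi> +>\<^bsub>tensor_alg F U\<^esub> tensor_in F U u"

definition polar ::
    "('f, 'm) ring_scheme \<Rightarrow> ('f, 'v) module \<Rightarrow> ('v \<Rightarrow> 'f) \<Rightarrow> 'v \<Rightarrow> 'v \<Rightarrow> 'f" where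
  "polar F V q u v = q (u \<oplus>\<^bsub>V\<^esub> v) \<ominus>\<^bsub>F\<^esub> q u \<ominus>\<^bsub>F\<^esub> q v"

definition bilinear_form ::
    "('f, 'm) ring_scheme \<Rightarrow> ('f, 'v) module \<Rightarrow> ('v \<Rightarrow> 'v \<Rightarrow> 'f) \<Rightarrow> bool" where
  "bilinear_form F V b \<longleftrightarrow>
     (\<forall>u\<in>carrier V. \<forall>v\<in>carrier V. b u v \<in> carrier F) \<and>
     (\<forall>u\<in>carrier V. \<forall>v\<in>carrier V. \<forall>w\<in>carrier V.
        b (u \<oplus>\<^bsub>V\<^esub> v) w = b u w \<oplus>\<^bsub>F\<^esub> b v w \<and> b w (u \<oplus>\<^bsub>V\<^esub> v) = b w u \<oplus>\<^bsub>F\<^esub> b w v) \<and>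
     (\<forall>c\<in>carrier F. \<forall>u\<in>carrier V. \<forall>v\<in>carrier V.
        b (c \<odot>\<^bsub>V\<^esub> u) v = c \<otimes>\<^bsub>F\<^esub> b u v \<and> b u (c \<odot>\<^bsub>V\<^esub> v) = c \<otimes>\<^bsub>F\<^esub> b u v)"

definition quadratic_form ::
    "('f, 'm) ring_scheme \<Rightarrow> ('f, 'v) module \<Rightarrow> ('v \<Rightarrow> 'f) \<Rightarrow> bool" where
  "quadratic_form F V q \<longleftrightarrow>
     (\<forall>v\<in>carrier V. q v \<in> carrier F) \<and>
     (\<forall>c\<in>carrier F. \<forall>v\<in>carrier V. q (c \<odot>\<^bsub>V\<^esub> v) = c \<otimes>\<^bsub>F\<^esub> c \<otimes>\<^bsub>F\<^esub> q v) \<and>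
     bilinear_form F V (polar F V q)"

definition quadratic_space ::
    "('f, 'm) ring_scheme \<Rightarrow> ('f, 'v) module \<Rightarrow> ('v \<Rightarrow> 'f) \<Rightarrow> bool" where
  "quadratic_space F V q \<longleftrightarrow>
     vectorspace F V \<and> vectorspace.fin_dim F V \<and> quadratic_form F V q \<and>
     (\<forall>u\<in>carrier V. (\<forall>v\<in>carrier V. polar F V q u v = \<zero>\<^bsub>F\<^esub>) \<longrightarrow> u = \<zero>\<^bsub>V\<^esub>)"

definition orthogonal_group ::
    "('f, 'm) ring_scheme \<Rightarrow> ('f, 'v) module \<Rightarrow> ('v \<Rightarrow> 'f) \<Rightarrow> ('v \<Rightarrow> 'v) set" where
  "orthogonal_group F V q =
     {\<tau> \<in> module_hom F V V. bij_betw \<tau> (carrier V) (carrier V) \<and> (\<forall>v\<in>carrier V. q (\<tau> v) = q v)}"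

definition Fix :: "('f, 'v) module \<Rightarrow> ('v \<Rightarrow> 'v) \<Rightarrow> 'v set" where
  "Fix V \<tau> = {x \<in> carrier V. \<tau> x = x}"

definition Res :: "('f, 'v) module \<Rightarrow> ('v \<Rightarrow> 'v) \<Rightarrow> 'v set" where
  "Res V \<tau> = {\<tau> x \<ominus>\<^bsub>V\<^esub> x | x. x \<in> carrier V}"

definition wall_form ::
    "('f, 'm) ring_scheme \<Rightarrow> ('f, 'v) module \<Rightarrow> ('v \<Rightarrow> 'f) \<Rightarrow> ('v \<Rightarrow> 'v) \<Rightarrow> 'v \<Rightarrow> 'v \<Rightarrow> 'f" where
  "wall_form F V q \<tau> u w =
     (THE c. \<exists>x\<in>carrier V. \<exists>y\<in>carrier V.
        u = \<tau> x \<ominus>\<^bsub>V\<^esub> x \<and> w = \<tau> y \<ominus>\<^bsub>V\<^esub> y \<and> c = polar F V q (\<tau> x \<ominus>\<^bsub>V\<^esub> x) y)"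

definition alg_involution ::
    "('f, 'm) ring_scheme \<Rightarrow> ('f, 'a) module \<Rightarrow> ('a \<Rightarrow> 'a) \<Rightarrow> bool" where
  "alg_involution F A \<sigma> \<longleftrightarrow>
     \<sigma> \<in> module_hom F A A \<and>
     (\<forall>x\<in>carrier A. \<forall>y\<in>carrier A. \<sigma> (x \<otimes>\<^bsub>A\<^esub> y) = \<sigma> y \<otimes>\<^bsub>A\<^esub> \<sigma> x) \<and>
     (\<forall>x\<in>carrier A. \<sigma> (\<sigma> x) = x)"

text \<open>Extensionality makes the involution unique as a total function.\<close>

definition clifford_inv ::
    "('f, 'm) ring_scheme \<Rightarrow> ('f, 'v) module \<Rightarrow> ('v \<Rightarrow> 'f) \<Rightarrow> ('v \<Rightarrow> 'v) \<Rightarrow>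
     ('v list \<Rightarrow> 'f) set set \<Rightarrow> ('v list \<Rightarrow> 'f) set set" where
  "clifford_inv F V q \<tau> =
     (THE J. J \<in> extensional (carrier (clifford_alg F V q)) \<and>
        alg_involution F (clifford_alg F V q) J \<and>
        (\<forall>v\<in>carrier V. J (clifford_in F V q v) = clifford_in F V q (\<tau> v)))"

definition Sym :: "('f, 'a) module \<Rightarrow> ('a \<Rightarrow> 'a) \<Rightarrow> 'a set" where
  "Sym A \<sigma> = {a \<in> carrier A. \<sigma> a = a}"

text \<open>
  The subalgebras representing the invariant \<open>\<Phi>(A,\<sigma>)\<close>. When \<open>A\<close> is totally decomposable in
  characteristic 2 and \<open>\<sigma>\<close> is orthogonal, this set is nonempty and all its members are isomorphic;
  \<open>\<Phi>(A,\<sigma>)\<close> is their common isomorphism class. The number \<open>n\<close> is determined by \<open>deg A = 2\<^sup>n\<close>.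
\<close>

definition Phi_representatives ::
    "('f, 'm) ring_scheme \<Rightarrow> ('f, 'a) module \<Rightarrow> ('a \<Rightarrow> 'a) \<Rightarrow> 'a set set" where
  "Phi_representatives F A \<sigma> =
     {S. subalg F A S \<and> S \<subseteq> Sym A \<sigma> \<and>
         (\<forall>x\<in>S. \<exists>c\<in>carrier F. x \<otimes>\<^bsub>A\<^esub> x = c \<odot>\<^bsub>A\<^esub> \<one>\<^bsub>A\<^esub>) \<and>
         alg_centralizer A S = S \<and>
         (\<exists>n. has_degree F A (2 ^ n) \<and> has_dim F (A\<lparr>carrier := S\<rparr>) (2 ^ n) \<and>
              (\<exists>X. X \<subseteq> S \<and> finite X \<and> card X = n \<and> alg_generated F A X = S))}"

text \<open>\<open>\<Phi>(A,\<sigma>) \<simeq> B\<close>: there are representatives, and each of them is isomorphic to \<open>B\<close>.\<close>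

definition Phi_isomorphic ::
    "('f, 'm) ring_scheme \<Rightarrow> ('f, 'a) module \<Rightarrow> ('a \<Rightarrow> 'a) \<Rightarrow> ('f, 'b) module \<Rightarrow> bool" where
  "Phi_isomorphic F A \<sigma> B \<longleftrightarrow>
     Phi_representatives F A \<sigma> \<noteq> {} \<and>
     (\<forall>S\<in>Phi_representatives F A \<sigma>. alg_isomorphic F (A\<lparr>carrier := S\<rparr>) B)"

end

theory Submission
  imports Defs
begin

text \<open>
  In characteristic 2, \<open>q (\<tau> x - x) = b (\<tau> x - x) x\<close> for an isometry \<open>\<tau>\<close>, so \<open>\<phi>\<close> is just the
  restriction of \<open>q\<close> to \<open>R = Res \<tau>\<close>, which is totally isotropic. Write \<open>ad x a = x a + a x\<close>, let
  \<open>f i\<close> be vectors whose images \<open>rho i = \<tau> (f i) - f i\<close> form a basis of \<open>R\<close>, and let \<open>rs, fs\<close> be the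
  basis dual to \<open>rho, f\<close>. Commutators with the dual vectors strip the generators of \<open>C(q)\<close> one at a
  time; this yields the dimensions, shows that \<open>R\<close> generates a self-centralizing subalgebra, and
  produces a trace \<open>T\<close>, the product of all these commutators, with \<open>T \<circ> J = T\<close>.

  If \<open>S\<close> is any representative with generators \<open>x\<^sub>1, \<dots>, x\<^sub>n\<close>, counting dimensions shows
  \<open>ad x\<^sub>1 (\<dots> (ad x\<^sub>n g)) = 1\<close> for some \<open>g\<close>, and therefore \<open>C(q) = S g S\<close>. The additive map
  \<open>a \<mapsto> T (J a a)\<close> sends \<open>s g t\<close> to \<open>s\<^sup>2 t\<^sup>2 T (J g g)\<close> and is not zero, so its values form
  a line over the field \<open>{s\<^sup>2 | s \<in> S}\<close>. Hence this field does not depend on \<open>S\<close>, and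
  an exchange argument gives \<open>S\<close> generators with the same squares as the \<open>rho i\<close>.
\<close>

section \<open>Subalgebras and dimensions\<close>

text \<open>Membership in \<open>Phi_representatives\<close> gives S some n generators with unknown
  squares, whereas a homomorphism from C(q|R) onto S needs n generators with squares q(rho i). This
  is why the squares of S must be shown to be independent of S. S need not be a field: it may
  contain nilpotents, and some q(rho i) may lie in the field generated by the others over the
  squares of F, or all may vanish. Counting field degrees therefore does not produce the generators,
  and redundant ones have to be repaired separately. In \<open>Res_Fix\<close>, one inclusion makes
  R isotropic; the other makes R so large that \<open>rho\<close> and \<open>f\<close> together span
  V. The identity T(J a) = T(a) makes the mixed terms T(J a b) and T(J b a) equal, and
  characteristic 2 then makes a |-> T(J a a) additive. Dimension counts need lower bounds as well as
  spanning sets. They rest on 1 \<noteq> 0 in C(q), which generators and relations do not show; a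
  functional that evaluates words by contractions proves it.\<close>

locale assoc_alg = F: field F + A: ring A + VS: vectorspace F A
  for F :: "('f, 'm) ring_scheme" and A :: "('f, 'a) module" (structure) +
  assumes smult_mult_l: "\<lbrakk>c \<in> carrier F; x \<in> carrier A; y \<in> carrier A\<rbrakk> \<Longrightarrow> (c \<odot> x) \<otimes> y = c \<odot> (x \<otimes> y)"
    and smult_mult_r: "\<lbrakk>c \<in> carrier F; x \<in> carrier A; y \<in> carrier A\<rbrakk> \<Longrightarrow> x \<otimes> (c \<odot> y) = c \<odot> (x \<otimes> y)"

lemma assoc_algI:
  fixes A (structure)
  assumes "vectorspace F A" "ring A"
    and "\<And>c x y. \<lbrakk>c \<in> carrier F; x \<in> carrier A; y \<in> carrier A\<rbrakk> \<Longrightarrow> (c \<odot> x) \<otimes> y = c \<odot> (x \<otimes> y)"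
    and "\<And>c x y. \<lbrakk>c \<in> carrier F; x \<in> carrier A; y \<in> carrier A\<rbrakk> \<Longrightarrow> x \<otimes> (c \<odot> y) = c \<odot> (x \<otimes> y)"
  shows "assoc_alg F A"
  using assms vectorspace.axioms[of F A]
  by (intro assoc_alg.intro assoc_alg_axioms.intro) auto

context assoc_alg
begin

lemma submoduleI:
  assumes "S \<subseteq> carrier A" "\<zero> \<in> S" "\<And>x y. \<lbrakk>x \<in> S; y \<in> S\<rbrakk> \<Longrightarrow> x \<oplus> y \<in> S"
    "\<And>c x. \<lbrakk>c \<in> carrier F; x \<in> S\<rbrakk> \<Longrightarrow> c \<odot> x \<in> S"
  shows "submodule F S A"
  using assms VS.module_axioms by (auto simp: submodule_def)

lemma subspaceI:
  assumes "S \<subseteq> carrier A" "\<zero> \<in> S" "\<And>x y. \<lbrakk>x \<in> S; y \<in> S\<rbrakk> \<Longrightarrow> x \<oplus> y \<in> S"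
    "\<And>c x. \<lbrakk>c \<in> carrier F; x \<in> S\<rbrakk> \<Longrightarrow> c \<odot> x \<in> S"
  shows "subspace F S A"
  using submoduleI[OF assms] VS.vectorspace_axioms by (auto simp: subspace_def)

lemma subalgI:
  assumes "S \<subseteq> carrier A" "\<one> \<in> S" "\<And>x y. \<lbrakk>x \<in> S; y \<in> S\<rbrakk> \<Longrightarrow> x \<oplus> y \<in> S"
    "\<And>x y. \<lbrakk>x \<in> S; y \<in> S\<rbrakk> \<Longrightarrow> x \<otimes> y \<in> S" "\<And>c x. \<lbrakk>c \<in> carrier F; x \<in> S\<rbrakk> \<Longrightarrow> c \<odot> x \<in> S"
  shows "subalg F A S"
proof -
  have "\<ominus> x \<in> S" if "x \<in> S" for x
  proof -
    have "\<ominus> x = (\<ominus>\<^bsub>F\<^esub> \<one>\<^bsub>F\<^esub>) \<odot> x"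
      using that assms(1) VS.smult_l_minus[of "\<one>\<^bsub>F\<^esub>" x] by auto
    then show ?thesis using assms(5)[of "\<ominus>\<^bsub>F\<^esub> \<one>\<^bsub>F\<^esub>" x] that by auto
  qed
  then show ?thesis
    using assms unfolding subalg_def by (auto intro!: A.subringI)
qed

lemma subalgD:
  assumes "subalg F A S"
  shows "S \<subseteq> carrier A" "\<zero> \<in> S" "\<one> \<in> S" "\<And>x y. \<lbrakk>x \<in> S; y \<in> S\<rbrakk> \<Longrightarrow> x \<oplus> y \<in> S"
    "\<And>x y. \<lbrakk>x \<in> S; y \<in> S\<rbrakk> \<Longrightarrow> x \<otimes> y \<in> S" "\<And>c x. \<lbrakk>c \<in> carrier F; x \<in> S\<rbrakk> \<Longrightarrow> c \<odot> x \<in> S"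
    "\<And>x. x \<in> S \<Longrightarrow> x \<in> carrier A"
  using assms subringE[of S A] unfolding subalg_def by auto

lemma subalg_subspace: "subalg F A S \<Longrightarrow> subspace F S A"
  by (intro subspaceI) (auto dest: subalgD)

lemma subalg_carrier: "subalg F A (carrier A)"
  by (rule subalgI) auto

lemma subalg_alg_generated:
  assumes "X \<subseteq> carrier A"
  shows "subalg F A (alg_generated F A X)"
  using subalg_carrier assms unfolding alg_generated_def
  by (intro subalgI) (auto simp: subalgD)

lemma alg_generated_incl: "X \<subseteq> alg_generated F A X"
  unfolding alg_generated_def by auto

lemma alg_generated_minimal: "\<lbrakk>subalg F A S; X \<subseteq> S\<rbrakk> \<Longrightarrow> alg_generated F A X \<subseteq> S"
  unfolding alg_generated_def by auto

lemma alg_generated_mono: "X \<subseteq> Y \<Longrightarrow> alg_generated F A X \<subseteq> alg_generated F A Y"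
  unfolding alg_generated_def by auto

lemma subalg_centralizer:
  assumes "X \<subseteq> carrier A"
  shows "subalg F A (alg_centralizer A X)"
proof (rule subalgI)
  fix x y assume *: "x \<in> alg_centralizer A X" "y \<in> alg_centralizer A X"
  then have car: "x \<in> carrier A" "y \<in> carrier A" by (auto simp: alg_centralizer_def)
  have "(x \<otimes> y) \<otimes> s = s \<otimes> (x \<otimes> y)" if "s \<in> X" for s
  proof -
    have s: "s \<in> carrier A" using assms that by auto
    have "(x \<otimes> y) \<otimes> s = x \<otimes> (s \<otimes> y)" using * that s car
      by (simp add: alg_centralizer_def A.m_assoc)
    also have "\<dots> = (s \<otimes> x) \<otimes> y" using * that s car
      by (auto simp: alg_centralizer_def simp flip: A.m_assoc)
    finally show ?thesis using s car by (simp add: A.m_assoc)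
  qed
  then show "x \<otimes> y \<in> alg_centralizer A X" using car by (auto simp: alg_centralizer_def)
next
  fix x y assume *: "x \<in> alg_centralizer A X" "y \<in> alg_centralizer A X"
  then show "x \<oplus> y \<in> alg_centralizer A X"
    using assms by (auto simp: alg_centralizer_def A.l_distr A.r_distr subset_eq)
next
  fix c x assume "c \<in> carrier F" "x \<in> alg_centralizer A X"
  then show "c \<odot> x \<in> alg_centralizer A X"
    using assms by (auto simp: alg_centralizer_def smult_mult_l smult_mult_r subset_eq)
qed (use assms in \<open>auto simp: alg_centralizer_def\<close>)

text \<open>The elements commuting with a fixed a form a subalgebra, so they include the algebra
  generated by X as soon as they include X.\<close>

lemma alg_centralizer_generated:
  assumes "X \<subseteq> carrier A"
  shows "alg_centralizer A (alg_generated F A X) = alg_centralizer A X"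
proof
  show "alg_centralizer A (alg_generated F A X) \<subseteq> alg_centralizer A X"
    using alg_generated_incl unfolding alg_centralizer_def by auto
  show "alg_centralizer A X \<subseteq> alg_centralizer A (alg_generated F A X)"
  proof
    fix a assume a: "a \<in> alg_centralizer A X"
    then have "X \<subseteq> alg_centralizer A {a}" using assms unfolding alg_centralizer_def by auto
    then have "alg_generated F A X \<subseteq> alg_centralizer A {a}"
      using a by (intro alg_generated_minimal subalg_centralizer) (auto simp: alg_centralizer_def)
    then show "a \<in> alg_centralizer A (alg_generated F A X)"
      using a by (auto simp: alg_centralizer_def)
  qed
qed

text \<open>The copy of F inside A, through which "the square lies in F" is expressed as a property
  of elements of A. It is one-dimensional only once 1 is known to be nonzero.\<close>

definition scal :: "'a set" where "scal = {c \<odot> \<one> | c. c \<in> carrier F}"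

lemma scal_closed: "s \<in> scal \<Longrightarrow> s \<in> carrier A"
  by (auto simp: scal_def)

lemma scal_commute: "\<lbrakk>s \<in> scal; x \<in> carrier A\<rbrakk> \<Longrightarrow> s \<otimes> x = x \<otimes> s"
  by (auto simp: scal_def smult_mult_l smult_mult_r)

lemma subalg_scal: "subalg F A scal"
proof (rule subalgI)
  show "\<one> \<in> scal" unfolding scal_def by (rule CollectI, rule exI[of _ "\<one>\<^bsub>F\<^esub>"]) auto
  fix x y assume xy: "x \<in> scal" "y \<in> scal"
  then obtain c d where *: "x = c \<odot> \<one>" "y = d \<odot> \<one>" "c \<in> carrier F" "d \<in> carrier F"
    by (auto simp: scal_def)
  have "x \<oplus> y = (c \<oplus>\<^bsub>F\<^esub> d) \<odot> \<one>" "x \<otimes> y = (c \<otimes>\<^bsub>F\<^esub> d) \<odot> \<one>"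
    using * by (simp_all add: VS.smult_l_distr VS.smult_assoc1 smult_mult_l)
  with * show "x \<oplus> y \<in> scal" "x \<otimes> y \<in> scal"
    unfolding scal_def by (metis (mono_tags, lifting) F.ring_simprules(1,5) mem_Collect_eq)+
next
  fix c x assume xy: "c \<in> carrier F" "x \<in> scal"
  then obtain d where *: "x = d \<odot> \<one>" "d \<in> carrier F"
    by (auto simp: scal_def)
  have "c \<odot> x = (c \<otimes>\<^bsub>F\<^esub> d) \<odot> \<one>"
    using * xy by (simp add: VS.smult_assoc1)
  then show "c \<odot> x \<in> scal"
    unfolding scal_def using xy * by auto
qed (auto simp: scal_closed)

lemma scal_subset: "subalg F A S \<Longrightarrow> scal \<subseteq> S"
  unfolding scal_def by (auto dest: subalgD)

lemma alg_generated_empty: "alg_generated F A {} = scal"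
  by (intro equalityI alg_generated_minimal subalg_scal scal_subset subalg_alg_generated) auto

lemma scal_inverse:
  assumes "s \<in> scal" "s \<noteq> \<zero>"
  shows "\<exists>t\<in>scal. s \<otimes> t = \<one>"
proof -
  obtain c where c: "c \<in> carrier F" "s = c \<odot> \<one>" using assms by (auto simp: scal_def)
  have "c \<noteq> \<zero>\<^bsub>F\<^esub>" using assms c by auto
  then have u: "c \<in> Units F" using c by (simp add: F.field_Units)
  then have "s \<otimes> (inv\<^bsub>F\<^esub> c \<odot> \<one>) = \<one>"
    using c by (simp add: smult_mult_l VS.smult_assoc1[symmetric])
  moreover have "inv\<^bsub>F\<^esub> c \<odot> \<one> \<in> scal" using u by (auto simp: scal_def)
  ultimately show ?thesis by blast
qed

text \<open>Unlike a bound on \<^const>\<open>vectorspace.dim\<close>, this includes finite-dimensionality.\<close>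
definition spanned :: "'a set \<Rightarrow> nat \<Rightarrow> bool" where
  "spanned S N \<longleftrightarrow> subspace F S A \<and> (\<exists>B. finite B \<and> card B \<le> N \<and> B \<subseteq> S \<and> S \<subseteq> VS.span B)"

lemma spanned_dim:
  assumes "spanned S N"
  shows "vectorspace.fin_dim F (A\<lparr>carrier := S\<rparr>)" "vectorspace.dim F (A\<lparr>carrier := S\<rparr>) \<le> N"
proof -
  obtain B where B: "finite B" "card B \<le> N" "B \<subseteq> S" "S \<subseteq> VS.span B" and S: "subspace F S A"
    using assms by (auto simp: spanned_def)
  interpret S: vectorspace F "A\<lparr>carrier := S\<rparr>" using S by (rule VS.subspace_is_vs)
  have sm: "submodule F S A" using S by (simp add: subspace_def)
  have "VS.span B \<subseteq> S" by (rule VS.span_is_subset[OF B(3) sm])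
  then have g: "S.gen_set B" using VS.span_li_not_depend(1)[OF B(3) sm] B(4) by auto
  show "S.fin_dim" unfolding S.fin_dim_def using B g by auto
  show "S.dim \<le> N" using S.gen_ge_dim[of B] B g by auto
qed

lemma spanned_scal: "spanned scal 1"
  unfolding spanned_def
proof (intro conjI exI[of _ "{\<one>}"])
  show "subspace F scal A" by (rule subalg_subspace[OF subalg_scal])
  have *: "submodule F (VS.span {\<one>}) A" by (intro VS.span_is_submodule) auto
  have "\<one> \<in> VS.span {\<one>}" using VS.in_own_span[of "{\<one>}"] by auto
  then show "scal \<subseteq> VS.span {\<one>}" using submodule.smult_closed[OF *] by (auto simp: scal_def)
qed (use subalgD(3)[OF subalg_scal] in auto)

text \<open>Only an upper bound, because the sum of H and H y need not be direct. Directness is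
  obtained later from elements dual to the generators.\<close>

lemma spanned_double:
  assumes "spanned H N" "y \<in> carrier A"
    and H': "subspace F H' A" "H' = {u \<oplus> v \<otimes> y | u v. u \<in> H \<and> v \<in> H}"
  shows "spanned H' (2 * N)"
proof -
  obtain B where B: "finite B" "card B \<le> N" "B \<subseteq> H" "H \<subseteq> VS.span B" and H: "subspace F H A"
    using assms by (auto simp: spanned_def)
  have smH: "submodule F H A" using H by (simp add: subspace_def)
  have HA: "H \<subseteq> carrier A" using submodule.subset[OF smH] .
  let ?B = "B \<union> (\<lambda>b. b \<otimes> y) ` B"
  have BA: "?B \<subseteq> carrier A" using B(3) HA assms(2) by auto
  have sp: "submodule F (VS.span ?B) A" by (rule VS.span_is_submodule[OF BA])
  have own: "?B \<subseteq> VS.span ?B" by (rule VS.in_own_span[OF BA])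
  have "submodule F {v \<in> carrier A. v \<otimes> y \<in> VS.span ?B} A"
    using assms(2) submodule.zero_closed[OF sp] submodule.m_closed[OF sp] submodule.smult_closed[OF sp]
    by (intro submoduleI) (auto simp: A.l_distr smult_mult_l)
  then have "VS.span B \<subseteq> {v \<in> carrier A. v \<otimes> y \<in> VS.span ?B}"
    using own BA by (intro VS.span_is_subset) auto
  then have 1: "v \<otimes> y \<in> VS.span ?B" if "v \<in> H" for v using that B(4) by auto
  have 2: "u \<in> VS.span ?B" if "u \<in> H" for u
    using that B(4) VS.span_is_monotone[of B ?B] by auto
  have "H' \<subseteq> VS.span ?B" using 1 2 submodule.m_closed[OF sp] unfolding H'(2) by auto
  moreover have "?B \<subseteq> H'"
  proof -
    have z: "\<zero> \<in> H" by (rule submodule.zero_closed[OF smH])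
    have "u \<in> H'" if "u \<in> H" for u
    proof -
      have "u = u \<oplus> \<zero> \<otimes> y" using that HA assms(2) by auto
      then show ?thesis unfolding H'(2) using that z by blast
    qed
    moreover have "u \<otimes> y \<in> H'" if "u \<in> H" for u
    proof -
      have "u \<otimes> y = \<zero> \<oplus> u \<otimes> y" using that HA assms(2) by auto
      then show ?thesis unfolding H'(2) using that z by blast
    qed
    ultimately show ?thesis using B(3) by auto
  qed
  moreover have "card ?B \<le> 2 * N"
    using card_Un_le[of B "(\<lambda>b. b \<otimes> y) ` B"] card_image_le[OF B(1), of "\<lambda>b. b \<otimes> y"] B(2) by linarith
  ultimately show ?thesis unfolding spanned_def using B(1) H' by (intro conjI exI[of _ ?B]) auto
qed

lemma dim_ker_im:
  assumes H: "subspace F H A" and fd: "vectorspace.fin_dim F (A\<lparr>carrier := H\<rparr>)"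
    and D: "\<And>x. x \<in> H \<Longrightarrow> D x \<in> H" "\<And>x y. \<lbrakk>x \<in> H; y \<in> H\<rbrakk> \<Longrightarrow> D (x \<oplus> y) = D x \<oplus> D y"
      "\<And>c x. \<lbrakk>c \<in> carrier F; x \<in> H\<rbrakk> \<Longrightarrow> D (c \<odot> x) = c \<odot> D x"
  shows "vectorspace.dim F (A\<lparr>carrier := D ` H\<rparr>)
       + vectorspace.dim F (A\<lparr>carrier := {x \<in> H. D x = \<zero>}\<rparr>) = vectorspace.dim F (A\<lparr>carrier := H\<rparr>)"
proof -
  interpret S: vectorspace F "A\<lparr>carrier := H\<rparr>" using H by (rule VS.subspace_is_vs)
  interpret L: linear_map F "A\<lparr>carrier := H\<rparr>" "A\<lparr>carrier := H\<rparr>" D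
    using D by unfold_locales (auto simp: module_hom_def)
  show ?thesis using L.rank_nullity[OF fd] by (simp add: L.im_def L.ker_def)
qed

text \<open>Independent subsets of G stay independent in H, so their size is bounded by the
  dimension of H. A maximal one is a basis of G, and if it has full size it is a basis of H
  too.\<close>

lemma dim_subspace_fin:
  assumes "subspace F H A" "subspace F G A" "G \<subseteq> H" "vectorspace.fin_dim F (A\<lparr>carrier := H\<rparr>)"
  shows "vectorspace.fin_dim F (A\<lparr>carrier := G\<rparr>)"
    and "vectorspace.dim F (A\<lparr>carrier := G\<rparr>) \<le> vectorspace.dim F (A\<lparr>carrier := H\<rparr>)"
    and "vectorspace.dim F (A\<lparr>carrier := G\<rparr>) = vectorspace.dim F (A\<lparr>carrier := H\<rparr>) \<Longrightarrow> G = H"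
proof -
  interpret H: vectorspace F "A\<lparr>carrier := H\<rparr>" using assms(1) by (rule VS.subspace_is_vs)
  interpret G: vectorspace F "A\<lparr>carrier := G\<rparr>" using assms(2) by (rule VS.subspace_is_vs)
  have smH: "submodule F H A" and smG: "submodule F G A" using assms by (auto simp: subspace_def)
  have small: "finite B \<and> card B \<le> H.dim" if "B \<subseteq> G" "G.lin_indpt B" for B
    using H.li_le_dim[OF assms(4), of B] that VS.span_li_not_depend(2)[OF _ smG, of B]
      VS.span_li_not_depend(2)[OF _ smH, of B] assms(3) by auto
  have "\<exists>B. finite B \<and> maximal B (\<lambda>S. S \<subseteq> carrier (A\<lparr>carrier := G\<rparr>) \<and> G.lin_indpt S)"
    using small by (intro maximal_exists[of _ H.dim "{}"]) (auto simp: G.lin_dep_def)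
  then obtain B where B: "finite B" "maximal B (\<lambda>S. S \<subseteq> carrier (A\<lparr>carrier := G\<rparr>) \<and> G.lin_indpt S)"
    by blast
  then have basis: "G.basis B" by (intro G.max_li_is_basis) auto
  then have Bli: "B \<subseteq> G" "G.lin_indpt B" and gen: "G.gen_set B" unfolding G.basis_def by auto
  show fd: "G.fin_dim" unfolding G.fin_dim_def using B(1) Bli gen by auto
  have dimG: "G.dim = card B" using G.dim_basis[OF B(1) basis] .
  then show "G.dim \<le> H.dim" using small Bli by auto
  assume eq: "G.dim = H.dim"
  have li: "H.lin_indpt B"
    using Bli VS.span_li_not_depend(2)[OF _ smG, of B]
      VS.span_li_not_depend(2)[OF _ smH, of B] assms(3) by auto
  have "H.basis B" using H.dim_li_is_basis[OF assms(4) B(1) _ li] eq dimG Bli assms(3) by auto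
  then have "H.span B = H" unfolding H.basis_def by auto
  then show "G = H" using gen VS.span_li_not_depend(1)[OF _ smG, of B]
      VS.span_li_not_depend(1)[OF _ smH, of B] assms(3) Bli by auto
qed

end

section \<open>Commutators in characteristic 2\<close>

locale assoc_alg2 = assoc_alg F A
  for F :: "('f, 'm) ring_scheme" and A :: "('f, 'a) module" (structure) +
  assumes char2: "\<one>\<^bsub>F\<^esub> \<oplus>\<^bsub>F\<^esub> \<one>\<^bsub>F\<^esub> = \<zero>\<^bsub>F\<^esub>"
begin

lemma add_self [simp]: "x \<in> carrier A \<Longrightarrow> x \<oplus> x = \<zero>"
  using VS.smult_l_distr[of "\<one>\<^bsub>F\<^esub>" "\<one>\<^bsub>F\<^esub>" x] char2 by simp

lemma add_self_left [simp]: "\<lbrakk>x \<in> carrier A; y \<in> carrier A\<rbrakk> \<Longrightarrow> x \<oplus> (x \<oplus> y) = y"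
  by (simp add: A.a_assoc[symmetric])

lemma neg_eq [simp]: "x \<in> carrier A \<Longrightarrow> \<ominus> x = x"
  by (rule A.minus_equality) auto

lemma add_eq_zero_iff: "\<lbrakk>x \<in> carrier A; y \<in> carrier A\<rbrakk> \<Longrightarrow> x \<oplus> y = \<zero> \<longleftrightarrow> x = y"
  by (metis A.r_neg A.r_zero add_self_left neg_eq)

lemmas expand = A.l_distr A.r_distr A.m_assoc A.a_ac smult_mult_l smult_mult_r

text \<open>In characteristic 2 commutator and anticommutator coincide. Hence \<open>ad x\<close> is
  a derivation, and for vectors of a Clifford algebra it also computes the polar form.\<close>

definition ad :: "'a \<Rightarrow> 'a \<Rightarrow> 'a" where "ad x a = x \<otimes> a \<oplus> a \<otimes> x"

lemma ad_closed [simp]: "\<lbrakk>x \<in> carrier A; a \<in> carrier A\<rbrakk> \<Longrightarrow> ad x a \<in> carrier A"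
  by (simp add: ad_def)

lemma ad_add: "\<lbrakk>x \<in> carrier A; a \<in> carrier A; b \<in> carrier A\<rbrakk> \<Longrightarrow> ad x (a \<oplus> b) = ad x a \<oplus> ad x b"
  by (simp add: ad_def expand)

lemma ad_add_left: "\<lbrakk>x \<in> carrier A; y \<in> carrier A; b \<in> carrier A\<rbrakk> \<Longrightarrow> ad (x \<oplus> y) b = ad x b \<oplus> ad y b"
  by (simp add: ad_def expand)

lemma ad_smult: "\<lbrakk>c \<in> carrier F; x \<in> carrier A; a \<in> carrier A\<rbrakk> \<Longrightarrow> ad x (c \<odot> a) = c \<odot> ad x a"
  by (simp add: ad_def VS.smult_r_distr smult_mult_l smult_mult_r)

lemma ad_smult_left: "\<lbrakk>c \<in> carrier F; x \<in> carrier A; a \<in> carrier A\<rbrakk> \<Longrightarrow> ad (c \<odot> x) a = c \<odot> ad x a"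
  by (simp add: ad_def VS.smult_r_distr smult_mult_l smult_mult_r)

lemma ad_mult: "\<lbrakk>x \<in> carrier A; a \<in> carrier A; b \<in> carrier A\<rbrakk> \<Longrightarrow> ad x (a \<otimes> b) = ad x a \<otimes> b \<oplus> a \<otimes> ad x b"
  by (simp add: ad_def expand)

lemma ad_eq_zero: "\<lbrakk>x \<in> carrier A; a \<in> carrier A\<rbrakk> \<Longrightarrow> ad x a = \<zero> \<longleftrightarrow> x \<otimes> a = a \<otimes> x"
  by (simp add: ad_def add_eq_zero_iff)

lemma ad_zero [simp]: "x \<in> carrier A \<Longrightarrow> ad x \<zero> = \<zero>" "x \<in> carrier A \<Longrightarrow> ad \<zero> x = \<zero>"
  by (simp_all add: ad_def)

lemma ad_one: "x \<in> carrier A \<Longrightarrow> ad x \<one> = \<zero>"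
  by (simp add: ad_eq_zero)

text \<open>The two terms x a x cancel, so applying \<open>ad x\<close> twice is the commutator with
  the square of x, which is central.\<close>

lemma ad_ad_square:
  assumes "x \<in> carrier A" "x \<otimes> x \<in> scal" "a \<in> carrier A"
  shows "ad x (ad x a) = \<zero>"
proof -
  have "ad x (ad x a) = x \<otimes> x \<otimes> a \<oplus> a \<otimes> (x \<otimes> x)"
    using assms by (simp add: ad_def expand)
  then show ?thesis using assms scal_commute[OF assms(2,3)] by simp
qed

text \<open>Jacobi identity: the two orders differ by the commutator with the scalar
  \<open>ad x y\<close>.\<close>

lemma ad_ad_commute:
  assumes "x \<in> carrier A" "y \<in> carrier A" "ad x y \<in> scal" "a \<in> carrier A"
  shows "ad x (ad y a) = ad y (ad x a)"
proof -
  have "ad x (ad y a) \<oplus> ad y (ad x a) = ad x y \<otimes> a \<oplus> a \<otimes> ad x y"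
    using assms by (simp add: ad_def expand)
  also have "\<dots> = \<zero>" using assms scal_commute[OF assms(3,4)] by simp
  finally show ?thesis using assms by (simp add: add_eq_zero_iff)
qed

text \<open>By the Leibniz rule, stability under \<open>ad x\<close> has to be checked on generators
  only.\<close>

lemma subalg_ad_stable:
  assumes "subalg F A H" "x \<in> carrier A"
  shows "subalg F A {a \<in> H. ad x a \<in> H}"
  by (rule subalgI) (use assms in \<open>auto simp: subalgD ad_add ad_mult ad_smult ad_one\<close>)

lemma subalg_ad_kernel:
  assumes "subalg F A H" "x \<in> carrier A"
  shows "subalg F A {a \<in> H. ad x a = \<zero>}"
  by (rule subalgI) (use assms in \<open>auto simp: subalgD ad_add ad_mult ad_smult ad_one\<close>)

text \<open>Moving y to the right past an element of the old algebra costs only a commutator, which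
  lies in the old algebra again; and the square of y is a scalar. So no power of y above the first
  is needed.\<close>

lemma alg_generated_insert:
  assumes X: "X \<subseteq> carrier A" and y: "y \<in> carrier A" "y \<otimes> y \<in> scal"
    and ad: "\<And>x. x \<in> X \<Longrightarrow> ad y x \<in> alg_generated F A X"
  shows "alg_generated F A (insert y X)
       = {u \<oplus> v \<otimes> y | u v. u \<in> alg_generated F A X \<and> v \<in> alg_generated F A X}" (is "_ = ?R")
proof
  let ?H = "alg_generated F A X"
  have H: "subalg F A ?H" using subalg_alg_generated[OF X] .
  note HD = subalgD[OF H]
  have "?H \<subseteq> {a \<in> ?H. ad y a \<in> ?H}"
    using ad alg_generated_incl by (intro alg_generated_minimal subalg_ad_stable H y) auto
  then have adH: "ad y a \<in> ?H" if "a \<in> ?H" for a using that by auto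
  have yH: "y \<otimes> y \<in> ?H" using scal_subset[OF H] y by auto
  have I: "u \<oplus> v \<otimes> y \<in> ?R" if "u \<in> ?H" "v \<in> ?H" for u v using that by auto
  have IH: "u \<in> ?R" if "u \<in> ?H" for u
    using I[of u \<zero>] that HD y by auto
  have "subalg F A ?R"
  proof (rule subalgI)
    show "?R \<subseteq> carrier A" using HD y by auto
    show "\<one> \<in> ?R" using IH HD by auto
  next
    fix a b assume "a \<in> ?R" "b \<in> ?R"
    then obtain u v u' v' where *: "a = u \<oplus> v \<otimes> y" "b = u' \<oplus> v' \<otimes> y" "u \<in> ?H" "v \<in> ?H" "u' \<in> ?H" "v' \<in> ?H"
      by blast
    have car: "u \<in> carrier A" "v \<in> carrier A" "u' \<in> carrier A" "v' \<in> carrier A" using * HD by auto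
    have "a \<oplus> b = (u \<oplus> u') \<oplus> (v \<oplus> v') \<otimes> y" using * car y by (simp add: expand)
    then show "a \<oplus> b \<in> ?R" using I * HD by auto
    \<comment> \<open>The commutation rule that collects every y at the right end.\<close>
    have yu: "y \<otimes> u' = u' \<otimes> y \<oplus> ad y u'" "y \<otimes> v' = v' \<otimes> y \<oplus> ad y v'"
      using car y by (simp_all add: ad_def expand)
    have "a \<otimes> b = u \<otimes> u' \<oplus> u \<otimes> v' \<otimes> y \<oplus> v \<otimes> (y \<otimes> u') \<oplus> v \<otimes> ((y \<otimes> v') \<otimes> y)"
      using * car y by (simp add: expand)
    also have "\<dots> = (u \<otimes> u' \<oplus> v \<otimes> ad y u' \<oplus> v \<otimes> v' \<otimes> (y \<otimes> y)) \<oplus> (u \<otimes> v' \<oplus> v \<otimes> u' \<oplus> v \<otimes> ad y v') \<otimes> y"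
      using car y unfolding yu by (simp add: expand)
    finally have "a \<otimes> b = (u \<otimes> u' \<oplus> v \<otimes> ad y u' \<oplus> v \<otimes> v' \<otimes> (y \<otimes> y)) \<oplus> (u \<otimes> v' \<oplus> v \<otimes> u' \<oplus> v \<otimes> ad y v') \<otimes> y" .
    then show "a \<otimes> b \<in> ?R" using I * HD adH yH by auto
  next
    fix c a assume c: "c \<in> carrier F" and "a \<in> ?R"
    then obtain u v where *: "a = u \<oplus> v \<otimes> y" "u \<in> ?H" "v \<in> ?H" by blast
    then have "c \<odot> a = c \<odot> u \<oplus> (c \<odot> v) \<otimes> y"
      using c y HD by (simp add: VS.smult_r_distr smult_mult_l)
    then show "c \<odot> a \<in> ?R" using I * HD c by auto
  qed
  moreover have "y \<in> ?R" using I[of \<zero> \<one>] HD y by auto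
  ultimately show "alg_generated F A (insert y X) \<subseteq> ?R"
    using IH alg_generated_incl[of X] by (intro alg_generated_minimal) blast+
  have sub: "subalg F A (alg_generated F A (insert y X))"
    using X y by (intro subalg_alg_generated) auto
  have "?H \<subseteq> alg_generated F A (insert y X)" by (intro alg_generated_mono) auto
  moreover have "y \<in> alg_generated F A (insert y X)" using alg_generated_incl[of "insert y X"] by auto
  ultimately show "?R \<subseteq> alg_generated F A (insert y X)"
    using subalgD[OF sub] by (auto simp: subset_eq)
qed

lemma spanned_alg_generated:
  assumes y: "\<And>i. i < k \<Longrightarrow> y i \<in> carrier A" "\<And>i. i < k \<Longrightarrow> y i \<otimes> y i \<in> scal"
    and comm: "\<And>i j. \<lbrakk>i < k; j < k\<rbrakk> \<Longrightarrow> ad (y i) (y j) \<in> scal"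
  shows "spanned (alg_generated F A (y ` {..<k})) (2 ^ k)"
  using assms
proof (induction k)
  case 0
  then show ?case using spanned_scal by (simp add: alg_generated_empty)
next
  case (Suc k)
  have X: "y ` {..<k} \<subseteq> carrier A" using Suc.prems(1) by auto
  have eq: "y ` {..<Suc k} = insert (y k) (y ` {..<k})" by (auto simp: lessThan_Suc)
  have "spanned (alg_generated F A (y ` {..<Suc k})) (2 * 2 ^ k)"
    unfolding eq
  proof (rule spanned_double)
    show "spanned (alg_generated F A (y ` {..<k})) (2 ^ k)"
      using Suc.prems by (intro Suc.IH) auto
    show "subspace F (alg_generated F A (insert (y k) (y ` {..<k}))) A"
      using X Suc.prems(1) by (intro subalg_subspace subalg_alg_generated) auto
    have "scal \<subseteq> alg_generated F A (y ` {..<k})" using X by (intro scal_subset subalg_alg_generated)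
    then show "alg_generated F A (insert (y k) (y ` {..<k})) = {u \<oplus> v \<otimes> y k | u v.
        u \<in> alg_generated F A (y ` {..<k}) \<and> v \<in> alg_generated F A (y ` {..<k})}"
      using Suc.prems X by (intro alg_generated_insert) (auto simp: subset_eq)
    show "y k \<in> carrier A" using Suc.prems by auto
  qed
  then show ?case by simp
qed

end

section \<open>Generators with dual elements: exact dimensions\<close>

locale dual_generators = assoc_alg2 F A
  for F :: "('f, 'm) ring_scheme" and A :: "('f, 'a) module" (structure) +
  fixes m :: nat and y ys :: "nat \<Rightarrow> 'a"
  assumes nontrivial: "\<one> \<noteq> \<zero>"
    and y_closed: "\<And>i. i < m \<Longrightarrow> y i \<in> carrier A" and ys_closed: "\<And>i. i < m \<Longrightarrow> ys i \<in> carrier A"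
    and y_square: "\<And>i. i < m \<Longrightarrow> y i \<otimes> y i \<in> scal"
    and y_ad: "\<And>i j. \<lbrakk>i < m; j < m\<rbrakk> \<Longrightarrow> ad (y i) (y j) \<in> scal"
    and dual: "\<And>i j. \<lbrakk>i < m; j < m\<rbrakk> \<Longrightarrow> ad (ys i) (y j) = (if i = j then \<one> else \<zero>)"
begin

abbreviation H :: "nat \<Rightarrow> 'a set" where "H k \<equiv> alg_generated F A (y ` {..<k})"

lemma y_image: "k \<le> m \<Longrightarrow> y ` {..<k} \<subseteq> carrier A"
  using y_closed by auto

lemma H_subalg: "k \<le> m \<Longrightarrow> subalg F A (H k)"
  using y_image by (rule subalg_alg_generated)

lemma H_mono: "k \<le> l \<Longrightarrow> H k \<subseteq> H l"
  by (rule alg_generated_mono) auto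

lemma H_killed:
  assumes "k \<le> j" "j < m" "a \<in> H k"
  shows "ad (ys j) a = \<zero>"
proof -
  have "H k \<subseteq> {a \<in> carrier A. ad (ys j) a = \<zero>}"
    using assms dual y_closed ys_closed by (intro alg_generated_minimal subalg_ad_kernel subalg_carrier) auto
  then show ?thesis using assms by auto
qed

lemma H_Suc:
  assumes "k < m"
  shows "H (Suc k) = {u \<oplus> v \<otimes> y k | u v. u \<in> H k \<and> v \<in> H k}"
proof -
  have eq: "y ` {..<Suc k} = insert (y k) (y ` {..<k})" by (auto simp: lessThan_Suc)
  show ?thesis unfolding eq
    using assms y_image y_square y_closed y_ad scal_subset[OF H_subalg[of k]]
    by (intro alg_generated_insert) auto
qed

text \<open>\<open>ad (ys k)\<close> acts as the partial derivative in \<open>y k\<close>: it kills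
  the earlier generators and reads off the coefficient. In particular u and v are determined by u +
  v y, so the sum is direct.\<close>

lemma ad_H_Suc:
  assumes "k < m" "u \<in> H k" "v \<in> H k"
  shows "ad (ys k) (u \<oplus> v \<otimes> y k) = v"
proof -
  have car: "u \<in> carrier A" "v \<in> carrier A" using assms subalgD[OF H_subalg[of k]] by auto
  show ?thesis
    using assms car ys_closed y_closed dual H_killed[of k k]
    by (simp add: ad_add ad_mult)
qed

lemma H_kernel: "k < m \<Longrightarrow> {a \<in> H (Suc k). ad (ys k) a = \<zero>} = H k"
proof (intro equalityI subsetI)
  fix a assume k: "k < m" and a: "a \<in> {a \<in> H (Suc k). ad (ys k) a = \<zero>}"
  then obtain u v where *: "a = u \<oplus> v \<otimes> y k" "u \<in> H k" "v \<in> H k" using H_Suc by auto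
  then have "v = \<zero>" using a ad_H_Suc k by auto
  then show "a \<in> H k" using * y_closed k subalgD[OF H_subalg[of k]] by auto
next
  fix a assume "k < m" and "a \<in> H k"
  then show "a \<in> {a \<in> H (Suc k). ad (ys k) a = \<zero>}" using H_killed[of k k] H_mono[of k "Suc k"] by auto
qed

lemma H_image: "k < m \<Longrightarrow> ad (ys k) ` H (Suc k) = H k"
proof (intro equalityI subsetI)
  fix v assume k: "k < m" and v: "v \<in> H k"
  then have "\<zero> \<oplus> v \<otimes> y k \<in> H (Suc k)" using H_Suc subalgD(2)[OF H_subalg[of k]] by force
  moreover have "ad (ys k) (\<zero> \<oplus> v \<otimes> y k) = v"
    using k v subalgD(2)[OF H_subalg[of k]] by (intro ad_H_Suc) auto
  ultimately show "v \<in> ad (ys k) ` H (Suc k)" by force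
qed (auto simp: H_Suc ad_H_Suc)

text \<open>An element killed by the derivatives in the last generators does not involve them. With
  k = n this identifies the centralizer of \<open>S0\<close>, and with k = 0 it shows that traces
  are scalars.\<close>

lemma H_kernels:
  assumes "k \<le> l" "l \<le> m" "a \<in> H l" "\<And>j. \<lbrakk>k \<le> j; j < l\<rbrakk> \<Longrightarrow> ad (ys j) a = \<zero>"
  shows "a \<in> H k"
  using assms
proof (induction l)
  case (Suc l)
  show ?case
  proof (cases "k = Suc l")
    case False
    then have "a \<in> H l" using H_kernel[of l] Suc.prems by auto
    then show ?thesis using Suc False by auto
  qed (use Suc.prems in simp)
qed simp

text \<open>Rank-nullity for \<open>ad (ys k)\<close>: its image and its kernel on
  \<open>H (Suc k)\<close> are both \<open>H k\<close>, so the dimension doubles. The start of the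
  recursion needs 1 \<noteq> 0.\<close>

lemma H_has_dim: "k \<le> m \<Longrightarrow> has_dim F (A\<lparr>carrier := H k\<rparr>) (2 ^ k)"
proof (induction k)
  case 0
  interpret S: vectorspace F "A\<lparr>carrier := scal\<rparr>"
    by (rule VS.subspace_is_vs[OF subalg_subspace[OF subalg_scal]])
  have fd: "S.fin_dim" and le: "S.dim \<le> 1" using spanned_dim[OF spanned_scal] by auto
  have one: "\<one> \<in> scal" using subalgD(3)[OF subalg_scal] .
  have "S.dim \<noteq> 0"
  proof
    assume "S.dim = 0"
    then obtain B where B: "finite B" "S.basis B" "card B = 0"
      using S.finite_basis_exists[OF fd] S.dim_basis by auto
    then have "S.span {} = scal" by (auto simp: S.basis_def)
    then have "scal = {\<zero>}" using S.span_empty by auto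
    then show False using one nontrivial by auto
  qed
  then have "S.dim = 1" using le by auto
  then show ?case using fd unfolding has_dim_def by (simp add: alg_generated_empty)
next
  case (Suc k)
  then have k: "k < m" by simp
  have sub: "subspace F (H (Suc k)) A" using k by (intro subalg_subspace H_subalg) auto
  have fd: "vectorspace.fin_dim F (A\<lparr>carrier := H (Suc k)\<rparr>)"
    using k y_closed y_square y_ad by (intro spanned_dim(1)[OF spanned_alg_generated]) auto
  have car: "\<And>x. x \<in> H (Suc k) \<Longrightarrow> x \<in> carrier A" using k subalgD[OF H_subalg[of "Suc k"]] by auto
  have "ad (ys k) x \<in> H (Suc k)" if "x \<in> H (Suc k)" for x
    using H_image[OF k] H_mono[of k "Suc k"] that by auto
  from dim_ker_im[OF sub fd, of "ad (ys k)", OF this]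
  show ?case using Suc k fd H_image[OF k] H_kernel[OF k] car ys_closed
    by (simp add: has_dim_def ad_add ad_smult)
qed

end

section \<open>Centralizers of commuting generators and the bimodule S g S\<close>

context assoc_alg2
begin

lemma alg_centralizer_insert:
  assumes "x \<in> carrier A"
  shows "alg_centralizer A (insert x Y) = {a \<in> alg_centralizer A Y. ad x a = \<zero>}"
  using assms by (auto simp: alg_centralizer_def ad_eq_zero)

primrec ads :: "'a list \<Rightarrow> 'a \<Rightarrow> 'a" where
  "ads [] a = a"
| "ads (x # xs) a = ad x (ads xs a)"

text \<open>x commutes with \<open>xs\<close>, so x lies in their centralizer, which is a subalgebra
  and thus stable under \<open>ad x\<close>; and a second \<open>ad x\<close> gives zero.\<close>

lemma ad_centralizer:
  assumes "set (x # xs) \<subseteq> carrier A" "\<And>u v. \<lbrakk>u \<in> set (x # xs); v \<in> set (x # xs)\<rbrakk> \<Longrightarrow> u \<otimes> v = v \<otimes> u"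
    and "x \<otimes> x \<in> scal" "z \<in> alg_centralizer A (set xs)"
  shows "ad x z \<in> alg_centralizer A (set (x # xs))"
proof -
  have Z: "subalg F A (alg_centralizer A (set xs))" using assms by (intro subalg_centralizer) auto
  have "x \<in> alg_centralizer A (set xs)" using assms(1,2) by (auto simp: alg_centralizer_def)
  then have "ad x z \<in> alg_centralizer A (set xs)" using assms(4) subalgD[OF Z] by (auto simp: ad_def)
  moreover have "ad x (ad x z) = \<zero>" using assms by (intro ad_ad_square) (auto simp: alg_centralizer_def)
  ultimately show ?thesis using assms(1) by (simp add: alg_centralizer_insert)
qed

text \<open>Each generator at most halves the centralizer, because \<open>ad x\<close> maps the centralizer of the earlier
  generators into its own kernel. If every step is an exact halving, each \<open>ad x\<close> is onto that kernel.\<close>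
lemma alg_centralizer_dim:
  assumes fd: "vectorspace.fin_dim F A" and "set xs \<subseteq> carrier A"
    and "\<And>u v. \<lbrakk>u \<in> set xs; v \<in> set xs\<rbrakk> \<Longrightarrow> u \<otimes> v = v \<otimes> u" "\<And>u. u \<in> set xs \<Longrightarrow> u \<otimes> u \<in> scal"
  shows "vectorspace.dim F A \<le> 2 ^ length xs * vectorspace.dim F (A\<lparr>carrier := alg_centralizer A (set xs)\<rparr>)"
      (is "?le")
    and "vectorspace.dim F A = 2 ^ length xs * vectorspace.dim F (A\<lparr>carrier := alg_centralizer A (set xs)\<rparr>)
      \<Longrightarrow> \<forall>a\<in>alg_centralizer A (set xs). \<exists>g\<in>carrier A. ads xs g = a" (is "?eq \<Longrightarrow> ?surj")
proof -
  have "?le \<and> (?eq \<longrightarrow> ?surj)"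
    using assms(2-)
  proof (induction xs)
    case Nil
    have "alg_centralizer A {} = carrier A" by (auto simp: alg_centralizer_def)
    then show ?case by auto
  next
    case (Cons x xs)
    let ?Z = "alg_centralizer A (set xs)" and ?Z' = "alg_centralizer A (set (x # xs))"
    let ?d = "\<lambda>Z. vectorspace.dim F (A\<lparr>carrier := Z\<rparr>)"
    have x: "x \<in> carrier A" and xs: "set xs \<subseteq> carrier A" using Cons.prems by auto
    have IH: "vectorspace.dim F A \<le> 2 ^ length xs * ?d ?Z"
      "vectorspace.dim F A = 2 ^ length xs * ?d ?Z \<Longrightarrow> \<forall>a\<in>?Z. \<exists>g\<in>carrier A. ads xs g = a"
      using Cons by auto
    have sub: "subspace F ?Z A" "subspace F ?Z' A"
      using Cons.prems(1) by (auto intro!: subalg_subspace subalg_centralizer)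
    have Zcar: "?Z \<subseteq> carrier A" by (auto simp: alg_centralizer_def)
    have fdA: "vectorspace.fin_dim F (A\<lparr>carrier := carrier A\<rparr>)" using fd by simp
    have fdZ: "vectorspace.fin_dim F (A\<lparr>carrier := ?Z\<rparr>)"
      by (rule dim_subspace_fin(1)[OF subalg_subspace[OF subalg_carrier] sub(1) Zcar fdA])
    have Z'Z: "?Z' \<subseteq> ?Z" by (auto simp: alg_centralizer_def)
    have fdZ': "vectorspace.fin_dim F (A\<lparr>carrier := ?Z'\<rparr>)"
      by (rule dim_subspace_fin(1)[OF sub Z'Z fdZ])
    have adZ: "ad x z \<in> ?Z'" if "z \<in> ?Z" for z
      using Cons.prems that by (intro ad_centralizer) auto
    have sumZ: "?d (ad x ` ?Z) + ?d {z \<in> ?Z. ad x z = \<zero>} = ?d ?Z"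
      using adZ Z'Z Zcar x by (intro dim_ker_im sub fdZ) (auto simp: ad_add ad_smult subset_eq)
    have ker: "{z \<in> ?Z. ad x z = \<zero>} = ?Z'" using x by (simp add: alg_centralizer_insert)
    have subI: "subspace F (ad x ` ?Z) A"
    proof (rule subspaceI)
      have sm: "submodule F ?Z A" using sub by (simp add: subspace_def)
      show "ad x ` ?Z \<subseteq> carrier A" using x Zcar by auto
      show "\<zero> \<in> ad x ` ?Z" using submodule.zero_closed[OF sm] x by (intro image_eqI[of _ _ \<zero>]) auto
    next
      have sm: "submodule F ?Z A" using sub by (simp add: subspace_def)
      fix a c assume "a \<in> ad x ` ?Z" and c: "c \<in> carrier F"
      then obtain a' where a': "a = ad x a'" "a' \<in> ?Z" by auto
      then show "c \<odot> a \<in> ad x ` ?Z" using c submodule.smult_closed[OF sm] x Zcar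
        by (intro image_eqI[of _ _ "c \<odot> a'"]) (auto simp: ad_smult subset_eq)
    next
      have sm: "submodule F ?Z A" using sub by (simp add: subspace_def)
      fix a b assume "a \<in> ad x ` ?Z" "b \<in> ad x ` ?Z"
      then obtain a' where a': "a = ad x a'" "a' \<in> ?Z" by auto
      from \<open>b \<in> ad x ` ?Z\<close> obtain b' where b': "b = ad x b'" "b' \<in> ?Z" by auto
      show "a \<oplus> b \<in> ad x ` ?Z" using a' b' submodule.m_closed[OF sm] x Zcar
        by (intro image_eqI[of _ _ "a' \<oplus> b'"]) (auto simp: ad_add subset_eq)
    qed
    have imZ': "ad x ` ?Z \<subseteq> ?Z'" using adZ by auto
    note im = dim_subspace_fin[OF sub(2) subI imZ' fdZ']
    have le: "?d ?Z \<le> 2 * ?d ?Z'" using sumZ im(2) unfolding ker by linarith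
    have "vectorspace.dim F A \<le> 2 ^ length xs * (2 * ?d ?Z')"
      using IH(1) le by (meson le_trans mult_le_mono2)
    moreover have "\<exists>g\<in>carrier A. ads (x # xs) g = a"
      if eq: "vectorspace.dim F A = 2 ^ length (x # xs) * ?d ?Z'" and a: "a \<in> ?Z'" for a
    proof -
      \<comment> \<open>Equality after the last generator forces equality at every earlier one: the
        bound for \<open>xs\<close> leaves no room for a step that loses less than half.\<close>
      have "2 ^ length xs * (2 * ?d ?Z') \<le> 2 ^ length xs * ?d ?Z" using eq IH(1) by simp
      then have "?d ?Z = 2 * ?d ?Z'" using le by simp
      then have "ad x ` ?Z = ?Z'" using im(3) sumZ unfolding ker by simp
      then have "a \<in> ad x ` ?Z" using a by simp
      then obtain z where z: "z \<in> ?Z" "ad x z = a" by (auto simp only: image_iff)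
      have "vectorspace.dim F A = 2 ^ length xs * ?d ?Z" using eq \<open>?d ?Z = 2 * ?d ?Z'\<close> by simp
      from IH(2)[OF this] z show ?thesis by auto
    qed
    ultimately show ?case by auto
  qed
  then show ?le and "?eq \<Longrightarrow> ?surj" by simp_all
qed

text \<open>The additive span S h S. The inductive form lets additive maps be treated by induction;
  for a subalgebra S, scalar multiples are absorbed by the factors s and t.\<close>

inductive_set bimod :: "'a set \<Rightarrow> 'a \<Rightarrow> 'a set" for S h where
  base: "\<lbrakk>s \<in> S; t \<in> S\<rbrakk> \<Longrightarrow> s \<otimes> h \<otimes> t \<in> bimod S h"
| add: "\<lbrakk>a \<in> bimod S h; b \<in> bimod S h\<rbrakk> \<Longrightarrow> a \<oplus> b \<in> bimod S h"

lemma bimod_subset: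
  assumes "subalg F A Z" "S \<subseteq> Z" "h \<in> Z"
  shows "bimod S h \<subseteq> Z"
proof
  fix b assume "b \<in> bimod S h"
  then show "b \<in> Z" by induction (use assms in \<open>auto simp: subalgD subset_eq\<close>)
qed

text \<open>x is absorbed into either factor from S, whence the first claim. For the second,
  \<open>ad x\<close> is linear over S on both sides because x commutes with S, so s (ad x h) t is
  the image of s h t.\<close>

lemma bimod_ad:
  assumes S: "subalg F A S" and comm: "\<And>u v. \<lbrakk>u \<in> S; v \<in> S\<rbrakk> \<Longrightarrow> u \<otimes> v = v \<otimes> u"
    and x: "x \<in> S" and h: "h \<in> carrier A" and b: "b \<in> bimod S (ad x h)"
  shows "b \<in> bimod S h" "b \<in> ad x ` bimod S h"
proof -
  note SD = subalgD[OF S]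
  have hc: "bimod S h \<subseteq> carrier A" using bimod_subset[OF subalg_carrier SD(1) h] .
  have "b \<in> bimod S h \<and> b \<in> ad x ` bimod S h"
    using b
  proof (induction rule: bimod.induct)
    case (base s t)
    have car: "s \<in> carrier A" "t \<in> carrier A" "x \<in> carrier A" using base x SD by auto
    have "s \<otimes> ad x h \<otimes> t = (s \<otimes> x) \<otimes> h \<otimes> t \<oplus> s \<otimes> h \<otimes> (x \<otimes> t)"
      using car h by (simp add: ad_def expand)
    then have "s \<otimes> ad x h \<otimes> t \<in> bimod S h" using base x SD by (simp add: bimod.intros)
    moreover have "ad x (s \<otimes> h \<otimes> t) = s \<otimes> ad x h \<otimes> t"
      using car h comm[OF x base(1)] comm[OF x base(2)] by (simp add: ad_mult ad_eq_zero[THEN iffD2])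
    ultimately show ?case using base by (metis bimod.base image_eqI)
  next
    case (add a b)
    then obtain a' b' where "a = ad x a'" "a' \<in> bimod S h" "b = ad x b'" "b' \<in> bimod S h" by auto
    then have "a \<oplus> b = ad x (a' \<oplus> b')" "a' \<oplus> b' \<in> bimod S h"
      using hc SD x by (auto simp: ad_add subset_eq bimod.add)
    then show ?case using add(3,4) by (metis bimod.add image_eqI)
  qed
  then show "b \<in> bimod S h" "b \<in> ad x ` bimod S h" by auto
qed

text \<open>Statements about centralizers are lifted one generator at a time, from the full list
  back to the empty one, whose centralizer is all of A.\<close>

lemma bimod_total_aux:
  assumes S: "subalg F A S" and comm: "\<And>u v. \<lbrakk>u \<in> S; v \<in> S\<rbrakk> \<Longrightarrow> u \<otimes> v = v \<otimes> u"
    and sq: "\<And>u. u \<in> S \<Longrightarrow> u \<otimes> u \<in> scal" and g: "g \<in> carrier A"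
  shows "\<lbrakk>set xs \<subseteq> S; alg_centralizer A (set xs) \<subseteq> bimod S (ads xs g)\<rbrakk> \<Longrightarrow> carrier A \<subseteq> bimod S g"
proof (induction xs)
  case Nil
  then show ?case by (simp add: alg_centralizer_def)
next
  case (Cons x xs)
  note SD = subalgD[OF S]
  have h_cent: "ads ys g \<in> alg_centralizer A (set ys)" if "set ys \<subseteq> S" for ys
    using that
  proof (induction ys)
    case Nil
    then show ?case using g by (simp add: alg_centralizer_def)
  next
    case (Cons y ys)
    have "ad y (ads ys g) \<in> alg_centralizer A (set (y # ys))"
      using Cons SD(7) by (intro ad_centralizer) (auto intro: comm sq)
    then show ?case by simp
  qed
  let ?Z = "alg_centralizer A (set xs)" and ?h = "ads xs g"
  have Z: "subalg F A ?Z" using Cons.prems SD by (intro subalg_centralizer) auto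
  have SZ: "S \<subseteq> ?Z" using Cons.prems(1) comm SD by (auto simp: alg_centralizer_def subset_eq)
  have x: "x \<in> S" "x \<in> carrier A" and xs: "set xs \<subseteq> S" using Cons.prems SD by auto
  have hZ: "?h \<in> ?Z" using h_cent xs by auto
  then have hA: "?h \<in> carrier A" by (auto simp: alg_centralizer_def)
  have "?Z \<subseteq> bimod S ?h"
  proof
    fix a assume a: "a \<in> ?Z"
    have aA: "a \<in> carrier A" using a by (auto simp: alg_centralizer_def)
    have "ad x a \<in> alg_centralizer A (set (x # xs))"
      using Cons.prems(1) SD(7) a by (intro ad_centralizer) (auto intro: comm sq)
    \<comment> \<open>The derivative of a agrees with that of some b in S h S. Then a + b has
      derivative zero, so it lies in the smaller centralizer, where the claim is already
      available.\<close>
    then have "ad x a \<in> bimod S (ad x ?h)" using Cons.prems(2) by auto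
    then obtain b where b: "b \<in> bimod S ?h" "ad x a = ad x b"
      using bimod_ad(2)[OF S comm x(1) hA] by blast
    have bZ: "b \<in> ?Z" using bimod_subset[OF Z SZ hZ] b by auto
    then have bA: "b \<in> carrier A" by (auto simp: alg_centralizer_def)
    have "ad x (a \<oplus> b) = \<zero>" using b x aA bA by (simp add: ad_add)
    then have "a \<oplus> b \<in> alg_centralizer A (set (x # xs))"
      using a bZ x subalgD(4)[OF Z] by (simp add: alg_centralizer_insert)
    then have "a \<oplus> b \<in> bimod S (ad x ?h)" using Cons.prems(2) by auto
    then have "a \<oplus> b \<in> bimod S ?h" using bimod_ad(1)[OF S comm x(1) hA] by blast
    then have "b \<oplus> (a \<oplus> b) \<in> bimod S ?h" by (rule bimod.add[OF b(1)])
    moreover have "b \<oplus> (a \<oplus> b) = a" using aA bA by (simp add: A.a_comm[of a b])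
    ultimately show "a \<in> bimod S ?h" by metis
  qed
  then show ?case using Cons.IH xs by auto
qed

text \<open>The centralizer of X is S, so n generators reduce dimension
  \<open>(2 ^ n)\<^sup>2\<close> to \<open>2 ^ n\<close> and every step is an exact halving. Hence
  1, an element of S, equals \<open>ads xs g\<close> for some g, and S = S 1 S starts the
  lifting.\<close>

lemma bimod_total:
  assumes fd: "has_dim F A ((2 ^ n)\<^sup>2)" and S: "subalg F A S" and self: "alg_centralizer A S = S"
    and sq: "\<And>u. u \<in> S \<Longrightarrow> u \<otimes> u \<in> scal" and dimS: "has_dim F (A\<lparr>carrier := S\<rparr>) (2 ^ n)"
    and X: "X \<subseteq> S" "finite X" "card X = n" "alg_generated F A X = S"
  shows "\<exists>g\<in>carrier A. carrier A = bimod S g"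
proof -
  note SD = subalgD[OF S]
  have comm: "\<And>u v. \<lbrakk>u \<in> S; v \<in> S\<rbrakk> \<Longrightarrow> u \<otimes> v = v \<otimes> u"
    using self unfolding alg_centralizer_def by blast
  obtain xs where xs: "set xs = X" "distinct xs" using X(2) finite_distinct_list by blast
  have len: "length xs = n" using xs X(3) distinct_card by force
  have cent: "alg_centralizer A (set xs) = S"
    using alg_centralizer_generated[of X] X self xs SD by auto
  have "vectorspace.dim F A = 2 ^ length xs * vectorspace.dim F (A\<lparr>carrier := alg_centralizer A (set xs)\<rparr>)"
    using fd dimS unfolding cent len has_dim_def by (simp add: power2_eq_square)
  moreover have "vectorspace.fin_dim F A" using fd by (simp add: has_dim_def)
  ultimately have "\<forall>a\<in>alg_centralizer A (set xs). \<exists>g\<in>carrier A. ads xs g = a"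
    using X(1) xs(1) SD(1) by (intro alg_centralizer_dim(2)) (auto intro: comm sq)
  then obtain g where g: "g \<in> carrier A" "ads xs g = \<one>" unfolding cent using SD(3) by blast
  have "S \<subseteq> bimod S \<one>"
  proof
    fix s assume "s \<in> S"
    then show "s \<in> bimod S \<one>" using bimod.base[of s S \<one> \<one>] SD by simp
  qed
  then have "carrier A \<subseteq> bimod S g"
    using X xs g cent by (intro bimod_total_aux[OF S comm sq, of g xs]) auto
  moreover have "bimod S g \<subseteq> carrier A" by (rule bimod_subset[OF subalg_carrier SD(1) g(1)])
  ultimately show ?thesis using g by blast
qed

end

section \<open>Quotients and free algebras\<close>

definition alg_hom :: "('f, 'm) ring_scheme \<Rightarrow> ('f, 'a) module \<Rightarrow> ('f, 'b) module \<Rightarrow> ('a \<Rightarrow> 'b) \<Rightarrow> bool" where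
  "alg_hom F A B h \<longleftrightarrow> h \<in> ring_hom A B \<and> h \<in> module_hom F A B"

lemma alg_homI:
  assumes "\<And>x. x \<in> carrier A \<Longrightarrow> h x \<in> carrier B"
    "\<And>x y. \<lbrakk>x \<in> carrier A; y \<in> carrier A\<rbrakk> \<Longrightarrow> h (x \<otimes>\<^bsub>A\<^esub> y) = h x \<otimes>\<^bsub>B\<^esub> h y"
    "\<And>x y. \<lbrakk>x \<in> carrier A; y \<in> carrier A\<rbrakk> \<Longrightarrow> h (x \<oplus>\<^bsub>A\<^esub> y) = h x \<oplus>\<^bsub>B\<^esub> h y"
    "\<And>c x. \<lbrakk>c \<in> carrier F; x \<in> carrier A\<rbrakk> \<Longrightarrow> h (c \<odot>\<^bsub>A\<^esub> x) = c \<odot>\<^bsub>B\<^esub> h x"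
    "h \<one>\<^bsub>A\<^esub> = \<one>\<^bsub>B\<^esub>"
  shows "alg_hom F A B h"
  using assms by (auto simp: alg_hom_def ring_hom_def module_hom_def)

lemma alg_homD:
  assumes "alg_hom F A B h"
  shows "\<And>x. x \<in> carrier A \<Longrightarrow> h x \<in> carrier B"
    "\<And>x y. \<lbrakk>x \<in> carrier A; y \<in> carrier A\<rbrakk> \<Longrightarrow> h (x \<otimes>\<^bsub>A\<^esub> y) = h x \<otimes>\<^bsub>B\<^esub> h y"
    "\<And>x y. \<lbrakk>x \<in> carrier A; y \<in> carrier A\<rbrakk> \<Longrightarrow> h (x \<oplus>\<^bsub>A\<^esub> y) = h x \<oplus>\<^bsub>B\<^esub> h y"
    "\<And>c x. \<lbrakk>c \<in> carrier F; x \<in> carrier A\<rbrakk> \<Longrightarrow> h (c \<odot>\<^bsub>A\<^esub> x) = c \<odot>\<^bsub>B\<^esub> h x"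
    "h \<one>\<^bsub>A\<^esub> = \<one>\<^bsub>B\<^esub>"
  using assms by (auto simp: alg_hom_def ring_hom_def module_hom_def)

lemma alg_hom_comp: "\<lbrakk>alg_hom F A B f; alg_hom F B C g\<rbrakk> \<Longrightarrow> alg_hom F A C (g \<circ> f)"
  by (rule alg_homI) (auto simp: alg_homD)

lemma alg_hom_zero:
  assumes "assoc_alg F A" "assoc_alg F B" "alg_hom F A B h"
  shows "h \<zero>\<^bsub>A\<^esub> = \<zero>\<^bsub>B\<^esub>" and "\<And>x y. \<lbrakk>x \<in> carrier A; y \<in> carrier A\<rbrakk> \<Longrightarrow> h (x \<ominus>\<^bsub>A\<^esub> y) = h x \<ominus>\<^bsub>B\<^esub> h y"
    and "ideal (a_kernel A B h) A"
proof -
  interpret A: assoc_alg F A by fact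
  interpret B: assoc_alg F B by fact
  interpret h: ring_hom_ring A B h
    using assms(3) A.A.ring_axioms B.A.ring_axioms by (intro ring_hom_ringI2) (auto simp: alg_hom_def)
  show "h \<zero>\<^bsub>A\<^esub> = \<zero>\<^bsub>B\<^esub>" by simp
  show "\<And>x y. \<lbrakk>x \<in> carrier A; y \<in> carrier A\<rbrakk> \<Longrightarrow> h (x \<ominus>\<^bsub>A\<^esub> y) = h x \<ominus>\<^bsub>B\<^esub> h y"
    by (simp add: a_minus_def)
  show "ideal (a_kernel A B h) A" by (rule h.kernel_is_ideal)
qed

lemma alg_hom_vanish_genideal:
  assumes "assoc_alg F A" "assoc_alg F B" "alg_hom F A B h"
    and "R \<subseteq> carrier A" "\<And>r. r \<in> R \<Longrightarrow> h r = \<zero>\<^bsub>B\<^esub>" "x \<in> genideal A R"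
  shows "h x = \<zero>\<^bsub>B\<^esub>"
proof -
  interpret A: assoc_alg F A by fact
  have "genideal A R \<subseteq> a_kernel A B h"
    using assms alg_hom_zero(3)[OF assms(1-3)] by (intro A.A.genideal_minimal) (auto simp: a_kernel_def')
  then show ?thesis using assms(6) by (auto simp: a_kernel_def')
qed

context assoc_alg
begin

lemma alg_quot_simps:
  assumes "ideal I A"
  shows "carrier (alg_quot A I) = {I +> a | a. a \<in> carrier A}"
    "\<zero>\<^bsub>alg_quot A I\<^esub> = I" "\<one>\<^bsub>alg_quot A I\<^esub> = I +> \<one>"
    "\<And>a b. \<lbrakk>a \<in> carrier A; b \<in> carrier A\<rbrakk> \<Longrightarrow> (I +> a) \<oplus>\<^bsub>alg_quot A I\<^esub> (I +> b) = I +> (a \<oplus> b)"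
    "\<And>a b. \<lbrakk>a \<in> carrier A; b \<in> carrier A\<rbrakk> \<Longrightarrow> (I +> a) \<otimes>\<^bsub>alg_quot A I\<^esub> (I +> b) = I +> (a \<otimes> b)"
    "\<And>c a. \<lbrakk>c \<in> carrier F; a \<in> carrier A\<rbrakk> \<Longrightarrow> c \<odot>\<^bsub>alg_quot A I\<^esub> (I +> a) = I +> (c \<odot> a)"
proof -
  interpret I: ideal I A by fact
  show "carrier (alg_quot A I) = {I +> a | a. a \<in> carrier A}"
    by (auto simp: alg_quot_def FactRing_def A_RCOSETS_def')
  show "\<zero>\<^bsub>alg_quot A I\<^esub> = I" "\<one>\<^bsub>alg_quot A I\<^esub> = I +> \<one>"
    by (simp_all add: alg_quot_def FactRing_def)
  show "(I +> a) \<oplus>\<^bsub>alg_quot A I\<^esub> (I +> b) = I +> (a \<oplus> b)" if "a \<in> carrier A" "b \<in> carrier A" for a b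
    using that by (simp add: alg_quot_def FactRing_def I.a_rcos_sum)
  show "(I +> a) \<otimes>\<^bsub>alg_quot A I\<^esub> (I +> b) = I +> (a \<otimes> b)" if "a \<in> carrier A" "b \<in> carrier A" for a b
    using that by (simp add: alg_quot_def FactRing_def I.rcoset_mult_add)
  show "c \<odot>\<^bsub>alg_quot A I\<^esub> (I +> a) = I +> (c \<odot> a)" if c: "c \<in> carrier F" and a: "a \<in> carrier A" for c a
  proof -
    have eq: "I +> (c \<odot> x) = I +> (c \<odot> a)" if x: "x \<in> I +> a" for x
    proof -
      obtain i where i: "i \<in> I" "x = i \<oplus> a" using x by (auto simp: a_r_coset_def')
      have iA: "i \<in> carrier A" using i I.a_subset by auto
      \<comment> \<open>A ring ideal is automatically a subspace, since scaling by c is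
        multiplication by the element c 1. This makes the scalar action on cosets well
        defined.\<close>
      have "c \<odot> x = (c \<odot> \<one>) \<otimes> i \<oplus> c \<odot> a" using i iA a c by (simp add: VS.smult_r_distr smult_mult_l)
      moreover have "(c \<odot> \<one>) \<otimes> i \<in> I" using I.I_l_closed i c by auto
      ultimately have "c \<odot> x \<in> I +> (c \<odot> a)" by (auto simp: a_r_coset_def')
      then show ?thesis using I.a_repr_independence' c a by (metis VS.smult_closed)
    qed
    have "I +> a \<noteq> {}" using I.a_rcos_self[OF a] by blast
    then have "(\<Union>x\<in>I +> a. I +> (c \<odot> x)) = I +> (c \<odot> a)" by (rule SUP_eq_const) (rule eq)
    then show ?thesis by (simp add: alg_quot_def)
  qed
qed

lemma assoc_alg_quot:
  assumes "ideal I A"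
  shows "assoc_alg F (alg_quot A I)"
proof -
  interpret I: ideal I A by fact
  note Q = alg_quot_simps[OF assms]
  have z: "\<zero>\<^bsub>alg_quot A I\<^esub> = I +> \<zero>" using I.a_rcos_const[of \<zero>] by (simp add: Q(2))
  have ab: "abelian_group (alg_quot A I)"
  proof (rule abelian_groupI)
    fix x assume "x \<in> carrier (alg_quot A I)"
    then obtain a where a: "x = I +> a" "a \<in> carrier A" by (auto simp: Q(1))
    show "\<exists>y\<in>carrier (alg_quot A I). y \<oplus>\<^bsub>alg_quot A I\<^esub> x = \<zero>\<^bsub>alg_quot A I\<^esub>"
      by (intro bexI[of _ "I +> (\<ominus> a)"]) (use a in \<open>auto simp: Q(1,4) z A.l_neg\<close>)
  next
    show "\<zero>\<^bsub>alg_quot A I\<^esub> \<in> carrier (alg_quot A I)" unfolding Q(1) z by blast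
    fix x y assume "x \<in> carrier (alg_quot A I)" "y \<in> carrier (alg_quot A I)"
    then obtain a b where a: "x = I +> a" "a \<in> carrier A" "y = I +> b" "b \<in> carrier A" by (auto simp: Q(1))
    show "x \<oplus>\<^bsub>alg_quot A I\<^esub> y = y \<oplus>\<^bsub>alg_quot A I\<^esub> x" using a by (simp add: Q(4) A.a_comm)
  qed (auto simp: Q(1,4) z A.a_assoc)
  have r: "ring (alg_quot A I)"
  proof (rule ringI[OF ab])
    show "Group.monoid (alg_quot A I)"
      by (rule monoidI) (auto simp: Q(1,3,5) A.m_assoc)
  qed (auto simp: Q(1,4,5) A.l_distr A.r_distr)
  then interpret Q: ring "alg_quot A I" .
  have m: "module F (alg_quot A I)"
    using Q.abelian_group_axioms F.is_cring
    by (intro moduleI) (auto simp: Q(1,4,6) VS.smult_l_distr VS.smult_r_distr VS.smult_assoc1)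
  then show ?thesis
    using r F.field_axioms
    by (intro assoc_algI vectorspace.intro) (auto simp: Q(1,5,6) smult_mult_l smult_mult_r)
qed

lemma alg_hom_proj: "ideal I A \<Longrightarrow> alg_hom F A (alg_quot A I) ((+>) I)"
  by (rule alg_homI) (auto simp: alg_quot_simps)

lemma coset_eq_iff:
  assumes "ideal I A" "a \<in> carrier A" "b \<in> carrier A"
  shows "I +> a = I +> b \<longleftrightarrow> a \<ominus> b \<in> I"
  using A.quotient_eq_iff_same_a_r_cos[OF assms] by auto

lemma coset_zero_iff:
  assumes "ideal I A" "a \<in> carrier A"
  shows "I +> a = \<zero>\<^bsub>alg_quot A I\<^esub> \<longleftrightarrow> a \<in> I"
proof -
  interpret I: ideal I A by fact
  show ?thesis
    using assms I.a_rcos_self[of a] I.a_rcos_const[of a] by (auto simp: alg_quot_simps)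
qed

lemma alg_quot_lift:
  assumes I: "ideal I A" and B: "assoc_alg F B" and h: "alg_hom F A B h"
    and van: "\<And>x. x \<in> I \<Longrightarrow> h x = \<zero>\<^bsub>B\<^esub>"
  shows "\<exists>g. alg_hom F (alg_quot A I) B g \<and> (\<forall>a\<in>carrier A. g (I +> a) = h a)"
proof -
  interpret B: assoc_alg F B by fact
  define g where "g X = h (SOME a. a \<in> carrier A \<and> X = I +> a)" for X
  have g: "g (I +> a) = h a" if a: "a \<in> carrier A" for a
  proof -
    let ?b = "SOME b. b \<in> carrier A \<and> I +> a = I +> b"
    have b: "?b \<in> carrier A" "I +> a = I +> ?b"
      using someI[of "\<lambda>b. b \<in> carrier A \<and> I +> a = I +> b" a] a by auto
    then have "a \<ominus> ?b \<in> I" using coset_eq_iff[OF I a] by blast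
    then have "h a \<ominus>\<^bsub>B\<^esub> h ?b = \<zero>\<^bsub>B\<^esub>"
      using van alg_hom_zero(2)[OF assoc_alg_axioms B h a b(1)] by auto
    then have "h a = h ?b" using a b alg_homD[OF h] by (simp add: B.A.r_right_minus_eq)
    then show ?thesis by (simp add: g_def)
  qed
  have "alg_hom F (alg_quot A I) B g"
    by (rule alg_homI) (auto simp: alg_quot_simps[OF I] g alg_homD[OF h])
  with g show ?thesis by blast
qed

end

section \<open>Free algebras: ring axioms, linear extension, evaluation\<close>

locale free_algebra = field F for F :: "('f, 'm) ring_scheme" (structure) +
  fixes X :: "'v set"
begin

abbreviation "M \<equiv> free_alg F X"

definition mono :: "'f \<Rightarrow> 'v list \<Rightarrow> 'v list \<Rightarrow> 'f" where
  "mono c w = (\<lambda>v. if v = w then c else \<zero>)"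

lemma free_carrier: "p \<in> carrier M \<longleftrightarrow> (\<forall>w. p w \<in> carrier F) \<and> (\<forall>w. w \<notin> lists X \<longrightarrow> p w = \<zero>) \<and> finite {w. p w \<noteq> \<zero>}"
  by (auto simp: free_alg_def)

lemma free_ops:
  "\<zero>\<^bsub>M\<^esub> = (\<lambda>w. \<zero>)" "\<one>\<^bsub>M\<^esub> = mono \<one> []" "p \<oplus>\<^bsub>M\<^esub> r = (\<lambda>w. p w \<oplus> r w)" "c \<odot>\<^bsub>M\<^esub> p = (\<lambda>w. c \<otimes> p w)"
  "p \<otimes>\<^bsub>M\<^esub> r = (\<lambda>w. \<Oplus>i\<in>{..length w}. p (take i w) \<otimes> r (drop i w))"
  by (auto simp: free_alg_def mono_def)

lemma free_letter_mono: "free_letter F u = mono \<one> [u]"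
  by (simp add: free_letter_def mono_def)

lemma mono_closed: "\<lbrakk>c \<in> carrier F; w \<in> lists X\<rbrakk> \<Longrightarrow> mono c w \<in> carrier M"
  unfolding free_carrier by (auto simp: mono_def intro!: finite_subset[of _ "{w}"])

lemma free_add_closed: "\<lbrakk>p \<in> carrier M; r \<in> carrier M\<rbrakk> \<Longrightarrow> p \<oplus>\<^bsub>M\<^esub> r \<in> carrier M"
  unfolding free_carrier free_ops
  by (auto intro: finite_subset[of _ "{w. p w \<noteq> \<zero>} \<union> {w. r w \<noteq> \<zero>}"])

lemma free_smult_closed: "\<lbrakk>c \<in> carrier F; p \<in> carrier M\<rbrakk> \<Longrightarrow> c \<odot>\<^bsub>M\<^esub> p \<in> carrier M"
  unfolding free_carrier free_ops
  by (auto intro: finite_subset[of _ "{w. p w \<noteq> \<zero>}"])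

lemma free_neg_closed: "p \<in> carrier M \<Longrightarrow> (\<lambda>w. \<ominus> p w) \<in> carrier M"
  unfolding free_carrier by (auto intro: finite_subset[of _ "{w. p w \<noteq> \<zero>}"])

lemma free_zero_closed: "\<zero>\<^bsub>M\<^esub> \<in> carrier M"
  unfolding free_carrier free_ops by auto

lemma free_abelian_group: "abelian_group M"
proof (rule abelian_groupI)
  fix x assume "x \<in> carrier M"
  then show "\<exists>y\<in>carrier M. y \<oplus>\<^bsub>M\<^esub> x = \<zero>\<^bsub>M\<^esub>"
    using free_neg_closed[of x] by (intro bexI[of _ "\<lambda>w. \<ominus> x w"]) (auto simp: free_ops free_carrier l_neg)
qed (auto simp: free_add_closed free_zero_closed, auto simp: free_ops free_carrier a_ac)

lemma free_module: "module F M"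
  using is_cring free_abelian_group
  by (rule moduleI) (auto simp: free_smult_closed, auto simp: free_ops free_carrier l_distr r_distr m_assoc)

sublocale M: module F M
  by (rule free_module)

lemma free_vectorspace: "vectorspace F M"
  using free_module field_axioms by (rule vectorspace.intro)

lemma free_fun_closed: "p \<in> carrier M \<Longrightarrow> p w \<in> carrier F"
  by (simp add: free_carrier)

lemma free_mult_closed:
  assumes "p \<in> carrier M" "r \<in> carrier M"
  shows "p \<otimes>\<^bsub>M\<^esub> r \<in> carrier M"
proof -
  have *: "\<exists>i. p (take i w) \<noteq> \<zero> \<and> r (drop i w) \<noteq> \<zero>" if "(p \<otimes>\<^bsub>M\<^esub> r) w \<noteq> \<zero>" for w
  proof (rule ccontr)
    assume "\<not> ?thesis"
    then have "p (take i w) \<otimes> r (drop i w) = \<zero>" for i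
      using assms by (metis free_fun_closed l_null r_null)
    then have "(p \<otimes>\<^bsub>M\<^esub> r) w = \<zero>" by (simp add: free_ops finsum_zero)
    with that show False by simp
  qed
  have "{w. (p \<otimes>\<^bsub>M\<^esub> r) w \<noteq> \<zero>} \<subseteq> (\<lambda>(u, v). u @ v) ` ({w. p w \<noteq> \<zero>} \<times> {w. r w \<noteq> \<zero>})"
  proof
    fix w assume "w \<in> {w. (p \<otimes>\<^bsub>M\<^esub> r) w \<noteq> \<zero>}"
    then obtain i where "p (take i w) \<noteq> \<zero>" "r (drop i w) \<noteq> \<zero>" using * by auto
    then show "w \<in> (\<lambda>(u, v). u @ v) ` ({w. p w \<noteq> \<zero>} \<times> {w. r w \<noteq> \<zero>})"
      by (intro image_eqI[of _ _ "(take i w, drop i w)"]) auto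
  qed
  then have "finite {w. (p \<otimes>\<^bsub>M\<^esub> r) w \<noteq> \<zero>}"
    using assms by (elim finite_subset) (auto simp: free_carrier)
  moreover have "(p \<otimes>\<^bsub>M\<^esub> r) w = \<zero>" if "w \<notin> lists X" for w
  proof (rule ccontr)
    assume "(p \<otimes>\<^bsub>M\<^esub> r) w \<noteq> \<zero>"
    then obtain i where "p (take i w) \<noteq> \<zero>" "r (drop i w) \<noteq> \<zero>" using * by auto
    then have "take i w \<in> lists X" "drop i w \<in> lists X" using assms by (auto simp: free_carrier)
    then have "take i w @ drop i w \<in> lists X" by (simp only: append_in_lists_conv)
    then show False using that by simp
  qed
  moreover have "(p \<otimes>\<^bsub>M\<^esub> r) w \<in> carrier F" for w
    using assms[THEN free_fun_closed] by (auto simp: free_ops intro!: finsum_closed)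
  ultimately show ?thesis by (simp add: free_carrier)
qed

lemma free_l_distr:
  assumes "p \<in> carrier M" "r \<in> carrier M" "s \<in> carrier M"
  shows "(p \<oplus>\<^bsub>M\<^esub> r) \<otimes>\<^bsub>M\<^esub> s = p \<otimes>\<^bsub>M\<^esub> s \<oplus>\<^bsub>M\<^esub> r \<otimes>\<^bsub>M\<^esub> s"
proof
  note cl = assms[THEN free_fun_closed]
  fix w
  have "((p \<oplus>\<^bsub>M\<^esub> r) \<otimes>\<^bsub>M\<^esub> s) w
      = (\<Oplus>i\<in>{..length w}. p (take i w) \<otimes> s (drop i w) \<oplus> r (take i w) \<otimes> s (drop i w))"
    unfolding free_ops using cl by (intro finsum_cong') (auto simp: l_distr)
  also have "\<dots> = (p \<otimes>\<^bsub>M\<^esub> s \<oplus>\<^bsub>M\<^esub> r \<otimes>\<^bsub>M\<^esub> s) w"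
    unfolding free_ops using cl by (subst finsum_addf) auto
  finally show "((p \<oplus>\<^bsub>M\<^esub> r) \<otimes>\<^bsub>M\<^esub> s) w = (p \<otimes>\<^bsub>M\<^esub> s \<oplus>\<^bsub>M\<^esub> r \<otimes>\<^bsub>M\<^esub> s) w" .
qed

lemma free_r_distr:
  assumes "p \<in> carrier M" "r \<in> carrier M" "s \<in> carrier M"
  shows "s \<otimes>\<^bsub>M\<^esub> (p \<oplus>\<^bsub>M\<^esub> r) = s \<otimes>\<^bsub>M\<^esub> p \<oplus>\<^bsub>M\<^esub> s \<otimes>\<^bsub>M\<^esub> r"
proof
  note cl = assms[THEN free_fun_closed]
  fix w
  have "(s \<otimes>\<^bsub>M\<^esub> (p \<oplus>\<^bsub>M\<^esub> r)) w
      = (\<Oplus>i\<in>{..length w}. s (take i w) \<otimes> p (drop i w) \<oplus> s (take i w) \<otimes> r (drop i w))"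
    unfolding free_ops using cl by (intro finsum_cong') (auto simp: r_distr)
  also have "\<dots> = (s \<otimes>\<^bsub>M\<^esub> p \<oplus>\<^bsub>M\<^esub> s \<otimes>\<^bsub>M\<^esub> r) w"
    unfolding free_ops using cl by (subst finsum_addf) auto
  finally show "(s \<otimes>\<^bsub>M\<^esub> (p \<oplus>\<^bsub>M\<^esub> r)) w = (s \<otimes>\<^bsub>M\<^esub> p \<oplus>\<^bsub>M\<^esub> s \<otimes>\<^bsub>M\<^esub> r) w" .
qed

lemma free_smult_mult:
  assumes "c \<in> carrier F" "p \<in> carrier M" "r \<in> carrier M"
  shows "(c \<odot>\<^bsub>M\<^esub> p) \<otimes>\<^bsub>M\<^esub> r = c \<odot>\<^bsub>M\<^esub> (p \<otimes>\<^bsub>M\<^esub> r)" "p \<otimes>\<^bsub>M\<^esub> (c \<odot>\<^bsub>M\<^esub> r) = c \<odot>\<^bsub>M\<^esub> (p \<otimes>\<^bsub>M\<^esub> r)"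
proof -
  note cl = assms(2,3)[THEN free_fun_closed]
  show "(c \<odot>\<^bsub>M\<^esub> p) \<otimes>\<^bsub>M\<^esub> r = c \<odot>\<^bsub>M\<^esub> (p \<otimes>\<^bsub>M\<^esub> r)"
  proof
    fix w
    show "((c \<odot>\<^bsub>M\<^esub> p) \<otimes>\<^bsub>M\<^esub> r) w = (c \<odot>\<^bsub>M\<^esub> (p \<otimes>\<^bsub>M\<^esub> r)) w"
      unfolding free_ops using cl assms(1)
      by (subst finsum_rdistr) (auto simp: m_assoc intro!: finsum_cong')
  qed
  show "p \<otimes>\<^bsub>M\<^esub> (c \<odot>\<^bsub>M\<^esub> r) = c \<odot>\<^bsub>M\<^esub> (p \<otimes>\<^bsub>M\<^esub> r)"
  proof
    fix w
    show "(p \<otimes>\<^bsub>M\<^esub> (c \<odot>\<^bsub>M\<^esub> r)) w = (c \<odot>\<^bsub>M\<^esub> (p \<otimes>\<^bsub>M\<^esub> r)) w"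
      unfolding free_ops using cl assms(1)
      by (subst finsum_rdistr) (auto simp: m_lcomm intro!: finsum_cong')
  qed
qed

lemma mono_mult:
  assumes "c \<in> carrier F" "d \<in> carrier F"
  shows "mono c u \<otimes>\<^bsub>M\<^esub> mono d v = mono (c \<otimes> d) (u @ v)"
proof
  fix w
  show "(mono c u \<otimes>\<^bsub>M\<^esub> mono d v) w = mono (c \<otimes> d) (u @ v) w"
  proof (cases "w = u @ v")
    case True
    have "(mono c u \<otimes>\<^bsub>M\<^esub> mono d v) w = (\<Oplus>i\<in>{..length w}. if length u = i then c \<otimes> d else \<zero>)"
      unfolding free_ops
    proof (intro finsum_cong')
      fix i assume "i \<in> {..length w}"
      then have "take i w = u \<Longrightarrow> i = length u" by auto
      then show "mono c u (take i w) \<otimes> mono d v (drop i w) = (if length u = i then c \<otimes> d else \<zero>)"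
        using True assms by (auto simp: mono_def)
    qed (use assms in auto)
    also have "\<dots> = c \<otimes> d" using assms True by (intro finsum_singleton[where f = "\<lambda>_. c \<otimes> d"]) auto
    finally show ?thesis using True by (simp add: mono_def)
  next
    case False
    have "(mono c u \<otimes>\<^bsub>M\<^esub> mono d v) w = (\<Oplus>i\<in>{..length w}. \<zero>)"
      unfolding free_ops
    proof (intro finsum_cong')
      fix i
      have "take i w \<noteq> u \<or> drop i w \<noteq> v" using False append_take_drop_id[of i w] by metis
      then show "mono c u (take i w) \<otimes> mono d v (drop i w) = \<zero>" using assms by (auto simp: mono_def)
    qed auto
    then show ?thesis using False by (simp add: mono_def)
  qed
qed

text \<open>Splits off one monomial of the finite support at a time, so identities additive in p
  reduce to monomials.\<close>

lemma free_induct [consumes 1, case_names zero add]: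
  assumes "p \<in> carrier M" and zero: "P \<zero>\<^bsub>M\<^esub>"
    and add: "\<And>c w p. \<lbrakk>c \<in> carrier F; w \<in> lists X; p \<in> carrier M; P p\<rbrakk> \<Longrightarrow> P (mono c w \<oplus>\<^bsub>M\<^esub> p)"
  shows "P p"
proof -
  have "finite S \<Longrightarrow> \<forall>p\<in>carrier M. {w. p w \<noteq> \<zero>} \<subseteq> S \<longrightarrow> P p" for S :: "'v list set"
  proof (induction S rule: finite_induct)
    case empty
    show ?case
    proof (intro ballI impI)
      fix p :: "'v list \<Rightarrow> 'f" assume "{w. p w \<noteq> \<zero>} \<subseteq> {}"
      then have "p = \<zero>\<^bsub>M\<^esub>" by (intro ext) (simp add: free_ops)
      then show "P p" using zero by simp
    qed
  next
    case (insert v S)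
    show ?case
    proof (intro ballI impI)
      fix p assume p: "p \<in> carrier M" "{w. p w \<noteq> \<zero>} \<subseteq> insert v S"
      let ?p = "p(v := \<zero>)"
      have p': "?p \<in> carrier M"
        using p(1) unfolding free_carrier by (auto intro: finite_subset[of _ "{w. p w \<noteq> \<zero>}"])
      have "{w. ?p w \<noteq> \<zero>} \<subseteq> S" using p(2) by auto
      with bspec[OF insert.IH p'] have Pp': "P ?p" by (rule mp)
      show "P p"
      proof (cases "v \<in> lists X")
        case True
        have "mono (p v) v \<oplus>\<^bsub>M\<^esub> ?p = p"
          using free_fun_closed[OF p(1)] by (auto simp: free_ops mono_def)
        then show ?thesis using add[of "p v" v ?p] True free_fun_closed[OF p(1)] p' Pp' by simp
      next
        case False
        then have "p v = \<zero>" using p(1) unfolding free_carrier by blast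
        then have "?p = p" by (metis fun_upd_triv)
        then show ?thesis using Pp' by simp
      qed
    qed
  qed
  then show ?thesis using assms(1) by (auto simp: free_carrier)
qed

lemma free_mult_zero: "p \<in> carrier M \<Longrightarrow> \<zero>\<^bsub>M\<^esub> \<otimes>\<^bsub>M\<^esub> p = \<zero>\<^bsub>M\<^esub>" "p \<in> carrier M \<Longrightarrow> p \<otimes>\<^bsub>M\<^esub> \<zero>\<^bsub>M\<^esub> = \<zero>\<^bsub>M\<^esub>"
  using free_fun_closed[of p] by (simp_all add: free_ops finsum_zero)

lemmas free_closed = free_add_closed free_mult_closed free_smult_closed free_zero_closed mono_closed

text \<open>Trilinearity reduces the claim to monomials, where it is associativity of concatenation;
  this avoids reindexing a double convolution sum.\<close>

lemma free_assoc:
  assumes "p \<in> carrier M" "r \<in> carrier M" "s \<in> carrier M"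
  shows "(p \<otimes>\<^bsub>M\<^esub> r) \<otimes>\<^bsub>M\<^esub> s = p \<otimes>\<^bsub>M\<^esub> (r \<otimes>\<^bsub>M\<^esub> s)"
proof -
  have 1: "(mono c u \<otimes>\<^bsub>M\<^esub> mono d v) \<otimes>\<^bsub>M\<^esub> s = mono c u \<otimes>\<^bsub>M\<^esub> (mono d v \<otimes>\<^bsub>M\<^esub> s)"
    if "c \<in> carrier F" "d \<in> carrier F" "u \<in> lists X" "v \<in> lists X" for c d u v
    using assms(3) that
    by (induction rule: free_induct) (simp_all add: free_closed free_mult_zero free_r_distr mono_mult m_assoc)
  have 2: "(mono c u \<otimes>\<^bsub>M\<^esub> r) \<otimes>\<^bsub>M\<^esub> s = mono c u \<otimes>\<^bsub>M\<^esub> (r \<otimes>\<^bsub>M\<^esub> s)"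
    if "c \<in> carrier F" "u \<in> lists X" for c u
    using assms(2) that assms(3)
    by (induction rule: free_induct) (simp_all add: free_closed free_mult_zero free_r_distr free_l_distr 1)
  show ?thesis using assms
    by (induction rule: free_induct) (simp_all add: free_closed free_mult_zero free_l_distr 2)
qed

lemma free_one:
  assumes "p \<in> carrier M"
  shows "\<one>\<^bsub>M\<^esub> \<otimes>\<^bsub>M\<^esub> p = p" "p \<otimes>\<^bsub>M\<^esub> \<one>\<^bsub>M\<^esub> = p"
  using assms
  by (induction rule: free_induct) (simp_all add: free_ops(2) free_mult_zero free_l_distr free_r_distr mono_mult free_closed)

lemma free_ring: "ring M"
proof (rule ringI)
  show "Group.monoid M"
    by (rule monoidI) (auto simp: free_closed free_assoc free_one, auto simp: free_ops free_closed)
qed (simp_all add: free_abelian_group free_l_distr free_r_distr)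

lemma free_assoc_alg: "assoc_alg F M"
  using free_vectorspace free_ring by (rule assoc_algI) (auto simp: free_smult_mult)

end

text \<open>The target is a mere module so that one construction serves twice: with an algebra as
  target it evaluates words, and with F as target it gives Wick's functional.\<close>

locale free_linear = free_algebra F X + W: module F W
  for F :: "('f, 'm) ring_scheme" (structure) and X :: "'v set" and W :: "('f, 'a) module" +
  fixes g :: "'v list \<Rightarrow> 'a"
  assumes g_closed: "\<And>w. w \<in> lists X \<Longrightarrow> g w \<in> carrier W"
begin

definition lin_ext :: "('v list \<Rightarrow> 'f) \<Rightarrow> 'a" where
  "lin_ext p = (\<Oplus>\<^bsub>W\<^esub>w\<in>{w. p w \<noteq> \<zero>}. p w \<odot>\<^bsub>W\<^esub> g w)"

lemma support_lists: "p \<in> carrier M \<Longrightarrow> {w. p w \<noteq> \<zero>} \<subseteq> lists X"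
  unfolding free_carrier by blast

lemma term_closed:
  assumes "p \<in> carrier M" "S \<subseteq> lists X"
  shows "(\<lambda>w. p w \<odot>\<^bsub>W\<^esub> g w) \<in> S \<rightarrow> carrier W"
  using free_fun_closed[OF assms(1)] assms(2) g_closed by blast

text \<open>Enlarging the index set beyond the support lets p, r and their sum be written over one
  common set of words.\<close>

lemma lin_ext_eq:
  assumes "p \<in> carrier M" "finite S" "S \<subseteq> lists X" "{w. p w \<noteq> \<zero>} \<subseteq> S"
  shows "lin_ext p = (\<Oplus>\<^bsub>W\<^esub>w\<in>S. p w \<odot>\<^bsub>W\<^esub> g w)"
  unfolding lin_ext_def
  using assms term_closed[OF assms(1,3)] g_closed
  by (intro W.add.finprod_mono_neutral_cong_left) (auto simp: W.smult_l_null subset_eq simp del: in_lists_conv_set)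

lemma lin_ext_closed: "p \<in> carrier M \<Longrightarrow> lin_ext p \<in> carrier W"
  unfolding lin_ext_def by (intro W.finsum_closed term_closed support_lists)

lemma lin_ext_zero: "lin_ext \<zero>\<^bsub>M\<^esub> = \<zero>\<^bsub>W\<^esub>"
  unfolding lin_ext_def by (simp add: free_ops(1))

lemma lin_ext_add:
  assumes "p \<in> carrier M" "r \<in> carrier M"
  shows "lin_ext (p \<oplus>\<^bsub>M\<^esub> r) = lin_ext p \<oplus>\<^bsub>W\<^esub> lin_ext r"
proof -
  note cl = assms[THEN free_fun_closed]
  let ?S = "{w. p w \<noteq> \<zero>} \<union> {w. r w \<noteq> \<zero>}"
  have S: "finite ?S" "?S \<subseteq> lists X" using assms support_lists by (auto simp: free_carrier simp del: in_lists_conv_set)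
  have sum: "{w. (p \<oplus>\<^bsub>M\<^esub> r) w \<noteq> \<zero>} \<subseteq> ?S" by (auto simp: free_ops(3))
  have "lin_ext (p \<oplus>\<^bsub>M\<^esub> r) = (\<Oplus>\<^bsub>W\<^esub>w\<in>?S. (p \<oplus>\<^bsub>M\<^esub> r) w \<odot>\<^bsub>W\<^esub> g w)"
    by (rule lin_ext_eq[OF free_add_closed[OF assms] S sum])
  also have "\<dots> = (\<Oplus>\<^bsub>W\<^esub>w\<in>?S. p w \<odot>\<^bsub>W\<^esub> g w \<oplus>\<^bsub>W\<^esub> r w \<odot>\<^bsub>W\<^esub> g w)"
    unfolding free_ops(3)
    using cl g_closed S by (intro W.finsum_cong') (auto simp: W.smult_l_distr subset_eq simp del: in_lists_conv_set)
  also have "\<dots> = lin_ext p \<oplus>\<^bsub>W\<^esub> lin_ext r"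
    using term_closed assms S lin_ext_eq[OF assms(1) S] lin_ext_eq[OF assms(2) S]
    by (subst W.finsum_addf) auto
  finally show ?thesis .
qed

lemma lin_ext_smult:
  assumes "c \<in> carrier F" "p \<in> carrier M"
  shows "lin_ext (c \<odot>\<^bsub>M\<^esub> p) = c \<odot>\<^bsub>W\<^esub> lin_ext p"
proof -
  note cl = free_fun_closed[OF assms(2)]
  let ?S = "{w. p w \<noteq> \<zero>}"
  have S: "finite ?S" "?S \<subseteq> lists X" using assms support_lists by (auto simp: free_carrier simp del: in_lists_conv_set)
  have sub: "{w. (c \<odot>\<^bsub>M\<^esub> p) w \<noteq> \<zero>} \<subseteq> ?S" using assms(1) by (auto simp: free_ops(4))
  have "lin_ext (c \<odot>\<^bsub>M\<^esub> p) = (\<Oplus>\<^bsub>W\<^esub>w\<in>?S. (c \<odot>\<^bsub>M\<^esub> p) w \<odot>\<^bsub>W\<^esub> g w)"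
    by (rule lin_ext_eq[OF free_smult_closed[OF assms] S sub])
  also have "\<dots> = (\<Oplus>\<^bsub>W\<^esub>w\<in>?S. c \<odot>\<^bsub>W\<^esub> (p w \<odot>\<^bsub>W\<^esub> g w))"
    unfolding free_ops(4)
    using cl g_closed S assms(1)
    by (intro W.finsum_cong') (auto simp: W.smult_assoc1 subset_eq simp del: in_lists_conv_set)
  also have "\<dots> = c \<odot>\<^bsub>W\<^esub> lin_ext p"
    unfolding lin_ext_def using S assms term_closed[OF assms(2) S(2)]
    by (intro W.finsum_smult_ldistr[symmetric]) auto
  finally show ?thesis .
qed

lemma lin_ext_mono:
  assumes "c \<in> carrier F" "w \<in> lists X"
  shows "lin_ext (mono c w) = c \<odot>\<^bsub>W\<^esub> g w"
proof -
  have "lin_ext (mono c w) = (\<Oplus>\<^bsub>W\<^esub>v\<in>{w}. mono c w v \<odot>\<^bsub>W\<^esub> g v)"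
    using assms mono_closed by (intro lin_ext_eq) (auto simp: mono_def)
  then show ?thesis using assms g_closed by (simp add: mono_def)
qed

end

locale free_eval = free_algebra F X + B: assoc_alg F B
  for F :: "('f, 'm) ring_scheme" (structure) and X :: "'v set" and B :: "('f, 'a) module" +
  fixes f :: "'v \<Rightarrow> 'a"
  assumes f_closed: "\<And>x. x \<in> X \<Longrightarrow> f x \<in> carrier B"
begin

primrec wprod :: "'v list \<Rightarrow> 'a" where
  "wprod [] = \<one>\<^bsub>B\<^esub>"
| "wprod (x # w) = f x \<otimes>\<^bsub>B\<^esub> wprod w"

lemma wprod_closed: "w \<in> lists X \<Longrightarrow> wprod w \<in> carrier B"
  by (induction w) (auto simp: f_closed)

lemma wprod_append: "\<lbrakk>u \<in> lists X; v \<in> lists X\<rbrakk> \<Longrightarrow> wprod (u @ v) = wprod u \<otimes>\<^bsub>B\<^esub> wprod v"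
  by (induction u) (auto simp: f_closed wprod_closed B.A.m_assoc)

sublocale L: free_linear F X B wprod
  by unfold_locales (rule wprod_closed)

abbreviation "ev \<equiv> L.lin_ext"

lemma ev_mult:
  assumes "p \<in> carrier M" "r \<in> carrier M"
  shows "ev (p \<otimes>\<^bsub>M\<^esub> r) = ev p \<otimes>\<^bsub>B\<^esub> ev r"
proof -
  have 1: "ev (mono c u \<otimes>\<^bsub>M\<^esub> mono d v) = ev (mono c u) \<otimes>\<^bsub>B\<^esub> ev (mono d v)"
    if *: "c \<in> carrier F" "d \<in> carrier F" "u \<in> lists X" "v \<in> lists X" for c d u v
  proof -
    have "u @ v \<in> lists X" using * by (simp only: append_in_lists_conv)
    then show ?thesis using * wprod_closed
      by (simp add: mono_mult L.lin_ext_mono wprod_append B.smult_mult_l B.smult_mult_r m_comm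
          del: in_lists_conv_set flip: B.VS.smult_assoc1)
  qed
  have 2: "ev (mono c u \<otimes>\<^bsub>M\<^esub> r) = ev (mono c u) \<otimes>\<^bsub>B\<^esub> ev r" if "c \<in> carrier F" "u \<in> lists X" for c u
    using assms(2) that
    by (induction rule: free_induct)
      (simp_all add: free_closed free_mult_zero free_r_distr L.lin_ext_zero L.lin_ext_add L.lin_ext_closed
        B.A.r_distr 1 del: in_lists_conv_set)
  show ?thesis using assms
    by (induction rule: free_induct)
      (simp_all add: free_closed free_mult_zero free_l_distr L.lin_ext_zero L.lin_ext_add L.lin_ext_closed
        B.A.l_distr 2 del: in_lists_conv_set)
qed

lemma ev_letter: "u \<in> X \<Longrightarrow> ev (free_letter F u) = f u"
  by (simp add: free_letter_mono L.lin_ext_mono f_closed)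

lemma ev_hom: "alg_hom F M B ev"
proof (rule alg_homI)
  show "ev \<one>\<^bsub>M\<^esub> = \<one>\<^bsub>B\<^esub>" by (simp add: free_ops(2) L.lin_ext_mono)
qed (auto simp: L.lin_ext_closed ev_mult L.lin_ext_add L.lin_ext_smult)

end

lemma (in assoc_alg) subalg_vimage:
  assumes "assoc_alg F B" "alg_hom F A B h" "subalg F B S"
  shows "subalg F A {a \<in> carrier A. h a \<in> S}"
proof -
  interpret B: assoc_alg F B by fact
  show ?thesis
    by (rule subalgI) (auto simp: alg_homD[OF assms(2)] B.subalgD[OF assms(3)])
qed

context free_algebra
begin

lemma letter_closed: "u \<in> X \<Longrightarrow> free_letter F u \<in> carrier M"
  by (simp add: free_letter_mono mono_closed)

lemma free_generated:
  assumes S: "subalg F M S" and l: "free_letter F ` X \<subseteq> S"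
  shows "carrier M \<subseteq> S"
proof
  interpret M: assoc_alg F M by (rule free_assoc_alg)
  note SD = M.subalgD[OF S]
  have w: "mono \<one> w \<in> S" if "w \<in> lists X" for w
    using that
  proof (induction w)
    case Nil
    show ?case using SD(3) by (simp add: free_ops(2))
  next
    case (Cons x w)
    have "mono \<one> (x # w) = free_letter F x \<otimes>\<^bsub>M\<^esub> mono \<one> w"
      by (simp add: free_letter_mono mono_mult)
    then show ?case using Cons l SD by auto
  qed
  fix p assume "p \<in> carrier M"
  then show "p \<in> S"
  proof (induction rule: free_induct)
    case zero
    show ?case by (rule SD(2))
  next
    case (add c w p)
    have "mono c w = c \<odot>\<^bsub>M\<^esub> mono \<one> w" using add by (auto simp: free_ops(4) mono_def)
    then show ?case using add w SD by simp
  qed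
qed

end

section \<open>Clifford algebras\<close>

locale clifford = F: field F + U: vectorspace F U
  for F :: "('f, 'm) ring_scheme" and U :: "('f, 'v) module" +
  fixes \<psi> :: "'v \<Rightarrow> 'f"
  assumes psi_closed: "\<And>u. u \<in> carrier U \<Longrightarrow> \<psi> u \<in> carrier F"
begin

sublocale free: free_algebra F "carrier U" ..
sublocale M: assoc_alg F "free_alg F (carrier U)" by (rule free.free_assoc_alg)

abbreviation "M \<equiv> free_alg F (carrier U)"
abbreviation "T \<equiv> tensor_alg F U"
abbreviation "C \<equiv> clifford_alg F U \<psi>"
abbreviation "\<iota> \<equiv> clifford_in F U \<psi>"
abbreviation "l \<equiv> free_letter F"
abbreviation "t \<equiv> tensor_in F U"

definition tensor_rels :: "('v list \<Rightarrow> 'f) set" where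
  "tensor_rels = {l (u \<oplus>\<^bsub>U\<^esub> v) \<ominus>\<^bsub>M\<^esub> (l u \<oplus>\<^bsub>M\<^esub> l v) | u v. u \<in> carrier U \<and> v \<in> carrier U} \<union>
     {l (c \<odot>\<^bsub>U\<^esub> u) \<ominus>\<^bsub>M\<^esub> c \<odot>\<^bsub>M\<^esub> l u | c u. c \<in> carrier F \<and> u \<in> carrier U}"

definition clifford_rels :: "('v list \<Rightarrow> 'f) set set" where
  "clifford_rels = {t u \<otimes>\<^bsub>T\<^esub> t u \<ominus>\<^bsub>T\<^esub> \<psi> u \<odot>\<^bsub>T\<^esub> \<one>\<^bsub>T\<^esub> | u. u \<in> carrier U}"

lemma tensor_ideal_eq: "tensor_ideal F U = genideal M tensor_rels"
  by (simp add: tensor_ideal_def tensor_rels_def Let_def)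

lemma clifford_ideal_eq: "clifford_ideal F U \<psi> = genideal T clifford_rels"
  by (simp add: clifford_ideal_def clifford_rels_def Let_def)

lemma tensor_rels_closed: "tensor_rels \<subseteq> carrier M"
  by (auto simp: tensor_rels_def free.letter_closed)

lemma tensor_ideal: "ideal (tensor_ideal F U) M" and tensor_rels_in: "tensor_rels \<subseteq> tensor_ideal F U"
  unfolding tensor_ideal_eq using tensor_rels_closed
  by (auto intro: M.A.genideal_ideal M.A.genideal_self[THEN subsetD])

sublocale T: assoc_alg F T
  unfolding tensor_alg_def by (rule M.assoc_alg_quot[OF tensor_ideal])

lemma proj_T: "alg_hom F M T ((+>\<^bsub>M\<^esub>) (tensor_ideal F U))"
  unfolding tensor_alg_def by (rule M.alg_hom_proj[OF tensor_ideal])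

lemma tensor_in_closed: "u \<in> carrier U \<Longrightarrow> t u \<in> carrier T"
  unfolding tensor_in_def by (rule alg_homD(1)[OF proj_T free.letter_closed])

lemma tensor_in_add: "\<lbrakk>u \<in> carrier U; v \<in> carrier U\<rbrakk> \<Longrightarrow> t (u \<oplus>\<^bsub>U\<^esub> v) = t u \<oplus>\<^bsub>T\<^esub> t v"
proof -
  assume uv: "u \<in> carrier U" "v \<in> carrier U"
  then have "l (u \<oplus>\<^bsub>U\<^esub> v) \<ominus>\<^bsub>M\<^esub> (l u \<oplus>\<^bsub>M\<^esub> l v) \<in> tensor_ideal F U"
    using tensor_rels_in by (auto simp: tensor_rels_def)
  then show ?thesis
    unfolding tensor_in_def using uv
    by (simp add: alg_homD(3)[OF proj_T, symmetric] free.letter_closed M.coset_eq_iff[OF tensor_ideal])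
qed

lemma tensor_in_smult: "\<lbrakk>c \<in> carrier F; u \<in> carrier U\<rbrakk> \<Longrightarrow> t (c \<odot>\<^bsub>U\<^esub> u) = c \<odot>\<^bsub>T\<^esub> t u"
proof -
  assume uv: "c \<in> carrier F" "u \<in> carrier U"
  then have "l (c \<odot>\<^bsub>U\<^esub> u) \<ominus>\<^bsub>M\<^esub> c \<odot>\<^bsub>M\<^esub> l u \<in> tensor_ideal F U"
    using tensor_rels_in by (auto simp: tensor_rels_def)
  then show ?thesis
    unfolding tensor_in_def using uv
    by (simp add: alg_homD(4)[OF proj_T, symmetric] free.letter_closed M.coset_eq_iff[OF tensor_ideal])
qed

lemma clifford_rels_closed: "clifford_rels \<subseteq> carrier T"
  by (auto simp: clifford_rels_def tensor_in_closed psi_closed)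

lemma clifford_ideal: "ideal (clifford_ideal F U \<psi>) T" and clifford_rels_in: "clifford_rels \<subseteq> clifford_ideal F U \<psi>"
  unfolding clifford_ideal_eq using clifford_rels_closed
  by (auto intro: T.A.genideal_ideal T.A.genideal_self[THEN subsetD])

sublocale C: assoc_alg F C
  unfolding clifford_alg_def by (rule T.assoc_alg_quot[OF clifford_ideal])

lemma proj_C: "alg_hom F T C ((+>\<^bsub>T\<^esub>) (clifford_ideal F U \<psi>))"
  unfolding clifford_alg_def by (rule T.alg_hom_proj[OF clifford_ideal])

lemma iota_closed: "u \<in> carrier U \<Longrightarrow> \<iota> u \<in> carrier C"
  unfolding clifford_in_def by (rule alg_homD(1)[OF proj_C tensor_in_closed])

lemma iota_add: "\<lbrakk>u \<in> carrier U; v \<in> carrier U\<rbrakk> \<Longrightarrow> \<iota> (u \<oplus>\<^bsub>U\<^esub> v) = \<iota> u \<oplus>\<^bsub>C\<^esub> \<iota> v"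
  unfolding clifford_in_def by (simp add: alg_homD(3)[OF proj_C] tensor_in_closed tensor_in_add)

lemma iota_smult: "\<lbrakk>c \<in> carrier F; u \<in> carrier U\<rbrakk> \<Longrightarrow> \<iota> (c \<odot>\<^bsub>U\<^esub> u) = c \<odot>\<^bsub>C\<^esub> \<iota> u"
  unfolding clifford_in_def by (simp add: alg_homD(4)[OF proj_C] tensor_in_closed tensor_in_smult)

lemma iota_square: "u \<in> carrier U \<Longrightarrow> \<iota> u \<otimes>\<^bsub>C\<^esub> \<iota> u = \<psi> u \<odot>\<^bsub>C\<^esub> \<one>\<^bsub>C\<^esub>"
proof -
  assume u: "u \<in> carrier U"
  then have "t u \<otimes>\<^bsub>T\<^esub> t u \<ominus>\<^bsub>T\<^esub> \<psi> u \<odot>\<^bsub>T\<^esub> \<one>\<^bsub>T\<^esub> \<in> clifford_ideal F U \<psi>"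
    using clifford_rels_in by (auto simp: clifford_rels_def)
  then show ?thesis
    unfolding clifford_in_def using u
    by (simp add: alg_homD(2,4)[OF proj_C, symmetric] alg_homD(5)[OF proj_C, symmetric] tensor_in_closed
        psi_closed T.coset_eq_iff[OF clifford_ideal])
qed

lemma iota_zero: "\<iota> \<zero>\<^bsub>U\<^esub> = \<zero>\<^bsub>C\<^esub>"
  using iota_smult[of "\<zero>\<^bsub>F\<^esub>" "\<zero>\<^bsub>U\<^esub>"] iota_closed[of "\<zero>\<^bsub>U\<^esub>"] by simp

text \<open>The preimage of S under the two projections is a subalgebra of the free algebra that
  contains all letters, hence everything.\<close>

lemma generated:
  assumes S: "subalg F C S" and i: "\<iota> ` carrier U \<subseteq> S"
  shows "S = carrier C"
proof
  show "S \<subseteq> carrier C" using C.subalgD(1)[OF S] .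
  let ?\<pi> = "(+>\<^bsub>T\<^esub>) (clifford_ideal F U \<psi>) \<circ> (+>\<^bsub>M\<^esub>) (tensor_ideal F U)"
  have pi: "alg_hom F M C ?\<pi>" by (rule alg_hom_comp[OF proj_T proj_C])
  have "carrier M \<subseteq> {a \<in> carrier M. ?\<pi> a \<in> S}"
    using i by (intro free.free_generated M.subalg_vimage[OF C.assoc_alg_axioms pi S])
      (auto simp: free.letter_closed clifford_in_def tensor_in_def)
  moreover have "carrier C \<subseteq> ?\<pi> ` carrier M"
    by (auto simp: clifford_alg_def tensor_alg_def T.alg_quot_simps(1)[OF clifford_ideal, unfolded tensor_alg_def]
        M.alg_quot_simps(1)[OF tensor_ideal])
  ultimately show "carrier C \<subseteq> S" by auto
qed

lemma hom_unique:
  assumes B: "assoc_alg F B" "alg_hom F C B g" "alg_hom F C B h"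
    and eq: "\<And>u. u \<in> carrier U \<Longrightarrow> g (\<iota> u) = h (\<iota> u)" and a: "a \<in> carrier C"
  shows "g a = h a"
proof -
  have "subalg F C {a \<in> carrier C. g a = h a}"
    by (rule C.subalgI) (auto simp: alg_homD[OF B(2)] alg_homD[OF B(3)])
  then have "{a \<in> carrier C. g a = h a} = carrier C"
    using eq by (intro generated) (auto simp: iota_closed)
  then show ?thesis using a by blast
qed

text \<open>Evaluation of words is pushed through the two quotients in turn: linearity of f kills
  the tensor relations, the condition on squares kills the Clifford relations.\<close>

lemma universal:
  assumes B: "assoc_alg F B" and f: "f \<in> module_hom F U B"
    and sq: "\<And>u. u \<in> carrier U \<Longrightarrow> f u \<otimes>\<^bsub>B\<^esub> f u = \<psi> u \<odot>\<^bsub>B\<^esub> \<one>\<^bsub>B\<^esub>"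
  shows "\<exists>h. alg_hom F C B h \<and> (\<forall>u\<in>carrier U. h (\<iota> u) = f u)"
proof -
  interpret B: assoc_alg F B by fact
  have fc: "f u \<in> carrier B" if "u \<in> carrier U" for u using f that by (auto simp: module_hom_def)
  interpret E: free_eval F "carrier U" B f by unfold_locales (rule fc)
  have van: "E.ev r = \<zero>\<^bsub>B\<^esub>" if "r \<in> tensor_rels" for r
    using that f fc unfolding tensor_rels_def
    by (auto simp: alg_hom_zero(2)[OF M.assoc_alg_axioms B E.ev_hom] free.letter_closed
        alg_homD(3,4)[OF E.ev_hom] E.ev_letter module_hom_def B.A.r_right_minus_eq)
  obtain g where g: "alg_hom F T B g" "\<forall>a\<in>carrier M. g (tensor_ideal F U +>\<^bsub>M\<^esub> a) = E.ev a"
    using M.alg_quot_lift[OF tensor_ideal B E.ev_hom]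
      alg_hom_vanish_genideal[OF M.assoc_alg_axioms B E.ev_hom tensor_rels_closed van]
    unfolding tensor_ideal_eq[symmetric] tensor_alg_def[symmetric] by blast
  have gt: "g (t u) = f u" if "u \<in> carrier U" for u
    using g(2) that by (simp add: tensor_in_def free.letter_closed E.ev_letter)
  have van2: "g r = \<zero>\<^bsub>B\<^esub>" if "r \<in> clifford_rels" for r
    using that sq fc unfolding clifford_rels_def
    by (auto simp: alg_hom_zero(2)[OF T.assoc_alg_axioms B g(1)] tensor_in_closed psi_closed
        alg_homD(2,4,5)[OF g(1)] gt B.A.r_right_minus_eq)
  obtain h where h: "alg_hom F C B h" "\<forall>a\<in>carrier T. h (clifford_ideal F U \<psi> +>\<^bsub>T\<^esub> a) = g a"
    using T.alg_quot_lift[OF clifford_ideal B g(1)]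
      alg_hom_vanish_genideal[OF T.assoc_alg_axioms B g(1) clifford_rels_closed van2]
    unfolding clifford_ideal_eq[symmetric] clifford_alg_def[symmetric] by blast
  then show ?thesis using gt by (auto simp: clifford_in_def tensor_in_closed)
qed

end

section \<open>Wick's functional on words\<close>

locale clifford_contraction = clifford F U \<psi>
  for F :: "('f, 'm) ring_scheme" (structure) and U :: "('f, 'v) module" and \<psi> :: "'v \<Rightarrow> 'f" +
  fixes \<beta> :: "'v \<Rightarrow> 'v \<Rightarrow> 'f"
  assumes char2: "\<one> \<oplus> \<one> = \<zero>"
    and beta: "bilinear_form F U \<beta>"
    and beta_diag: "\<And>u. u \<in> carrier U \<Longrightarrow> \<beta> u u = \<psi> u"
begin

definition "W = lists (carrier U)"

lemma W_simps [simp]: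
  "[] \<in> W" "x # w \<in> W \<longleftrightarrow> x \<in> carrier U \<and> w \<in> W" "u @ v \<in> W \<longleftrightarrow> u \<in> W \<and> v \<in> W"
  by (auto simp: W_def)

lemma F_add_self: "x \<in> carrier F \<Longrightarrow> x \<oplus> x = \<zero>"
  using F.l_distr[of \<one> \<one> x] char2 by simp

lemma beta_closed: "\<lbrakk>u \<in> carrier U; v \<in> carrier U\<rbrakk> \<Longrightarrow> \<beta> u v \<in> carrier F"
  and beta_add: "\<lbrakk>u \<in> carrier U; v \<in> carrier U; w \<in> carrier U\<rbrakk> \<Longrightarrow> \<beta> (u \<oplus>\<^bsub>U\<^esub> v) w = \<beta> u w \<oplus> \<beta> v w"
    "\<lbrakk>u \<in> carrier U; v \<in> carrier U; w \<in> carrier U\<rbrakk> \<Longrightarrow> \<beta> w (u \<oplus>\<^bsub>U\<^esub> v) = \<beta> w u \<oplus> \<beta> w v"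
  and beta_smult: "\<lbrakk>c \<in> carrier F; u \<in> carrier U; v \<in> carrier U\<rbrakk> \<Longrightarrow> \<beta> (c \<odot>\<^bsub>U\<^esub> u) v = c \<otimes> \<beta> u v"
    "\<lbrakk>c \<in> carrier F; u \<in> carrier U; v \<in> carrier U\<rbrakk> \<Longrightarrow> \<beta> u (c \<odot>\<^bsub>U\<^esub> v) = c \<otimes> \<beta> u v"
  using beta unfolding bilinear_form_def by auto

text \<open>Wick's recursion: \<open>wick\<close> contracts the first letter of a word with each later one. It respects the
  relations of the Clifford algebra although \<open>\<beta>\<close> need not be symmetric, and it is \<open>1\<close> on the empty
  word; this is what shows that the Clifford algebra is not zero.\<close>

fun contract :: "'v \<Rightarrow> ('v list \<Rightarrow> 'f) \<Rightarrow> 'v list \<Rightarrow> 'f" where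
  "contract x G [] = \<zero>"
| "contract x G (y # w) = \<beta> x y \<otimes> G w \<oplus> contract x (\<lambda>u. G (y # u)) w"

lemma contract_closed:
  "\<lbrakk>x \<in> carrier U; \<And>u. u \<in> W \<Longrightarrow> G u \<in> carrier F; w \<in> W\<rbrakk> \<Longrightarrow> contract x G w \<in> carrier F"
  by (induction w arbitrary: G) (auto simp: beta_closed)

text \<open>G is only ever evaluated on w with one letter deleted. This is what makes the recursion
  for \<open>wick\<close> terminate.\<close>

lemma contract_cong:
  "\<lbrakk>w \<in> W; \<And>u. \<lbrakk>u \<in> W; length u < length w\<rbrakk> \<Longrightarrow> G u = H u\<rbrakk> \<Longrightarrow> contract x G w = contract x H w"
proof (induction w arbitrary: G H)
  case (Cons y w)
  have "contract x (\<lambda>u. G (y # u)) w = contract x (\<lambda>u. H (y # u)) w"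
    using Cons.prems by (intro Cons.IH) (auto)
  then show ?case using Cons.prems by (simp)
qed simp

lemma contract_append:
  assumes "x \<in> carrier U" "\<And>u. u \<in> W \<Longrightarrow> G u \<in> carrier F" "w \<in> W" "v \<in> W"
  shows "contract x G (w @ v) = contract x (\<lambda>u. G (u @ v)) w \<oplus> contract x (\<lambda>u. G (w @ u)) v"
  using assms
proof (induction w arbitrary: G)
  case Nil
  then show ?case by (simp add: contract_closed)
next
  case (Cons y w)
  have "contract x (\<lambda>u. G (y # u)) (w @ v)
      = contract x (\<lambda>u. G (y # u @ v)) w \<oplus> contract x (\<lambda>u. G (y # w @ u)) v"
    using Cons.prems by (intro Cons.IH) (auto)
  moreover have "contract x (\<lambda>u. G (y # u @ v)) w \<in> carrier F" "contract x (\<lambda>u. G (y # w @ u)) v \<in> carrier F"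
    using Cons.prems by (auto intro!: contract_closed)
  ultimately show ?case
    using Cons.prems by (simp add: beta_closed F.a_assoc)
qed

lemma contract_linear:
  assumes "x \<in> carrier U" "\<And>u. u \<in> W \<Longrightarrow> G u \<in> carrier F" "\<And>u. u \<in> W \<Longrightarrow> H u \<in> carrier F" "w \<in> W"
  shows "contract x (\<lambda>u. G u \<oplus> H u) w = contract x G w \<oplus> contract x H w"
  using assms
proof (induction w arbitrary: G H)
  case (Cons y w)
  have "contract x (\<lambda>u. G (y # u) \<oplus> H (y # u)) w
      = contract x (\<lambda>u. G (y # u)) w \<oplus> contract x (\<lambda>u. H (y # u)) w"
    using Cons.prems by (intro Cons.IH) (auto)
  moreover have "contract x (\<lambda>u. G (y # u)) w \<in> carrier F" "contract x (\<lambda>u. H (y # u)) w \<in> carrier F"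
    using Cons.prems by (auto intro!: contract_closed)
  ultimately show ?case
    using Cons.prems by (simp add: beta_closed F.r_distr F.a_ac)
qed simp

lemma contract_scale:
  assumes "x \<in> carrier U" "\<And>u. u \<in> W \<Longrightarrow> G u \<in> carrier F" "c \<in> carrier F" "w \<in> W"
  shows "contract x (\<lambda>u. c \<otimes> G u) w = c \<otimes> contract x G w"
  using assms
proof (induction w arbitrary: G)
  case (Cons y w)
  have "contract x (\<lambda>u. c \<otimes> G (y # u)) w = c \<otimes> contract x (\<lambda>u. G (y # u)) w"
    using Cons.prems by (intro Cons.IH) (auto)
  moreover have "contract x (\<lambda>u. G (y # u)) w \<in> carrier F"
    using Cons.prems by (auto intro!: contract_closed)
  ultimately show ?case
    using Cons.prems by (simp add: beta_closed F.r_distr F.m_lcomm)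
qed simp

lemma contract_vector:
  assumes "x \<in> carrier U" "y \<in> carrier U" "c \<in> carrier F" "\<And>u. u \<in> W \<Longrightarrow> G u \<in> carrier F" "w \<in> W"
  shows "contract (x \<oplus>\<^bsub>U\<^esub> y) G w = contract x G w \<oplus> contract y G w"
    and "contract (c \<odot>\<^bsub>U\<^esub> x) G w = c \<otimes> contract x G w"
  using assms
proof (induction w arbitrary: G)
  case (Cons z w)
  {
    case 1
    have "contract (x \<oplus>\<^bsub>U\<^esub> y) (\<lambda>u. G (z # u)) w = contract x (\<lambda>u. G (z # u)) w \<oplus> contract y (\<lambda>u. G (z # u)) w"
      using 1 by (intro Cons.IH(1)) (auto)
    moreover have "contract x (\<lambda>u. G (z # u)) w \<in> carrier F" "contract y (\<lambda>u. G (z # u)) w \<in> carrier F"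
      using 1 by (auto intro!: contract_closed)
    ultimately show ?case
      using 1 by (simp add: beta_closed beta_add F.l_distr F.a_ac)
  next
    case 2
    have "contract (c \<odot>\<^bsub>U\<^esub> x) (\<lambda>u. G (z # u)) w = c \<otimes> contract x (\<lambda>u. G (z # u)) w"
      using 2 by (intro Cons.IH(2)) (auto)
    moreover have "contract x (\<lambda>u. G (z # u)) w \<in> carrier F"
      using 2 by (auto intro!: contract_closed)
    ultimately show ?case
      using 2 by (simp add: beta_closed beta_smult F.r_distr F.m_assoc)
  }
qed simp_all

text \<open>Two letters are deleted, and each pair occurs once for either order with the same
  coefficient; in characteristic 2 the two terms cancel. This is the rule that an interior product
  squares to zero.\<close>

lemma contract_contract:
  assumes "x \<in> carrier U" "\<And>u. u \<in> W \<Longrightarrow> G u \<in> carrier F" "w \<in> W"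
  shows "contract x (contract x G) w = \<zero>"
  using assms
proof (induction w arbitrary: G)
  case (Cons y w)
  have y: "y \<in> carrier U" "w \<in> W" using Cons.prems by auto
  have cl: "\<And>u. u \<in> W \<Longrightarrow> contract x (\<lambda>t. G (y # t)) u \<in> carrier F"
    using Cons.prems by (auto intro!: contract_closed)
  have cl2: "contract x G w \<in> carrier F" using Cons.prems by (auto intro!: contract_closed)
  have "contract x (\<lambda>u. contract x G (y # u)) w
      = contract x (\<lambda>u. \<beta> x y \<otimes> G u) w \<oplus> contract x (contract x (\<lambda>t. G (y # t))) w"
    using Cons.prems cl y by (simp add: contract_linear beta_closed)
  also have "\<dots> = \<beta> x y \<otimes> contract x G w"
    using Cons.prems y cl2 by (simp add: contract_scale Cons.IH beta_closed)
  finally show ?case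
    using y Cons.prems(1) cl2 by (simp add: F_add_self beta_closed)
qed simp

text \<open>The recursive call is hidden in the function argument of \<open>contract\<close>, hence
  the fuel. A call uses one unit and removes two letters, so fuel equal to the length suffices and
  the value for fuel 0 is then met only on the empty word.\<close>

primrec wick_fuel :: "nat \<Rightarrow> 'v list \<Rightarrow> 'f" where
  "wick_fuel 0 w = \<one>"
| "wick_fuel (Suc n) w = (case w of [] \<Rightarrow> \<one> | x # u \<Rightarrow> contract x (wick_fuel n) u)"

definition wick :: "'v list \<Rightarrow> 'f" where "wick w = wick_fuel (length w) w"

lemma wick_fuel_stable: "\<lbrakk>w \<in> W; length w \<le> n\<rbrakk> \<Longrightarrow> wick_fuel n w = wick w"
proof (induction n arbitrary: w rule: less_induct)
  case (less n)
  show ?case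
  proof (cases w)
    case Nil
    then show ?thesis by (cases n) (auto simp: wick_def)
  next
    case (Cons x u)
    then obtain k where k: "n = Suc k" using less.prems by (cases n) auto
    have "contract x (wick_fuel k) u = contract x (wick_fuel (length u)) u"
    proof (rule contract_cong)
      fix v assume v: "v \<in> W" "length v < length u"
      have "wick_fuel k v = wick v" using less.IH[of k v] v Cons k less.prems by auto
      moreover have "wick_fuel (length u) v = wick v" using less.IH[of "length u" v] v Cons k less.prems by auto
      ultimately show "wick_fuel k v = wick_fuel (length u) v" by simp
    qed (use less.prems Cons in auto)
    then show ?thesis using Cons k by (simp add: wick_def)
  qed
qed

lemma wick_Nil: "wick [] = \<one>"
  by (simp add: wick_def)

lemma wick_Cons: "\<lbrakk>x \<in> carrier U; w \<in> W\<rbrakk> \<Longrightarrow> wick (x # w) = contract x wick w"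
  unfolding wick_def[of "x # w"] by (auto intro!: contract_cong wick_fuel_stable)

lemma wick_closed: "w \<in> W \<Longrightarrow> wick w \<in> carrier F"
proof -
  have "w \<in> W \<Longrightarrow> wick_fuel n w \<in> carrier F" for n w
    by (induction n arbitrary: w) (auto split: list.split intro!: contract_closed)
  then show "w \<in> W \<Longrightarrow> wick w \<in> carrier F" by (simp add: wick_def)
qed

text \<open>The three terms say in which block the partner of x lies.\<close>

lemma wick_expand:
  assumes "x \<in> carrier U" "w \<in> W" "v \<in> W" "r \<in> W"
  shows "wick (x # w @ r @ v) = contract x (\<lambda>s. wick (s @ r @ v)) w
      \<oplus> (contract x (\<lambda>s. wick (w @ s @ v)) r \<oplus> contract x (\<lambda>s. wick (w @ r @ s)) v)"
  using assms
  by (simp add: wick_Cons contract_append wick_closed)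

lemma wick_closed_mid:
  "\<lbrakk>x \<in> carrier U; w \<in> W; v \<in> W; r \<in> W\<rbrakk> \<Longrightarrow> contract x (\<lambda>s. wick (s @ r @ v)) w \<in> carrier F"
  "\<lbrakk>x \<in> carrier U; w \<in> W; v \<in> W; r \<in> W\<rbrakk> \<Longrightarrow> contract x (\<lambda>s. wick (w @ s @ v)) r \<in> carrier F"
  "\<lbrakk>x \<in> carrier U; w \<in> W; v \<in> W; r \<in> W\<rbrakk> \<Longrightarrow> contract x (\<lambda>s. wick (w @ r @ s)) v \<in> carrier F"
  by (auto intro!: contract_closed wick_closed)

text \<open>The defining relations of the Clifford algebra, in the middle of an arbitrary word. If
  they stand at the front, linearity of \<open>contract\<close> in the vector and
  \<open>contract_contract\<close> give them; otherwise the first letter is contracted away and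
  induction on the total length of the context applies.\<close>

lemma wick_relations:
  assumes "w \<in> W" "v \<in> W" "a \<in> carrier U" "b \<in> carrier U" "c \<in> carrier F"
  shows wick_add: "wick (w @ [a \<oplus>\<^bsub>U\<^esub> b] @ v) = wick (w @ [a] @ v) \<oplus> wick (w @ [b] @ v)"
    and wick_smult: "wick (w @ [c \<odot>\<^bsub>U\<^esub> a] @ v) = c \<otimes> wick (w @ [a] @ v)"
    and wick_square: "wick (w @ [a, a] @ v) = \<psi> a \<otimes> wick (w @ v)"
proof -
  have "wick (w @ [a \<oplus>\<^bsub>U\<^esub> b] @ v) = wick (w @ [a] @ v) \<oplus> wick (w @ [b] @ v)
      \<and> wick (w @ [c \<odot>\<^bsub>U\<^esub> a] @ v) = c \<otimes> wick (w @ [a] @ v)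
      \<and> wick (w @ [a, a] @ v) = \<psi> a \<otimes> wick (w @ v)"
    using assms(1,2)
  proof (induction "length w + length v" arbitrary: w v rule: less_induct)
    case less
    show ?case
    proof (cases w)
      case Nil
      \<comment> \<open>Either the first \<open>a\<close> is paired with its neighbour, giving
        \<open>\<psi> a\<close>, or with a letter of \<open>v\<close>. In the second case the other
        \<open>a\<close> is contracted as well, and \<open>contract_contract\<close> kills the
        sum.\<close>
      have "wick (a # a # v) = \<beta> a a \<otimes> wick v \<oplus> contract a (\<lambda>u. wick (a # u)) v"
        using assms less.prems by (simp add: wick_Cons)
      also have "contract a (\<lambda>u. wick (a # u)) v = contract a (contract a wick) v"
        using assms less.prems by (intro contract_cong) (auto simp: wick_Cons)
      finally have "wick (a # a # v) = \<psi> a \<otimes> wick v"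
        using assms less.prems by (simp add: contract_contract wick_closed beta_diag psi_closed)
      then show ?thesis
        using Nil assms less.prems by (simp add: wick_Cons contract_vector wick_closed)
    next
      case (Cons x u)
      have xu: "x \<in> carrier U" "u \<in> W" using Cons less.prems by auto
      note cl = wick_closed_mid[OF xu(1)] wick_closed
      have IHl: "wick (s @ [a \<oplus>\<^bsub>U\<^esub> b] @ v) = wick (s @ [a] @ v) \<oplus> wick (s @ [b] @ v)"
          "wick (s @ [c \<odot>\<^bsub>U\<^esub> a] @ v) = c \<otimes> wick (s @ [a] @ v)"
          "wick (s @ [a, a] @ v) = \<psi> a \<otimes> wick (s @ v)" if "s \<in> W" "length s < length u" for s
        using less.hyps[of s v] that less.prems Cons by auto
      have IHr: "wick (u @ [a \<oplus>\<^bsub>U\<^esub> b] @ s) = wick (u @ [a] @ s) \<oplus> wick (u @ [b] @ s)"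
          "wick (u @ [c \<odot>\<^bsub>U\<^esub> a] @ s) = c \<otimes> wick (u @ [a] @ s)"
          "wick (u @ [a, a] @ s) = \<psi> a \<otimes> wick (u @ s)" if "s \<in> W" "length s < length v" for s
        using less.hyps[of u s] that xu Cons by auto
      have IHm: "wick (u @ [a \<oplus>\<^bsub>U\<^esub> b] @ v) = wick (u @ [a] @ v) \<oplus> wick (u @ [b] @ v)"
          "wick (u @ [c \<odot>\<^bsub>U\<^esub> a] @ v) = c \<otimes> wick (u @ [a] @ v)"
          "wick (u @ [a, a] @ v) = \<psi> a \<otimes> wick (u @ v)"
        using less.hyps[of u v] xu less.prems Cons by auto
      have v: "v \<in> W" using less.prems by simp
      have ab: "[a \<oplus>\<^bsub>U\<^esub> b] \<in> W" "[c \<odot>\<^bsub>U\<^esub> a] \<in> W" "[a] \<in> W" "[b] \<in> W" "[a, a] \<in> W" "[] \<in> W"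
        using assms by auto
      have uv: "u @ v \<in> W" "u @ [a] @ v \<in> W" using xu v ab by auto
      \<comment> \<open>The partner of \<open>x\<close> lies to the left of the altered letters.
        Deleting it shortens the context, so the induction hypothesis may be used under the
        contraction; \<open>r\<close> is the mirror image.\<close>
      have l: "contract x (\<lambda>s. wick (s @ [a \<oplus>\<^bsub>U\<^esub> b] @ v)) u
          = contract x (\<lambda>s. wick (s @ [a] @ v)) u \<oplus> contract x (\<lambda>s. wick (s @ [b] @ v)) u"
        "contract x (\<lambda>s. wick (s @ [c \<odot>\<^bsub>U\<^esub> a] @ v)) u = c \<otimes> contract x (\<lambda>s. wick (s @ [a] @ v)) u"
        "contract x (\<lambda>s. wick (s @ [a, a] @ v)) u = \<psi> a \<otimes> contract x (\<lambda>s. wick (s @ v)) u"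
        using xu v assms
        by (subst contract_linear[symmetric] contract_scale[symmetric];
            auto intro!: contract_cong IHl wick_closed psi_closed simp del: append.simps)+
      have r: "contract x (\<lambda>s. wick (u @ [a \<oplus>\<^bsub>U\<^esub> b] @ s)) v
          = contract x (\<lambda>s. wick (u @ [a] @ s)) v \<oplus> contract x (\<lambda>s. wick (u @ [b] @ s)) v"
        "contract x (\<lambda>s. wick (u @ [c \<odot>\<^bsub>U\<^esub> a] @ s)) v = c \<otimes> contract x (\<lambda>s. wick (u @ [a] @ s)) v"
        "contract x (\<lambda>s. wick (u @ [a, a] @ s)) v = \<psi> a \<otimes> contract x (\<lambda>s. wick (u @ s)) v"
        using xu v assms
        by (subst contract_linear[symmetric] contract_scale[symmetric];
            auto intro!: contract_cong IHr wick_closed psi_closed simp del: append.simps)+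
      have m: "contract x (\<lambda>s. wick (u @ s @ v)) [z] = \<beta> x z \<otimes> wick (u @ v)" if "z \<in> carrier U" for z
        using xu v that by (simp add: beta_closed wick_closed)
      \<comment> \<open>Whichever copy of \<open>a\<close> is the partner, the same word with the
        same factor remains, so the two terms cancel.\<close>
      have m2: "contract x (\<lambda>s. wick (u @ s @ v)) [a, a] = \<zero>"
        using xu v assms ab uv by (simp add: beta_closed wick_closed F_add_self)
      have m0: "contract x (\<lambda>s. wick (u @ s @ v)) [] = \<zero>" by simp
      have A: "wick (w @ [a \<oplus>\<^bsub>U\<^esub> b] @ v) = wick (w @ [a] @ v) \<oplus> wick (w @ [b] @ v)"
        unfolding Cons append_Cons[of x u] wick_expand[OF xu v ab(1)] wick_expand[OF xu v ab(3)] wick_expand[OF xu v ab(4)] l r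
        using xu v assms m cl ab uv
        by (simp add: beta_add beta_closed F.l_distr F.a_ac del: append.simps contract.simps)
      have B: "wick (w @ [c \<odot>\<^bsub>U\<^esub> a] @ v) = c \<otimes> wick (w @ [a] @ v)"
        unfolding Cons append_Cons[of x u] wick_expand[OF xu v ab(2)] wick_expand[OF xu v ab(3)] l r
        using xu v assms m cl ab uv
        by (simp add: beta_smult beta_closed F.r_distr F.m_assoc del: append.simps contract.simps)
      have C: "wick (w @ [a, a] @ v) = \<psi> a \<otimes> wick (w @ v)"
        unfolding Cons append_Cons[of x u] wick_expand[OF xu v ab(5)] wick_expand[OF xu v ab(6), unfolded append_Nil] l r m2 m0
        using xu v assms cl ab(6) uv
        by (simp add: psi_closed F.r_distr wick_closed_mid(1,3)[OF xu v ab(6), unfolded append_Nil] del: append.simps contract.simps)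
      show ?thesis using A B C by blast
    qed
  qed
  then show "wick (w @ [a \<oplus>\<^bsub>U\<^esub> b] @ v) = wick (w @ [a] @ v) \<oplus> wick (w @ [b] @ v)"
    "wick (w @ [c \<odot>\<^bsub>U\<^esub> a] @ v) = c \<otimes> wick (w @ [a] @ v)"
    "wick (w @ [a, a] @ v) = \<psi> a \<otimes> wick (w @ v)" by blast+
qed

end

definition self_module :: "('f, 'm) ring_scheme \<Rightarrow> ('f, 'f) module" where
  "self_module F = \<lparr>carrier = carrier F, mult = mult F, one = one F, zero = zero F, add = add F, smult = mult F\<rparr>"

lemma (in cring) module_self_module: "module R (self_module R)"
proof (rule moduleI)
  show "abelian_group (self_module R)"
  proof (rule abelian_groupI)
    fix x assume "x \<in> carrier (self_module R)"
    then show "\<exists>y\<in>carrier (self_module R). y \<oplus>\<^bsub>self_module R\<^esub> x = \<zero>\<^bsub>self_module R\<^esub>"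
      by (intro bexI[of _ "\<ominus> x"]) (auto simp: self_module_def l_neg)
  qed (auto simp: self_module_def a_ac)
qed (auto simp: self_module_def is_cring l_distr r_distr m_assoc)

section \<open>From Wick's functional to a nonzero Clifford algebra\<close>

context clifford_contraction
begin

sublocale L: free_linear F "carrier U" "self_module F" wick
proof -
  interpret S: module F "self_module F" by (rule F.module_self_module)
  show "free_linear F (carrier U) (self_module F) wick"
    by unfold_locales (auto simp: self_module_def W_def[symmetric] wick_closed simp del: in_lists_conv_set)
qed

abbreviation "wd w \<equiv> free.mono \<one> w"

lemma wd_closed: "w \<in> W \<Longrightarrow> wd w \<in> carrier M"
  by (simp add: free.mono_closed W_def)

lemma wd_mult: "wd u \<otimes>\<^bsub>M\<^esub> wd v = wd (u @ v)"
  by (simp add: free.mono_mult)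

definition vev :: "('v list \<Rightarrow> 'f) \<Rightarrow> 'f" where "vev = L.lin_ext"

lemma vev_simps:
  "vev \<zero>\<^bsub>M\<^esub> = \<zero>" "w \<in> W \<Longrightarrow> vev (wd w) = wick w"
  "\<lbrakk>p \<in> carrier M; r \<in> carrier M\<rbrakk> \<Longrightarrow> vev (p \<oplus>\<^bsub>M\<^esub> r) = vev p \<oplus> vev r"
  "\<lbrakk>c \<in> carrier F; p \<in> carrier M\<rbrakk> \<Longrightarrow> vev (c \<odot>\<^bsub>M\<^esub> p) = c \<otimes> vev p"
  "p \<in> carrier M \<Longrightarrow> vev p \<in> carrier F"
  using L.lin_ext_zero L.lin_ext_mono[of \<one> w] L.lin_ext_add[of p r] L.lin_ext_smult[of c p] L.lin_ext_closed[of p]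
    wick_closed[of w]
  by (simp_all add: vev_def self_module_def W_def)

lemma vev_minus: "\<lbrakk>p \<in> carrier M; r \<in> carrier M\<rbrakk> \<Longrightarrow> vev (p \<ominus>\<^bsub>M\<^esub> r) = vev p \<ominus> vev r"
proof -
  assume *: "p \<in> carrier M" "r \<in> carrier M"
  have "p \<ominus>\<^bsub>M\<^esub> r = p \<oplus>\<^bsub>M\<^esub> (\<ominus> \<one>) \<odot>\<^bsub>M\<^esub> r"
    using * free.M.smult_l_minus[of \<one> r] by (simp add: a_minus_def[of M])
  then show ?thesis using * by (simp add: vev_simps F.minus_eq F.l_minus)
qed

text \<open>The kernel of \<open>vev\<close> need not be an ideal; testing between arbitrary words
  on both sides gives the largest ideal inside it. The relations, known in every context, belong to
  it, and 1 does not.\<close>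

definition vacuum_ideal :: "('v list \<Rightarrow> 'f) set" where
  "vacuum_ideal = {p \<in> carrier M. \<forall>w\<in>W. \<forall>v\<in>W. vev (wd w \<otimes>\<^bsub>M\<^esub> p \<otimes>\<^bsub>M\<^esub> wd v) = \<zero>}"

lemma mono_eq_smult: "c \<in> carrier F \<Longrightarrow> free.mono c u = c \<odot>\<^bsub>M\<^esub> wd u"
  by (auto simp: free.free_ops(4) free.mono_def)

lemma ideal_vacuum: "ideal vacuum_ideal M"
proof (rule idealI)
  show "ring M" by (rule M.A.ring_axioms)
  have neg: "\<ominus>\<^bsub>M\<^esub> p = (\<ominus> \<one>) \<odot>\<^bsub>M\<^esub> p" if "p \<in> carrier M" for p
    using that free.M.smult_l_minus[of \<one> p] by simp
  show "subgroup vacuum_ideal (add_monoid M)"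
  proof (rule free.M.add.subgroupI)
    show "vacuum_ideal \<noteq> {}"
      by (auto simp: vacuum_ideal_def wd_closed vev_simps intro!: exI[of _ "\<zero>\<^bsub>M\<^esub>"])
    fix a b assume a: "a \<in> vacuum_ideal" and b: "b \<in> vacuum_ideal"
    then show "a \<oplus>\<^bsub>M\<^esub> b \<in> vacuum_ideal"
      by (auto simp: vacuum_ideal_def wd_closed vev_simps M.A.r_distr M.A.l_distr)
  next
    fix a assume a: "a \<in> vacuum_ideal"
    then show "\<ominus>\<^bsub>M\<^esub> a \<in> vacuum_ideal"
      by (auto simp: vacuum_ideal_def neg wd_closed vev_simps M.smult_mult_l M.smult_mult_r)
  qed (auto simp: vacuum_ideal_def)
next
  fix a x assume a: "a \<in> vacuum_ideal" and x: "x \<in> carrier M"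
  have aM: "a \<in> carrier M" using a by (simp add: vacuum_ideal_def)
  note cl = wd_closed aM
  have "vev (wd w \<otimes>\<^bsub>M\<^esub> (x \<otimes>\<^bsub>M\<^esub> a) \<otimes>\<^bsub>M\<^esub> wd v) = \<zero>" if wv: "w \<in> W" "v \<in> W" for w v
    using x
  proof (induction rule: free.free_induct)
    case zero
    show ?case using wv cl by (simp add: vev_simps)
  next
    case (add c u p)
    then have u: "u \<in> W" by (simp add: W_def)
    have "wd w \<otimes>\<^bsub>M\<^esub> (wd u \<otimes>\<^bsub>M\<^esub> a) \<otimes>\<^bsub>M\<^esub> wd v = wd (w @ u) \<otimes>\<^bsub>M\<^esub> a \<otimes>\<^bsub>M\<^esub> wd v"
      using u wv cl by (simp add: wd_mult[symmetric] M.A.m_assoc)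
    moreover have "vev (wd (w @ u) \<otimes>\<^bsub>M\<^esub> a \<otimes>\<^bsub>M\<^esub> wd v) = \<zero>" using a u wv by (simp add: vacuum_ideal_def)
    ultimately show ?case
      using u wv cl add by (simp add: mono_eq_smult[OF add(1), of u] M.A.l_distr M.A.r_distr M.smult_mult_l M.smult_mult_r vev_simps)
  qed
  then show "x \<otimes>\<^bsub>M\<^esub> a \<in> vacuum_ideal" using x aM by (simp add: vacuum_ideal_def)
  have "vev (wd w \<otimes>\<^bsub>M\<^esub> (a \<otimes>\<^bsub>M\<^esub> x) \<otimes>\<^bsub>M\<^esub> wd v) = \<zero>" if wv: "w \<in> W" "v \<in> W" for w v
    using x
  proof (induction rule: free.free_induct)
    case zero
    show ?case using wv cl by (simp add: vev_simps)
  next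
    case (add c u p)
    then have u: "u \<in> W" by (simp add: W_def)
    have "wd w \<otimes>\<^bsub>M\<^esub> (a \<otimes>\<^bsub>M\<^esub> wd u) \<otimes>\<^bsub>M\<^esub> wd v = wd w \<otimes>\<^bsub>M\<^esub> a \<otimes>\<^bsub>M\<^esub> wd (u @ v)"
      using u wv cl by (simp add: wd_mult[symmetric] M.A.m_assoc)
    moreover have "vev (wd w \<otimes>\<^bsub>M\<^esub> a \<otimes>\<^bsub>M\<^esub> wd (u @ v)) = \<zero>" using a u wv by (simp add: vacuum_ideal_def)
    ultimately show ?case
      using u wv cl add by (simp add: mono_eq_smult[OF add(1), of u] M.A.l_distr M.A.r_distr M.smult_mult_l M.smult_mult_r vev_simps)
  qed
  then show "a \<otimes>\<^bsub>M\<^esub> x \<in> vacuum_ideal" using x aM by (simp add: vacuum_ideal_def)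
qed

lemma l_wd: "l u = wd [u]"
  by (rule free.free_letter_mono)

lemma sandwich: "w \<in> W \<Longrightarrow> v \<in> W \<Longrightarrow> u \<in> W \<Longrightarrow> vev (wd w \<otimes>\<^bsub>M\<^esub> wd u \<otimes>\<^bsub>M\<^esub> wd v) = wick (w @ u @ v)"
  by (simp add: wd_mult vev_simps)

lemma sandwich_linear:
  assumes "w \<in> W" "v \<in> W" "p \<in> carrier M" "r \<in> carrier M" "c \<in> carrier F"
  shows "vev (wd w \<otimes>\<^bsub>M\<^esub> (p \<oplus>\<^bsub>M\<^esub> r) \<otimes>\<^bsub>M\<^esub> wd v) = vev (wd w \<otimes>\<^bsub>M\<^esub> p \<otimes>\<^bsub>M\<^esub> wd v) \<oplus> vev (wd w \<otimes>\<^bsub>M\<^esub> r \<otimes>\<^bsub>M\<^esub> wd v)"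
    and "vev (wd w \<otimes>\<^bsub>M\<^esub> (c \<odot>\<^bsub>M\<^esub> p) \<otimes>\<^bsub>M\<^esub> wd v) = c \<otimes> vev (wd w \<otimes>\<^bsub>M\<^esub> p \<otimes>\<^bsub>M\<^esub> wd v)"
    and "vev (wd w \<otimes>\<^bsub>M\<^esub> (p \<ominus>\<^bsub>M\<^esub> r) \<otimes>\<^bsub>M\<^esub> wd v) = vev (wd w \<otimes>\<^bsub>M\<^esub> p \<otimes>\<^bsub>M\<^esub> wd v) \<ominus> vev (wd w \<otimes>\<^bsub>M\<^esub> r \<otimes>\<^bsub>M\<^esub> wd v)"
proof -
  show "vev (wd w \<otimes>\<^bsub>M\<^esub> (p \<oplus>\<^bsub>M\<^esub> r) \<otimes>\<^bsub>M\<^esub> wd v) = vev (wd w \<otimes>\<^bsub>M\<^esub> p \<otimes>\<^bsub>M\<^esub> wd v) \<oplus> vev (wd w \<otimes>\<^bsub>M\<^esub> r \<otimes>\<^bsub>M\<^esub> wd v)"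
    using assms wd_closed by (simp add: M.A.r_distr M.A.l_distr vev_simps)
  show "vev (wd w \<otimes>\<^bsub>M\<^esub> (c \<odot>\<^bsub>M\<^esub> p) \<otimes>\<^bsub>M\<^esub> wd v) = c \<otimes> vev (wd w \<otimes>\<^bsub>M\<^esub> p \<otimes>\<^bsub>M\<^esub> wd v)"
    using assms wd_closed by (simp add: M.smult_mult_l M.smult_mult_r vev_simps)
  have "wd w \<otimes>\<^bsub>M\<^esub> (p \<ominus>\<^bsub>M\<^esub> r) \<otimes>\<^bsub>M\<^esub> wd v = (wd w \<otimes>\<^bsub>M\<^esub> p \<otimes>\<^bsub>M\<^esub> wd v) \<ominus>\<^bsub>M\<^esub> (wd w \<otimes>\<^bsub>M\<^esub> r \<otimes>\<^bsub>M\<^esub> wd v)"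
    using assms wd_closed by (simp add: a_minus_def[of M] M.A.r_distr M.A.l_distr M.A.r_minus M.A.l_minus)
  then show "vev (wd w \<otimes>\<^bsub>M\<^esub> (p \<ominus>\<^bsub>M\<^esub> r) \<otimes>\<^bsub>M\<^esub> wd v) = vev (wd w \<otimes>\<^bsub>M\<^esub> p \<otimes>\<^bsub>M\<^esub> wd v) \<ominus> vev (wd w \<otimes>\<^bsub>M\<^esub> r \<otimes>\<^bsub>M\<^esub> wd v)"
    using assms wd_closed by (simp add: vev_minus)
qed

text \<open>The free algebra modulo \<open>vacuum_ideal\<close> satisfies the Clifford relations, so
  the Clifford algebra maps to it. If 1 were 0 there, the functional would vanish on the empty word,
  where it is 1.\<close>

theorem clifford_nontrivial: "\<one>\<^bsub>C\<^esub> \<noteq> \<zero>\<^bsub>C\<^esub>"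
proof
  let ?B = "alg_quot M vacuum_ideal" and ?f = "\<lambda>u. vacuum_ideal +>\<^bsub>M\<^esub> l u"
  have B: "assoc_alg F ?B" by (rule M.assoc_alg_quot[OF ideal_vacuum])
  interpret B: assoc_alg F ?B by (rule B)
  note proj = M.alg_hom_proj[OF ideal_vacuum]
  have lc: "wd [u] \<in> carrier M" if "u \<in> carrier U" for u using that by (intro wd_closed) simp
  have "?f \<in> module_hom F U ?B"
  proof -
    have "wd [u \<oplus>\<^bsub>U\<^esub> v] \<ominus>\<^bsub>M\<^esub> (wd [u] \<oplus>\<^bsub>M\<^esub> wd [v]) \<in> vacuum_ideal" if "u \<in> carrier U" "v \<in> carrier U" for u v
      using that lc unfolding vacuum_ideal_def
      by (auto simp: sandwich_linear[of _ _ _ _ \<one>] sandwich wick_add[of _ _ _ _ \<one>, simplified] F.r_right_minus_eq wick_closed)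
    moreover have "wd [c \<odot>\<^bsub>U\<^esub> u] \<ominus>\<^bsub>M\<^esub> c \<odot>\<^bsub>M\<^esub> wd [u] \<in> vacuum_ideal" if "u \<in> carrier U" "c \<in> carrier F" for u c
      using that lc unfolding vacuum_ideal_def
      by (auto simp: sandwich_linear(3)[of _ _ _ _ \<one>] sandwich_linear(2)[of _ _ "wd [u]" "wd [u]"] sandwich
          wick_smult[of _ _ _ u, simplified] F.r_right_minus_eq wick_closed)
    ultimately show ?thesis
      by (auto simp: module_hom_def l_wd lc alg_homD(1)[OF proj] alg_homD(3,4)[OF proj, symmetric]
          M.coset_eq_iff[OF ideal_vacuum])
  qed
  moreover have "?f u \<otimes>\<^bsub>?B\<^esub> ?f u = \<psi> u \<odot>\<^bsub>?B\<^esub> \<one>\<^bsub>?B\<^esub>" if u: "u \<in> carrier U" for u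
  proof -
    have one: "\<one>\<^bsub>M\<^esub> = wd []" by (rule free.free_ops(2))
    have "wd [u, u] \<ominus>\<^bsub>M\<^esub> \<psi> u \<odot>\<^bsub>M\<^esub> \<one>\<^bsub>M\<^esub> \<in> vacuum_ideal"
      using u lc psi_closed wd_closed unfolding vacuum_ideal_def one
      by (auto simp: sandwich_linear(3)[of _ _ _ _ \<one>] sandwich_linear(2)[of _ _ "wd []" "wd []"] sandwich
          wick_square[of _ _ u u \<one>, simplified] F.r_right_minus_eq wick_closed)
    then have "vacuum_ideal +>\<^bsub>M\<^esub> wd [u, u] = vacuum_ideal +>\<^bsub>M\<^esub> (\<psi> u \<odot>\<^bsub>M\<^esub> \<one>\<^bsub>M\<^esub>)"
      using u psi_closed by (simp add: M.coset_eq_iff[OF ideal_vacuum] wd_closed)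
    moreover have "?f u \<otimes>\<^bsub>?B\<^esub> ?f u = vacuum_ideal +>\<^bsub>M\<^esub> wd [u, u]"
      using u lc by (simp add: l_wd alg_homD(2)[OF proj, symmetric] wd_mult)
    moreover have "\<psi> u \<odot>\<^bsub>?B\<^esub> \<one>\<^bsub>?B\<^esub> = vacuum_ideal +>\<^bsub>M\<^esub> (\<psi> u \<odot>\<^bsub>M\<^esub> \<one>\<^bsub>M\<^esub>)"
      using u psi_closed by (simp add: alg_homD(4,5)[OF proj])
    ultimately show ?thesis by simp
  qed
  ultimately obtain h where h: "alg_hom F C ?B h" using universal[OF B] by blast
  assume "\<one>\<^bsub>C\<^esub> = \<zero>\<^bsub>C\<^esub>"
  then have "\<one>\<^bsub>?B\<^esub> = \<zero>\<^bsub>?B\<^esub>"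
    using alg_homD(5)[OF h] alg_hom_zero(1)[OF C.assoc_alg_axioms B h] by simp
  then have "\<one>\<^bsub>M\<^esub> \<in> vacuum_ideal"
    using alg_homD(5)[OF proj] M.coset_zero_iff[OF ideal_vacuum, of "\<one>\<^bsub>M\<^esub>"] by simp
  then have "vev (wd [] \<otimes>\<^bsub>M\<^esub> \<one>\<^bsub>M\<^esub> \<otimes>\<^bsub>M\<^esub> wd []) = \<zero>" by (simp add: vacuum_ideal_def)
  then have "wick [] = \<zero>" using wd_closed by (simp add: vev_simps wd_mult)
  then show False by (simp add: wick_Nil)
qed

end

section \<open>Involutions of quadratic spaces\<close>

locale quadratic_char2 = F: field F + V: vectorspace F V
  for F :: "('f, 'm) ring_scheme" (structure) and V :: "('f, 'v) module" +
  fixes q :: "'v \<Rightarrow> 'f"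
  assumes char2: "\<one> \<oplus> \<one> = \<zero>"
    and quad: "quadratic_form F V q"
begin

abbreviation b :: "'v \<Rightarrow> 'v \<Rightarrow> 'f" where "b \<equiv> polar F V q"

lemma F2 [simp]: "x \<in> carrier F \<Longrightarrow> x \<oplus> x = \<zero>"
  using F.l_distr[of \<one> \<one> x] char2 by simp

lemma F2_left [simp]: "\<lbrakk>x \<in> carrier F; y \<in> carrier F\<rbrakk> \<Longrightarrow> x \<oplus> (x \<oplus> y) = y"
  by (simp add: F.a_assoc[symmetric])

lemma F2_neg [simp]: "x \<in> carrier F \<Longrightarrow> \<ominus> x = x"
  by (rule F.minus_equality) auto

lemma F2_minus [simp]: "\<lbrakk>x \<in> carrier F; y \<in> carrier F\<rbrakk> \<Longrightarrow> x \<ominus> y = x \<oplus> y"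
  by (simp add: F.minus_eq)

lemma F2_eq: "\<lbrakk>x \<in> carrier F; y \<in> carrier F\<rbrakk> \<Longrightarrow> x \<oplus> y = \<zero> \<longleftrightarrow> x = y"
  by (metis F.r_zero F2 F2_left)

lemma V2 [simp]: "x \<in> carrier V \<Longrightarrow> x \<oplus>\<^bsub>V\<^esub> x = \<zero>\<^bsub>V\<^esub>"
  using V.smult_l_distr[of \<one> \<one> x] char2 by simp

lemma V2_left [simp]: "\<lbrakk>x \<in> carrier V; y \<in> carrier V\<rbrakk> \<Longrightarrow> x \<oplus>\<^bsub>V\<^esub> (x \<oplus>\<^bsub>V\<^esub> y) = y"
  by (simp add: V.a_assoc[symmetric])

lemma V2_minus [simp]: "\<lbrakk>x \<in> carrier V; y \<in> carrier V\<rbrakk> \<Longrightarrow> x \<ominus>\<^bsub>V\<^esub> y = x \<oplus>\<^bsub>V\<^esub> y"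
proof -
  assume *: "x \<in> carrier V" "y \<in> carrier V"
  have "\<ominus>\<^bsub>V\<^esub> y = y" by (rule V.minus_equality) (use * in auto)
  then show ?thesis by (simp add: a_minus_def)
qed

lemma V2_eq: "\<lbrakk>x \<in> carrier V; y \<in> carrier V\<rbrakk> \<Longrightarrow> x \<oplus>\<^bsub>V\<^esub> y = \<zero>\<^bsub>V\<^esub> \<longleftrightarrow> x = y"
  by (metis V.r_zero V2 V2_left)

lemma q_closed [simp]: "v \<in> carrier V \<Longrightarrow> q v \<in> carrier F"
  and q_smult: "\<lbrakk>c \<in> carrier F; v \<in> carrier V\<rbrakk> \<Longrightarrow> q (c \<odot>\<^bsub>V\<^esub> v) = c \<otimes> c \<otimes> q v"
  and b_closed [simp]: "\<lbrakk>u \<in> carrier V; v \<in> carrier V\<rbrakk> \<Longrightarrow> b u v \<in> carrier F"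
  and b_add: "\<lbrakk>u \<in> carrier V; v \<in> carrier V; w \<in> carrier V\<rbrakk> \<Longrightarrow> b (u \<oplus>\<^bsub>V\<^esub> v) w = b u w \<oplus> b v w"
    "\<lbrakk>u \<in> carrier V; v \<in> carrier V; w \<in> carrier V\<rbrakk> \<Longrightarrow> b w (u \<oplus>\<^bsub>V\<^esub> v) = b w u \<oplus> b w v"
  and b_smult: "\<lbrakk>c \<in> carrier F; u \<in> carrier V; v \<in> carrier V\<rbrakk> \<Longrightarrow> b (c \<odot>\<^bsub>V\<^esub> u) v = c \<otimes> b u v"
    "\<lbrakk>c \<in> carrier F; u \<in> carrier V; v \<in> carrier V\<rbrakk> \<Longrightarrow> b u (c \<odot>\<^bsub>V\<^esub> v) = c \<otimes> b u v"
  using quad unfolding quadratic_form_def bilinear_form_def by auto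

lemma q_add: "\<lbrakk>u \<in> carrier V; v \<in> carrier V\<rbrakk> \<Longrightarrow> q (u \<oplus>\<^bsub>V\<^esub> v) = q u \<oplus> q v \<oplus> b u v"
  by (simp add: polar_def F.a_ac)

lemma q_zero: "q \<zero>\<^bsub>V\<^esub> = \<zero>"
  using q_smult[of \<zero> "\<zero>\<^bsub>V\<^esub>"] by simp

lemma b_sym: "\<lbrakk>u \<in> carrier V; v \<in> carrier V\<rbrakk> \<Longrightarrow> b u v = b v u"
  by (simp add: polar_def V.a_comm[of u v] F.a_ac)

lemma b_self: "v \<in> carrier V \<Longrightarrow> b v v = \<zero>"
  by (simp add: polar_def q_zero)

lemma b_zero [simp]: "v \<in> carrier V \<Longrightarrow> b \<zero>\<^bsub>V\<^esub> v = \<zero>" "v \<in> carrier V \<Longrightarrow> b v \<zero>\<^bsub>V\<^esub> = \<zero>"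
  using b_smult[of \<zero> "\<zero>\<^bsub>V\<^esub>" v] b_smult[of \<zero> v "\<zero>\<^bsub>V\<^esub>"] by simp_all

primrec lsum :: "(nat \<Rightarrow> 'f) \<Rightarrow> (nat \<Rightarrow> 'v) \<Rightarrow> nat \<Rightarrow> 'v" where
  "lsum c y 0 = \<zero>\<^bsub>V\<^esub>"
| "lsum c y (Suc k) = lsum c y k \<oplus>\<^bsub>V\<^esub> c k \<odot>\<^bsub>V\<^esub> y k"

lemma lsum_closed: "\<lbrakk>\<And>i. i < k \<Longrightarrow> c i \<in> carrier F; \<And>i. i < k \<Longrightarrow> y i \<in> carrier V\<rbrakk> \<Longrightarrow> lsum c y k \<in> carrier V"
  by (induction k) auto

lemma lsum_cong: "\<lbrakk>\<And>i. i < k \<Longrightarrow> c i = c' i; \<And>i. i < k \<Longrightarrow> y i = y' i\<rbrakk> \<Longrightarrow> lsum c y k = lsum c' y' k"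
  by (induction k) auto

lemma lsum_zero: "\<lbrakk>\<And>i. i < k \<Longrightarrow> c i = \<zero>; \<And>i. i < k \<Longrightarrow> y i \<in> carrier V\<rbrakk> \<Longrightarrow> lsum c y k = \<zero>\<^bsub>V\<^esub>"
  by (induction k) auto

lemma lsum_append:
  "\<lbrakk>\<And>i. i < m + k \<Longrightarrow> c i \<in> carrier F; \<And>i. i < m + k \<Longrightarrow> y i \<in> carrier V\<rbrakk>
    \<Longrightarrow> lsum c y (m + k) = lsum c y m \<oplus>\<^bsub>V\<^esub> lsum (\<lambda>i. c (m + i)) (\<lambda>i. y (m + i)) k"
proof (induction k)
  case 0
  then show ?case using lsum_closed[of m c y] by simp
next
  case (Suc k)
  then show ?case
    using lsum_closed[of m c y] lsum_closed[of k "\<lambda>i. c (m + i)" "\<lambda>i. y (m + i)"] by (simp add: V.a_assoc)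
qed

lemma lsum_submodule:
  "\<lbrakk>submodule F N V; \<And>i. i < k \<Longrightarrow> c i \<in> carrier F; \<And>i. i < k \<Longrightarrow> y i \<in> N\<rbrakk> \<Longrightarrow> lsum c y k \<in> N"
  by (induction k) (auto intro: submodule.zero_closed submodule.m_closed submodule.smult_closed)

lemma b_lsum_zero:
  "\<lbrakk>\<And>i. i < k \<Longrightarrow> c i \<in> carrier F; \<And>i. i < k \<Longrightarrow> y i \<in> carrier V; x \<in> carrier V; \<And>i. i < k \<Longrightarrow> b x (y i) = \<zero>\<rbrakk>
    \<Longrightarrow> b x (lsum c y k) = \<zero>"
  by (induction k) (auto simp: b_add b_smult lsum_closed)

lemma b_lsum_dual:
  assumes "\<And>i. i < k \<Longrightarrow> c i \<in> carrier F" "\<And>i. i < k \<Longrightarrow> y i \<in> carrier V" "x \<in> carrier V" "j < k"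
    "\<And>i. i < k \<Longrightarrow> b x (y i) = (if i = j then \<one> else \<zero>)"
  shows "b x (lsum c y k) = c j"
  using assms
proof (induction k)
  case (Suc k)
  have cl: "lsum c y k \<in> carrier V" using Suc.prems by (intro lsum_closed) auto
  show ?case
  proof (cases "j = k")
    case True
    then have "b x (lsum c y k) = \<zero>" using Suc.prems by (intro b_lsum_zero) auto
    then show ?thesis using Suc.prems True cl by (simp add: b_add b_smult)
  next
    case False
    then have "b x (lsum c y k) = c j" using Suc.prems by (intro Suc.IH) auto
    moreover have "b x (y k) = \<zero>" using Suc.prems(5)[of k] False by auto
    ultimately show ?thesis using Suc.prems False cl by (simp add: b_add b_smult)
  qed
qed simp

text \<open>An upper triangular bilinear form with diagonal \<open>q\<close>, built from coordinates \<open>xi\<close> along \<open>y\<close>.\<close>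
primrec tri :: "(nat \<Rightarrow> 'v \<Rightarrow> 'f) \<Rightarrow> (nat \<Rightarrow> 'v) \<Rightarrow> nat \<Rightarrow> 'v \<Rightarrow> 'v \<Rightarrow> 'f" where
  "tri xi y 0 u v = \<zero>"
| "tri xi y (Suc k) u v
    = tri xi y k u v \<oplus> xi k u \<otimes> (xi k v \<otimes> q (y k) \<oplus> b (lsum (\<lambda>i. xi i v) y k) (y k))"

lemma lsum_linear:
  assumes xi: "\<And>i v. \<lbrakk>i < k; v \<in> carrier V\<rbrakk> \<Longrightarrow> xi i v \<in> carrier F"
      "\<And>i u v. \<lbrakk>i < k; u \<in> carrier V; v \<in> carrier V\<rbrakk> \<Longrightarrow> xi i (u \<oplus>\<^bsub>V\<^esub> v) = xi i u \<oplus> xi i v"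
      "\<And>i c v. \<lbrakk>i < k; c \<in> carrier F; v \<in> carrier V\<rbrakk> \<Longrightarrow> xi i (c \<odot>\<^bsub>V\<^esub> v) = c \<otimes> xi i v"
    and y: "\<And>i. i < k \<Longrightarrow> y i \<in> carrier V"
    and uv: "u \<in> carrier V" "v \<in> carrier V" "c \<in> carrier F"
  shows "lsum (\<lambda>i. xi i (u \<oplus>\<^bsub>V\<^esub> v)) y k = lsum (\<lambda>i. xi i u) y k \<oplus>\<^bsub>V\<^esub> lsum (\<lambda>i. xi i v) y k" (is "?A k")
    and "lsum (\<lambda>i. xi i (c \<odot>\<^bsub>V\<^esub> u)) y k = c \<odot>\<^bsub>V\<^esub> lsum (\<lambda>i. xi i u) y k" (is "?B k")
proof -
  have "?A k \<and> ?B k"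
    using xi y
  proof (induction k)
    case (Suc k)
    have cl: "lsum (\<lambda>i. xi i u) y k \<in> carrier V" "lsum (\<lambda>i. xi i v) y k \<in> carrier V"
      using uv Suc.prems by (auto intro!: lsum_closed)
    have "?A k \<and> ?B k" using Suc.prems by (intro Suc.IH) auto
    then show ?case using Suc.prems uv cl
      by (simp add: V.smult_l_distr V.smult_r_distr V.smult_assoc1 V.a_ac)
  qed (use uv in simp_all)
  then show "?A k" "?B k" by blast+
qed

lemma tri_bilinear:
  assumes xi: "\<And>i v. \<lbrakk>i < k; v \<in> carrier V\<rbrakk> \<Longrightarrow> xi i v \<in> carrier F"
      "\<And>i u v. \<lbrakk>i < k; u \<in> carrier V; v \<in> carrier V\<rbrakk> \<Longrightarrow> xi i (u \<oplus>\<^bsub>V\<^esub> v) = xi i u \<oplus> xi i v"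
      "\<And>i c v. \<lbrakk>i < k; c \<in> carrier F; v \<in> carrier V\<rbrakk> \<Longrightarrow> xi i (c \<odot>\<^bsub>V\<^esub> v) = c \<otimes> xi i v"
    and y: "\<And>i. i < k \<Longrightarrow> y i \<in> carrier V"
  shows "bilinear_form F V (tri xi y k)" (is "?A k")
    and "\<And>v. v \<in> carrier V \<Longrightarrow> tri xi y k v v = q (lsum (\<lambda>i. xi i v) y k)"
proof -
  have "?A k \<and> (\<forall>v\<in>carrier V. tri xi y k v v = q (lsum (\<lambda>i. xi i v) y k))"
    using xi y
  proof (induction k)
    case 0
    show ?case by (simp add: bilinear_form_def q_zero)
  next
    case (Suc k)
    let ?t = "tri xi y k" and ?L = "\<lambda>v. lsum (\<lambda>i. xi i v) y k"
    have Lc: "?L v \<in> carrier V" if "v \<in> carrier V" for v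
      using that Suc.prems by (intro lsum_closed) auto
    have IH: "bilinear_form F V ?t \<and> (\<forall>v\<in>carrier V. ?t v v = q (?L v))"
      using Suc.prems by (intro Suc.IH) auto
    then have t: "bilinear_form F V ?t" by blast
    then have tc: "\<lbrakk>u \<in> carrier V; v \<in> carrier V\<rbrakk> \<Longrightarrow> ?t u v \<in> carrier F" for u v by (auto simp: bilinear_form_def)
    \<comment> \<open>The new summand becomes a product of two linear functionals,
      \<open>xi k u\<close> and \<open>ell v\<close>, hence bilinear. On the diagonal it is exactly
      what q gains when \<open>xi k v\<close> times \<open>y k\<close> is added to the partial
      sum.\<close>
    define ell where "ell v = xi k v \<otimes> q (y k) \<oplus> b (?L v) (y k)" for v
    have yk: "y k \<in> carrier V" using Suc.prems by simp
    have xk: "\<And>v. v \<in> carrier V \<Longrightarrow> xi k v \<in> carrier F"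
      "\<And>u v. \<lbrakk>u \<in> carrier V; v \<in> carrier V\<rbrakk> \<Longrightarrow> xi k (u \<oplus>\<^bsub>V\<^esub> v) = xi k u \<oplus> xi k v"
      "\<And>c v. \<lbrakk>c \<in> carrier F; v \<in> carrier V\<rbrakk> \<Longrightarrow> xi k (c \<odot>\<^bsub>V\<^esub> v) = c \<otimes> xi k v"
      using Suc.prems by auto
    have L: "?L (u \<oplus>\<^bsub>V\<^esub> v) = ?L u \<oplus>\<^bsub>V\<^esub> ?L v" "?L (c \<odot>\<^bsub>V\<^esub> u) = c \<odot>\<^bsub>V\<^esub> ?L u"
      if "u \<in> carrier V" "v \<in> carrier V" "c \<in> carrier F" for u v c
      by (rule lsum_linear; use Suc.prems that in simp)+
    then have L1: "?L (u \<oplus>\<^bsub>V\<^esub> v) = ?L u \<oplus>\<^bsub>V\<^esub> ?L v" if "u \<in> carrier V" "v \<in> carrier V" for u v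
      using that by blast
    have ell: "\<And>v. v \<in> carrier V \<Longrightarrow> ell v \<in> carrier F"
      "\<And>u v. \<lbrakk>u \<in> carrier V; v \<in> carrier V\<rbrakk> \<Longrightarrow> ell (u \<oplus>\<^bsub>V\<^esub> v) = ell u \<oplus> ell v"
      "\<And>c v. \<lbrakk>c \<in> carrier F; v \<in> carrier V\<rbrakk> \<Longrightarrow> ell (c \<odot>\<^bsub>V\<^esub> v) = c \<otimes> ell v"
      unfolding ell_def using yk xk Lc L1 L(2)
      by (simp_all add: b_add b_smult F.l_distr F.r_distr F.a_ac F.m_assoc)
    have eq: "tri xi y (Suc k) u v = ?t u v \<oplus> xi k u \<otimes> ell v" for u v by (simp add: ell_def)
    have "bilinear_form F V (tri xi y (Suc k))"
      using t xk ell unfolding bilinear_form_def eq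
      by (simp add: F.l_distr F.r_distr F.a_ac F.m_ac)
    moreover have "tri xi y (Suc k) v v = q (lsum (\<lambda>i. xi i v) y (Suc k))" if v: "v \<in> carrier V" for v
      using IH v Lc yk xk(1)
      by (simp add: q_add q_smult b_smult F.r_distr F.m_assoc F.a_assoc)
    ultimately show ?case by blast
  qed
  then show "?A k" and "\<And>v. v \<in> carrier V \<Longrightarrow> tri xi y k v v = q (lsum (\<lambda>i. xi i v) y k)" by blast+
qed

end

section \<open>The residual space and the Wall form\<close>

locale quad_involution = quadratic_char2 F V q
  for F :: "('f, 'm) ring_scheme" (structure) and V :: "('f, 'v) module" and q :: "'v \<Rightarrow> 'f" +
  fixes \<tau> :: "'v \<Rightarrow> 'v"
  assumes fin_dim: "V.fin_dim"
    and nondegenerate: "\<And>u. \<lbrakk>u \<in> carrier V; \<And>v. v \<in> carrier V \<Longrightarrow> b u v = \<zero>\<rbrakk> \<Longrightarrow> u = \<zero>\<^bsub>V\<^esub>"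
    and isometry: "\<tau> \<in> orthogonal_group F V q"
    and involution: "\<And>v. v \<in> carrier V \<Longrightarrow> \<tau> (\<tau> v) = v"
    and Res_Fix: "Res V \<tau> = Fix V \<tau>"
begin

abbreviation "R \<equiv> Res V \<tau>"

lemma tau_closed [simp]: "v \<in> carrier V \<Longrightarrow> \<tau> v \<in> carrier V"
  and tau_add: "\<lbrakk>u \<in> carrier V; v \<in> carrier V\<rbrakk> \<Longrightarrow> \<tau> (u \<oplus>\<^bsub>V\<^esub> v) = \<tau> u \<oplus>\<^bsub>V\<^esub> \<tau> v"
  and tau_smult: "\<lbrakk>c \<in> carrier F; v \<in> carrier V\<rbrakk> \<Longrightarrow> \<tau> (c \<odot>\<^bsub>V\<^esub> v) = c \<odot>\<^bsub>V\<^esub> \<tau> v"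
  and q_tau: "v \<in> carrier V \<Longrightarrow> q (\<tau> v) = q v"
  using isometry by (auto simp: orthogonal_group_def module_hom_def)

lemma b_tau_tau: "\<lbrakk>u \<in> carrier V; v \<in> carrier V\<rbrakk> \<Longrightarrow> b (\<tau> u) (\<tau> v) = b u v"
  by (simp add: polar_def tau_add[symmetric] q_tau)

lemma b_tau: "\<lbrakk>u \<in> carrier V; v \<in> carrier V\<rbrakk> \<Longrightarrow> b (\<tau> u) v = b u (\<tau> v)"
  using b_tau_tau[of u "\<tau> v"] by (simp add: involution)

lemma R_closed: "r \<in> R \<Longrightarrow> r \<in> carrier V" and R_fixed: "r \<in> R \<Longrightarrow> \<tau> r = r"
  by (auto simp: Res_Fix Fix_def)

lemma R_I: "\<lbrakk>v \<in> carrier V; \<tau> v \<oplus>\<^bsub>V\<^esub> v = \<zero>\<^bsub>V\<^esub>\<rbrakk> \<Longrightarrow> v \<in> R"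
  by (auto simp: Res_Fix Fix_def V2_eq)

lemma R_tau: "v \<in> carrier V \<Longrightarrow> \<tau> v \<oplus>\<^bsub>V\<^esub> v \<in> R"
  unfolding Res_def by force

lemma R_E: "r \<in> R \<Longrightarrow> \<exists>x\<in>carrier V. r = \<tau> x \<oplus>\<^bsub>V\<^esub> x"
  unfolding Res_def by force

lemma R_submodule: "submodule F R V"
  unfolding submodule_def using V.module_axioms
  by (auto simp: Res_Fix Fix_def tau_add tau_smult)
    (metis V.add.r_cancel_one' V.zero_closed tau_add tau_closed V.r_zero)

text \<open>With s = \<open>\<tau>\<close> x + x and r fixed, the terms b r (\<open>\<tau>\<close>
  x) and b r x agree and cancel. One argument is used as a fixed vector, the other as a residual
  one.\<close>

lemma R_isotropic:
  assumes "r \<in> R" "s \<in> R"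
  shows "b r s = \<zero>"
proof -
  obtain x where x: "x \<in> carrier V" "s = \<tau> x \<oplus>\<^bsub>V\<^esub> x" using R_E assms by blast
  then show ?thesis
    using R_closed[OF assms(1)] R_fixed[OF assms(1)] b_tau[of r x]
    by (simp add: b_add)
qed

text \<open>An isometry of order two is self-adjoint, hence so is \<open>\<tau>\<close> - 1.\<close>

lemma b_rho: "\<lbrakk>x \<in> carrier V; v \<in> carrier V\<rbrakk> \<Longrightarrow> b x (\<tau> v \<oplus>\<^bsub>V\<^esub> v) = b (\<tau> x \<oplus>\<^bsub>V\<^esub> x) v"
  by (simp add: b_add b_tau)

text \<open>Two preimages of v under \<open>\<tau>\<close> - 1 differ by a fixed vector, which lies
  in R and is therefore orthogonal to v. So the description defining the Wall form has one solution
  only.\<close>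

lemma wall_form_q:
  assumes "v \<in> R"
  shows "wall_form F V q \<tau> v v = q v"
proof -
  obtain x where x: "x \<in> carrier V" "v = \<tau> x \<oplus>\<^bsub>V\<^esub> x" using R_E assms by blast
  have qv: "q v = b v x"
    using x by (simp add: q_add q_tau b_add b_self)
  have uniq: "c = q v" if y: "y \<in> carrier V" "v = \<tau> y \<oplus>\<^bsub>V\<^esub> y" "c = b v y" for c y
  proof -
    have "\<tau> (x \<oplus>\<^bsub>V\<^esub> y) \<oplus>\<^bsub>V\<^esub> (x \<oplus>\<^bsub>V\<^esub> y) = (\<tau> x \<oplus>\<^bsub>V\<^esub> x) \<oplus>\<^bsub>V\<^esub> (\<tau> y \<oplus>\<^bsub>V\<^esub> y)"
      using x(1) y(1) by (simp add: tau_add V.a_ac)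
    also have "\<dots> = \<zero>\<^bsub>V\<^esub>" using x y R_closed[OF assms] by simp
    finally have "x \<oplus>\<^bsub>V\<^esub> y \<in> R" using x y by (intro R_I) auto
    then have "b v (x \<oplus>\<^bsub>V\<^esub> y) = \<zero>" using R_isotropic assms by blast
    then show ?thesis using x(1) y(1,3) qv R_closed[OF assms] by (simp add: b_add F2_eq)
  qed
  show ?thesis
    unfolding wall_form_def
  proof (rule the_equality)
    have "v = \<tau> x \<ominus>\<^bsub>V\<^esub> x" "q v = b (\<tau> x \<ominus>\<^bsub>V\<^esub> x) x" using x qv by simp_all
    then show "\<exists>x\<in>carrier V. \<exists>y\<in>carrier V. v = \<tau> x \<ominus>\<^bsub>V\<^esub> x \<and> v = \<tau> y \<ominus>\<^bsub>V\<^esub> y \<and> q v = b (\<tau> x \<ominus>\<^bsub>V\<^esub> x) y"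
      using x(1) by blast
    fix c
    assume "\<exists>x\<in>carrier V. \<exists>y\<in>carrier V. v = \<tau> x \<ominus>\<^bsub>V\<^esub> x \<and> v = \<tau> y \<ominus>\<^bsub>V\<^esub> y \<and> c = b (\<tau> x \<ominus>\<^bsub>V\<^esub> x) y"
    then obtain x' y where *: "v = \<tau> x' \<ominus>\<^bsub>V\<^esub> x'" "y \<in> carrier V" "v = \<tau> y \<ominus>\<^bsub>V\<^esub> y" "c = b (\<tau> x' \<ominus>\<^bsub>V\<^esub> x') y"
      by blast
    have "v = \<tau> y \<oplus>\<^bsub>V\<^esub> y" using *(2,3) by simp
    moreover have "c = b v y" using *(4) unfolding *(1)[symmetric] .
    ultimately show "c = q v" using uniq *(2) by blast
  qed
qed

text \<open>The last clause says that the f distinguish vectors of R at least as well as S does. It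
  is the invariant that turns into separation of R once S spans V.\<close>

definition dual_to :: "'v set \<Rightarrow> nat \<Rightarrow> (nat \<Rightarrow> 'v) \<Rightarrow> (nat \<Rightarrow> 'v) \<Rightarrow> bool" where
  "dual_to S n f fs \<longleftrightarrow> (\<forall>i<n. f i \<in> carrier V \<and> fs i \<in> R)
      \<and> (\<forall>i<n. \<forall>j<n. b (fs i) (f j) = (if i = j then \<one> else \<zero>))
      \<and> (\<forall>r\<in>R. (\<forall>j<n. b r (f j) = \<zero>) \<longrightarrow> (\<forall>v\<in>S. b r v = \<zero>))"

lemma dual_family: "set vs \<subseteq> carrier V \<Longrightarrow> \<exists>n f fs. dual_to (set vs) n f fs"
proof (induction vs)
  case Nil
  show ?case by (intro exI[of _ "0 :: nat"] exI) (simp add: dual_to_def)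
next
  case (Cons v vs)
  then obtain n f fs where H: "dual_to (set vs) n f fs" by auto
  have cl: "\<And>i. i < n \<Longrightarrow> f i \<in> carrier V" "\<And>i. i < n \<Longrightarrow> fs i \<in> R"
    and dual: "\<And>i j. \<lbrakk>i < n; j < n\<rbrakk> \<Longrightarrow> b (fs i) (f j) = (if i = j then \<one> else \<zero>)"
    and kills: "\<And>r w. \<lbrakk>r \<in> R; \<And>j. j < n \<Longrightarrow> b r (f j) = \<zero>; w \<in> set vs\<rbrakk> \<Longrightarrow> b r w = \<zero>"
    using H unfolding dual_to_def by blast+
  have v: "v \<in> carrier V" using Cons.prems by simp
  show ?case
  proof (cases "\<forall>r\<in>R. (\<forall>j<n. b r (f j) = \<zero>) \<longrightarrow> b r v = \<zero>")
    case True
    then have "dual_to (set (v # vs)) n f fs" using H unfolding dual_to_def by simp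
    then show ?thesis by blast
  next
    case False
    then obtain r0 where r0: "r0 \<in> R" "\<And>j. j < n \<Longrightarrow> b r0 (f j) = \<zero>" "b r0 v \<noteq> \<zero>" by auto
    have r0c: "r0 \<in> carrier V" using R_closed r0 by auto
    then have u: "b r0 v \<in> Units F" using r0(3) v by (simp add: F.field_Units)
    \<comment> \<open>Gram-Schmidt step: the vector r0 of R that detects v beyond the old f is
      normalised, and v is corrected by s so that the old \<open>fs\<close> no longer see
      it.\<close>
    define r where "r = inv (b r0 v) \<odot>\<^bsub>V\<^esub> r0"
    have r: "r \<in> R" unfolding r_def using u r0 by (intro submodule.smult_closed[OF R_submodule]) auto
    have rv: "b r v = \<one>" "\<And>j. j < n \<Longrightarrow> b r (f j) = \<zero>"
      unfolding r_def using u r0c v r0(2) cl by (simp_all add: b_smult)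
    define s where "s = lsum (\<lambda>j. b (fs j) v) f n"
    have fsc: "\<And>i. i < n \<Longrightarrow> fs i \<in> carrier V" using cl R_closed by auto
    have sc: "s \<in> carrier V" unfolding s_def using cl fsc v by (intro lsum_closed) auto
    have bs: "b (fs i) s = b (fs i) v" if "i < n" for i
      unfolding s_def using that cl fsc v dual by (subst b_lsum_dual[of n _ f "fs i" i]) auto
    have br: "b x s = \<zero>" if "x \<in> carrier V" "\<And>j. j < n \<Longrightarrow> b x (f j) = \<zero>" for x
      unfolding s_def using that cl fsc v by (intro b_lsum_zero) auto
    let ?f = "f(n := v \<oplus>\<^bsub>V\<^esub> s)" and ?fs = "fs(n := r)"
    have rc: "r \<in> carrier V" using r R_closed by auto
    have d: "b (?fs i) (?f j) = (if i = j then \<one> else \<zero>)" if "i < Suc n" "j < Suc n" for i j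
      using that dual bs br[OF rc rv(2)] rv rc v sc fsc by (auto simp: b_add less_Suc_eq)
    have k: "b x w = \<zero>" if x: "x \<in> R" "\<And>j. j < Suc n \<Longrightarrow> b x (?f j) = \<zero>" and w: "w \<in> set (v # vs)" for x w
    proof -
      have xf: "b x (f j) = \<zero>" if "j < n" for j using x(2)[of j] that by auto
      have xc: "x \<in> carrier V" using x R_closed by auto
      have "b x (v \<oplus>\<^bsub>V\<^esub> s) = \<zero>" using x(2)[of n] by simp
      then have "b x v = \<zero>" using br[OF xc xf] xc v sc by (simp add: b_add)
      then show ?thesis using kills[OF x(1) xf] w by auto
    qed
    have "?f i \<in> carrier V \<and> ?fs i \<in> R" if "i < Suc n" for i
      using that r v sc cl by (auto simp: less_Suc_eq)
    then have "dual_to (set (v # vs)) (Suc n) ?f ?fs"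
      unfolding dual_to_def using d k by blast
    then show ?thesis by blast
  qed
qed

end

text \<open>The vectors \<open>rho i = \<tau> (f i) - f i\<close> span the residual space, and \<open>rs, fs\<close> is the basis
  dual to \<open>rho, f\<close>.\<close>
locale quad_involution_basis = quad_involution F V q \<tau>
  for F :: "('f, 'm) ring_scheme" (structure) and V :: "('f, 'v) module" and q :: "'v \<Rightarrow> 'f" and \<tau> :: "'v \<Rightarrow> 'v" +
  fixes n :: nat and f fs :: "nat \<Rightarrow> 'v"
  assumes f_closed: "\<And>i. i < n \<Longrightarrow> f i \<in> carrier V"
    and fs_R: "\<And>i. i < n \<Longrightarrow> fs i \<in> R"
    and fs_f: "\<And>i j. \<lbrakk>i < n; j < n\<rbrakk> \<Longrightarrow> b (fs i) (f j) = (if i = j then \<one> else \<zero>)"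
    and R_separated: "\<And>r. \<lbrakk>r \<in> R; \<And>j. j < n \<Longrightarrow> b r (f j) = \<zero>\<rbrakk> \<Longrightarrow> r = \<zero>\<^bsub>V\<^esub>"

text \<open>Applied to a spanning list of V: a vector of R orthogonal to all f is then orthogonal to
  V and vanishes by nondegeneracy.\<close>

lemma (in quad_involution) exists_basis: "\<exists>n f fs. quad_involution_basis F V q \<tau> n f fs"
proof -
  obtain B where B: "finite B" "B \<subseteq> carrier V" "V.span B = carrier V"
    using fin_dim unfolding V.fin_dim_def by auto
  obtain vs where vs: "set vs = B" using B(1) finite_list by blast
  obtain n f fs where H: "dual_to (set vs) n f fs" using dual_family[of vs] vs B by blast
  note * = H[unfolded dual_to_def, THEN conjunct1] H[unfolded dual_to_def, THEN conjunct2, THEN conjunct1]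
    H[unfolded dual_to_def, THEN conjunct2, THEN conjunct2]
  have "r = \<zero>\<^bsub>V\<^esub>" if r: "r \<in> R" "\<And>j. j < n \<Longrightarrow> b r (f j) = \<zero>" for r
  proof (rule nondegenerate)
    show rc: "r \<in> carrier V" using r R_closed by auto
    have "submodule F {v \<in> carrier V. b r v = \<zero>} V"
      unfolding submodule_def using rc V.module_axioms by (auto simp: b_add b_smult)
    then have "V.span B \<subseteq> {v \<in> carrier V. b r v = \<zero>}"
      using *(3) r vs B by (intro V.span_is_subset) auto
    then show "b r v = \<zero>" if "v \<in> carrier V" for v using B that by auto
  qed
  then have "quad_involution_basis F V q \<tau> n f fs"
    using * by unfold_locales blast+
  then show ?thesis by blast
qed

context quad_involution_basis
begin

lemma fs_closed: "i < n \<Longrightarrow> fs i \<in> carrier V"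
  using fs_R R_closed by auto

definition rho :: "nat \<Rightarrow> 'v" where "rho i = \<tau> (f i) \<oplus>\<^bsub>V\<^esub> f i"

definition fs_pre :: "nat \<Rightarrow> 'v" where "fs_pre i = (SOME v. v \<in> carrier V \<and> fs i = \<tau> v \<oplus>\<^bsub>V\<^esub> v)"

text \<open>A preimage of \<open>fs i\<close> under \<open>\<tau>\<close> - 1. Adding a vector of R
  does not change its image and is used to make it orthogonal to every f.\<close>

definition rs :: "nat \<Rightarrow> 'v" where "rs i = fs_pre i \<oplus>\<^bsub>V\<^esub> lsum (\<lambda>j. b (fs_pre i) (f j)) fs n"

lemma fs_pre: "i < n \<Longrightarrow> fs_pre i \<in> carrier V" "i < n \<Longrightarrow> fs i = \<tau> (fs_pre i) \<oplus>\<^bsub>V\<^esub> fs_pre i"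
  using someI_ex[of "\<lambda>v. v \<in> carrier V \<and> fs i = \<tau> v \<oplus>\<^bsub>V\<^esub> v"] R_E[OF fs_R[of i]] unfolding fs_pre_def by auto

lemma rho_R: "i < n \<Longrightarrow> rho i \<in> R"
  unfolding rho_def by (intro R_tau f_closed)

lemma rho_closed: "i < n \<Longrightarrow> rho i \<in> carrier V"
  using rho_R R_closed by auto

lemma lsum_fs_R: "i < n \<Longrightarrow> lsum (\<lambda>j. b (fs_pre i) (f j)) fs n \<in> R"
  using fs_pre f_closed fs_R by (intro lsum_submodule[OF R_submodule]) auto

lemma rs_closed: "i < n \<Longrightarrow> rs i \<in> carrier V"
  unfolding rs_def using fs_pre lsum_fs_R R_closed by auto

lemma b_rho_right: "\<lbrakk>v \<in> carrier V; j < n\<rbrakk> \<Longrightarrow> b v (rho j) = b (\<tau> v \<oplus>\<^bsub>V\<^esub> v) (f j)"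
  unfolding rho_def by (intro b_rho f_closed)

lemma tau_rs: "i < n \<Longrightarrow> \<tau> (rs i) = rs i \<oplus>\<^bsub>V\<^esub> fs i"
proof -
  assume i: "i < n"
  let ?s = "lsum (\<lambda>j. b (fs_pre i) (f j)) fs n"
  have s: "?s \<in> carrier V" "\<tau> ?s = ?s" using lsum_fs_R[OF i] R_closed R_fixed by auto
  have "rs i \<oplus>\<^bsub>V\<^esub> fs i = fs_pre i \<oplus>\<^bsub>V\<^esub> ?s \<oplus>\<^bsub>V\<^esub> (fs_pre i \<oplus>\<^bsub>V\<^esub> \<tau> (fs_pre i))"
    using fs_pre(1)[OF i] by (simp add: rs_def fs_pre(2)[OF i] V.a_comm)
  also have "\<dots> = \<tau> (fs_pre i) \<oplus>\<^bsub>V\<^esub> ?s"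
    using fs_pre(1)[OF i] s by (simp add: V.a_ac)
  finally show ?thesis using fs_pre(1)[OF i] s by (simp add: rs_def tau_add)
qed

lemma tau_fs: "i < n \<Longrightarrow> \<tau> (fs i) = fs i" and tau_rho: "i < n \<Longrightarrow> \<tau> (rho i) = rho i"
  using fs_R rho_R R_fixed by auto

lemma tau_f: "i < n \<Longrightarrow> \<tau> (f i) = f i \<oplus>\<^bsub>V\<^esub> rho i"
  using f_closed by (simp add: rho_def V.a_ac)

lemma rs_f: "\<lbrakk>i < n; j < n\<rbrakk> \<Longrightarrow> b (rs i) (f j) = \<zero>"
proof -
  assume ij: "i < n" "j < n"
  have s: "lsum (\<lambda>j. b (fs_pre i) (f j)) fs n \<in> carrier V" using lsum_fs_R[OF ij(1)] R_closed by auto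
  have "b (f j) (lsum (\<lambda>j. b (fs_pre i) (f j)) fs n) = b (fs_pre i) (f j)"
    using ij fs_pre f_closed fs_closed fs_f by (intro b_lsum_dual) (auto simp: b_sym[of "f j"])
  then show ?thesis using ij fs_pre f_closed s by (simp add: rs_def b_add b_sym[of "lsum _ _ _"])
qed

lemma rs_rho: "\<lbrakk>i < n; j < n\<rbrakk> \<Longrightarrow> b (rs i) (rho j) = (if i = j then \<one> else \<zero>)"
  using rs_closed fs_closed by (simp add: b_rho_right tau_rs V.a_ac fs_f)

lemma fs_rho: "\<lbrakk>i < n; j < n\<rbrakk> \<Longrightarrow> b (fs i) (rho j) = \<zero>"
  using fs_R rho_R by (intro R_isotropic)

text \<open>The order matters: the first n vectors lie in R and generate the standard
  representative, and the last n dual vectors in \<open>ys\<close> are the \<open>fs\<close>, which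
  lie in R as well.\<close>

definition y :: "nat \<Rightarrow> 'v" where "y i = (if i < n then rho i else f (i - n))"

definition ys :: "nat \<Rightarrow> 'v" where "ys i = (if i < n then rs i else fs (i - n))"

lemma y_closed: "i < n + n \<Longrightarrow> y i \<in> carrier V" and ys_closed: "i < n + n \<Longrightarrow> ys i \<in> carrier V"
  by (auto simp: y_def ys_def rho_closed rs_closed f_closed fs_closed)

lemma ys_y: "\<lbrakk>i < n + n; j < n + n\<rbrakk> \<Longrightarrow> b (ys i) (y j) = (if i = j then \<one> else \<zero>)"
  by (auto simp: y_def ys_def rs_f rs_rho fs_f fs_rho)

lemma y_ys: "\<lbrakk>i < n + n; j < n + n\<rbrakk> \<Longrightarrow> b (y j) (ys i) = (if i = j then \<one> else \<zero>)"
  using ys_y[of i j] b_sym[OF y_closed ys_closed] by auto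

text \<open>By self-adjointness, orthogonality to the rho means that \<open>\<tau>\<close> d + d is
  orthogonal to the f, hence zero. So d is fixed, lies in R, and the f separate it from
  zero.\<close>

lemma y_separated:
  assumes d: "d \<in> carrier V" and 0: "\<And>j. j < n + n \<Longrightarrow> b d (y j) = \<zero>"
  shows "d = \<zero>\<^bsub>V\<^esub>"
proof -
  have "b (\<tau> d \<oplus>\<^bsub>V\<^esub> d) (f j) = \<zero>" if "j < n" for j
    using 0[of j] that d by (simp add: y_def b_rho_right)
  then have "\<tau> d \<oplus>\<^bsub>V\<^esub> d = \<zero>\<^bsub>V\<^esub>" using R_separated R_tau d by blast
  then have "d \<in> R" using R_I d by blast
  moreover have "b d (f j) = \<zero>" if "j < n" for j
    using 0[of "n + j"] that by (simp add: y_def)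
  ultimately show ?thesis using R_separated by blast
qed

lemma expand_ys:
  assumes v: "v \<in> carrier V"
  shows "v = lsum (\<lambda>j. b (y j) v) ys (n + n)"
proof -
  let ?s = "lsum (\<lambda>j. b (y j) v) ys (n + n)"
  have s: "?s \<in> carrier V" using v y_closed ys_closed by (intro lsum_closed) auto
  have "b (v \<oplus>\<^bsub>V\<^esub> ?s) (y j) = \<zero>" if j: "j < n + n" for j
  proof -
    have "b (y j) ?s = b (y j) v"
      using v j y_closed ys_closed y_ys by (intro b_lsum_dual) auto
    moreover have "b (v \<oplus>\<^bsub>V\<^esub> ?s) (y j) = b (y j) (v \<oplus>\<^bsub>V\<^esub> ?s)"
      using v s y_closed[OF j] by (intro b_sym) auto
    ultimately show ?thesis using v s y_closed[OF j] by (simp add: b_add)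
  qed
  then have "v \<oplus>\<^bsub>V\<^esub> ?s = \<zero>\<^bsub>V\<^esub>" using v s by (intro y_separated) auto
  then show ?thesis using v s by (simp add: V2_eq)
qed

text \<open>The difference is orthogonal to all \<open>ys\<close>. These span V by
  \<open>expand_ys\<close>, so nondegeneracy finishes.\<close>

lemma expand_y:
  assumes v: "v \<in> carrier V"
  shows "v = lsum (\<lambda>j. b (ys j) v) y (n + n)"
proof -
  let ?s = "lsum (\<lambda>j. b (ys j) v) y (n + n)"
  have s: "?s \<in> carrier V" using v y_closed ys_closed by (intro lsum_closed) auto
  have 0: "b (v \<oplus>\<^bsub>V\<^esub> ?s) (ys j) = \<zero>" if j: "j < n + n" for j
  proof -
    have "b (ys j) ?s = b (ys j) v"
      using v j y_closed ys_closed ys_y by (intro b_lsum_dual) auto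
    moreover have "b (v \<oplus>\<^bsub>V\<^esub> ?s) (ys j) = b (ys j) (v \<oplus>\<^bsub>V\<^esub> ?s)"
      using v s ys_closed[OF j] by (intro b_sym) auto
    ultimately show ?thesis using v s ys_closed[OF j] by (simp add: b_add)
  qed
  have "v \<oplus>\<^bsub>V\<^esub> ?s = \<zero>\<^bsub>V\<^esub>"
  proof (rule nondegenerate)
    show "v \<oplus>\<^bsub>V\<^esub> ?s \<in> carrier V" using v s by auto
    fix w assume w: "w \<in> carrier V"
    have "b (v \<oplus>\<^bsub>V\<^esub> ?s) (lsum (\<lambda>j. b (y j) w) ys (n + n)) = \<zero>"
      using v s w y_closed ys_closed 0 by (intro b_lsum_zero) auto
    then show "b (v \<oplus>\<^bsub>V\<^esub> ?s) w = \<zero>" using expand_ys[OF w] by simp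
  qed
  then show ?thesis using v s by (simp add: V2_eq)
qed

text \<open>The coefficient of r along \<open>f i\<close> is b (fs i) r, which vanishes because R is
  isotropic.\<close>

lemma expand_rho:
  assumes r: "r \<in> R"
  shows "r = lsum (\<lambda>i. b (rs i) r) rho n"
proof -
  have rc: "r \<in> carrier V" using r R_closed by auto
  have "r = lsum (\<lambda>j. b (ys j) r) y n \<oplus>\<^bsub>V\<^esub> lsum (\<lambda>i. b (ys (n + i)) r) (\<lambda>i. y (n + i)) n"
    using expand_y[OF rc] lsum_append[of n n "\<lambda>j. b (ys j) r" y] rc y_closed ys_closed by simp
  moreover have "lsum (\<lambda>i. b (ys (n + i)) r) (\<lambda>i. y (n + i)) n = \<zero>\<^bsub>V\<^esub>"
    using y_closed fs_R r by (intro lsum_zero) (auto simp: ys_def R_isotropic)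
  moreover have "lsum (\<lambda>j. b (ys j) r) y n = lsum (\<lambda>i. b (rs i) r) rho n"
    by (intro lsum_cong) (auto simp: y_def ys_def)
  moreover have "lsum (\<lambda>i. b (rs i) r) rho n \<in> carrier V"
    using rc rs_closed rho_closed by (intro lsum_closed) auto
  ultimately show ?thesis by simp
qed

text \<open>In characteristic 2 the polar form is alternating and does not determine q, so a form
  with diagonal q, in general not symmetric, is built from coordinates instead.\<close>

lemma exists_bilinear_diag: "\<exists>\<beta>. bilinear_form F V \<beta> \<and> (\<forall>v\<in>carrier V. \<beta> v v = q v)"
proof -
  have "bilinear_form F V (tri (\<lambda>j. b (ys j)) y (n + n))"
    using y_closed ys_closed by (intro tri_bilinear) (auto simp: b_add b_smult)
  moreover have "tri (\<lambda>j. b (ys j)) y (n + n) v v = q v" if v: "v \<in> carrier V" for v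
    using y_closed ys_closed v expand_y[OF v] by (subst tri_bilinear(2)) (auto simp: b_add b_smult)
  ultimately show ?thesis by blast
qed

end

section \<open>The field of squares of a representative\<close>

context assoc_alg2
begin

definition sqs :: "'a set \<Rightarrow> 'a set" where "sqs S = {s \<otimes> s | s. s \<in> S}"

text \<open>For scalars B this is the ring generated by B over the squares of F. It is closed under
  inverses without a clause for them, as 1/k is k times the square of 1/k.\<close>

inductive_set sq_closure :: "'a set \<Rightarrow> 'a set" for B where
  scal: "c \<in> scal \<Longrightarrow> c \<otimes> c \<in> sq_closure B"
| base: "b \<in> B \<Longrightarrow> b \<in> sq_closure B"
| add: "\<lbrakk>a \<in> sq_closure B; b \<in> sq_closure B\<rbrakk> \<Longrightarrow> a \<oplus> b \<in> sq_closure B"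
| mult: "\<lbrakk>a \<in> sq_closure B; b \<in> sq_closure B\<rbrakk> \<Longrightarrow> a \<otimes> b \<in> sq_closure B"

lemma sq_closure_least: "B \<subseteq> sq_closure C \<Longrightarrow> sq_closure B \<subseteq> sq_closure C"
proof
  fix x assume B: "B \<subseteq> sq_closure C" and "x \<in> sq_closure B"
  from this(2) show "x \<in> sq_closure C"
    by induction (use B in \<open>auto intro: sq_closure.intros\<close>)
qed

lemma square_add:
  "\<lbrakk>a \<in> carrier A; b \<in> carrier A; a \<otimes> b = b \<otimes> a\<rbrakk> \<Longrightarrow> (a \<oplus> b) \<otimes> (a \<oplus> b) = a \<otimes> a \<oplus> b \<otimes> b"
  by (simp add: A.l_distr A.r_distr A.a_ac)

lemma square_mult:
  assumes "a \<in> carrier A" "b \<in> carrier A" "a \<otimes> b = b \<otimes> a"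
  shows "(a \<otimes> b) \<otimes> (a \<otimes> b) = (a \<otimes> a) \<otimes> (b \<otimes> b)"
proof -
  have "(a \<otimes> b) \<otimes> (a \<otimes> b) = a \<otimes> (b \<otimes> a) \<otimes> b" using assms(1,2) by (simp add: A.m_assoc)
  also have "\<dots> = a \<otimes> (a \<otimes> b) \<otimes> b" using assms(3) by simp
  finally show ?thesis using assms(1,2) by (simp add: A.m_assoc)
qed

end

locale sq_alg = assoc_alg2 F A
  for F :: "('f, 'm) ring_scheme" and A :: "('f, 'a) module" (structure) +
  fixes S :: "'a set"
  assumes S: "subalg F A S"
    and comm: "\<And>u v. \<lbrakk>u \<in> S; v \<in> S\<rbrakk> \<Longrightarrow> u \<otimes> v = v \<otimes> u"
    and sq: "\<And>u. u \<in> S \<Longrightarrow> u \<otimes> u \<in> scal"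
begin

lemmas SD = subalgD[OF S]

lemma gen_S: "X \<subseteq> S \<Longrightarrow> alg_generated F A X \<subseteq> S"
  using S by (rule alg_generated_minimal)

lemma gen_subalg: "X \<subseteq> S \<Longrightarrow> subalg F A (alg_generated F A X)"
  using SD(1) by (intro subalg_alg_generated) auto

lemma sqs_subalg_closed:
  assumes "subalg F A G" "G \<subseteq> S" "a \<in> sqs G" "b \<in> sqs G"
  shows "a \<oplus> b \<in> sqs G" "a \<otimes> b \<in> sqs G"
proof -
  obtain s t where st: "a = s \<otimes> s" "b = t \<otimes> t" "s \<in> G" "t \<in> G" using assms by (auto simp: sqs_def)
  have car: "s \<in> carrier A" "t \<in> carrier A" "s \<otimes> t = t \<otimes> s" using st assms(2) SD(7) by (auto intro: comm)
  have "a \<oplus> b = (s \<oplus> t) \<otimes> (s \<oplus> t)" "a \<otimes> b = (s \<otimes> t) \<otimes> (s \<otimes> t)"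
    unfolding st(1,2) by (simp_all only: square_add[OF car] square_mult[OF car])
  then show "a \<oplus> b \<in> sqs G" "a \<otimes> b \<in> sqs G"
    using st subalgD(4,5)[OF assms(1)] unfolding sqs_def by blast+
qed

text \<open>Frobenius: on S squaring respects sums and products, and a scalar factor comes out
  squared. So squares of polynomials in X are polynomials in the squares of X over the squares of
  F.\<close>

lemma sqs_generated:
  assumes X: "X \<subseteq> S"
  shows "sqs (alg_generated F A X) = sq_closure ((\<lambda>x. x \<otimes> x) ` X)"
proof
  let ?K = "sq_closure ((\<lambda>x. x \<otimes> x) ` X)"
  have "subalg F A {a \<in> S. a \<otimes> a \<in> ?K}"
  proof (rule subalgI)
    have "\<one> \<otimes> \<one> \<in> ?K" by (intro sq_closure.scal subalgD(3)[OF subalg_scal])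
    then show "\<one> \<in> {a \<in> S. a \<otimes> a \<in> ?K}" using SD by simp
    fix a b assume "a \<in> {a \<in> S. a \<otimes> a \<in> ?K}" "b \<in> {a \<in> S. a \<otimes> a \<in> ?K}"
    then have ab: "a \<in> S" "b \<in> S" "a \<otimes> a \<in> ?K" "b \<otimes> b \<in> ?K" by auto
    note car = SD(7)[OF ab(1)] SD(7)[OF ab(2)] comm[OF ab(1,2)]
    show "a \<oplus> b \<in> {a \<in> S. a \<otimes> a \<in> ?K}" "a \<otimes> b \<in> {a \<in> S. a \<otimes> a \<in> ?K}"
      using ab SD(4,5) unfolding mem_Collect_eq square_add[OF car] square_mult[OF car]
      by (blast intro: sq_closure.intros)+
  next
    fix c a assume c: "c \<in> carrier F" and "a \<in> {a \<in> S. a \<otimes> a \<in> ?K}"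
    then have a: "a \<in> S" "a \<in> carrier A" "a \<otimes> a \<in> ?K" using SD by auto
    have s: "c \<odot> \<one> \<in> scal" using c by (auto simp: scal_def)
    have "(c \<odot> a) \<otimes> (c \<odot> a) = ((c \<odot> \<one>) \<otimes> (c \<odot> \<one>)) \<otimes> (a \<otimes> a)"
      using c a by (simp add: smult_mult_l smult_mult_r)
    then show "c \<odot> a \<in> {a \<in> S. a \<otimes> a \<in> ?K}"
      using c a SD s by (auto intro: sq_closure.intros)
  qed (use SD in auto)
  then have "alg_generated F A X \<subseteq> {a \<in> S. a \<otimes> a \<in> ?K}"
    using X by (intro alg_generated_minimal) (auto intro: sq_closure.base)
  then show "sqs (alg_generated F A X) \<subseteq> ?K" by (auto simp: sqs_def)
  show "?K \<subseteq> sqs (alg_generated F A X)"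
  proof
    fix k assume "k \<in> ?K"
    then show "k \<in> sqs (alg_generated F A X)"
    proof induction
      case (scal c)
      then show ?case using scal_subset[OF gen_subalg[OF X]] by (auto simp: sqs_def)
    next
      case (base b)
      then show ?case using alg_generated_incl[of X] by (auto simp: sqs_def)
    qed (use sqs_subalg_closed[OF gen_subalg[OF X] gen_S[OF X]] in blast)+
  qed
qed

lemma gen_insert:
  assumes "X \<subseteq> S" "y \<in> S"
  shows "alg_generated F A (insert y X)
       = {u \<oplus> v \<otimes> y | u v. u \<in> alg_generated F A X \<and> v \<in> alg_generated F A X}"
proof (rule alg_generated_insert)
  fix x assume x: "x \<in> X"
  then have "ad y x = \<zero>" using assms comm SD(7) by (subst ad_eq_zero) auto
  then show "ad y x \<in> alg_generated F A X" using subalgD(2)[OF gen_subalg[OF assms(1)]] by simp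
qed (use assms SD sq in auto)

text \<open>A Steinitz exchange for \<open>2\<close>-bases: a generator can be traded for a square root \<open>x\<close> of \<open>a\<close> as
  soon as it occurs in \<open>x\<close> with an invertible coefficient.\<close>
lemma exchange_step:
  assumes Z: "Z \<subseteq> S" and Y: "finite Y" "Y \<subseteq> S" and gen: "alg_generated F A (Z \<union> Y) = S"
    and a: "a \<in> sqs S" "a \<notin> sqs (alg_generated F A Z)"
  shows "\<exists>x\<in>S. \<exists>y\<in>Y. x \<otimes> x = a \<and> alg_generated F A (insert x (Z \<union> (Y - {y}))) = S"
proof -
  define P where "P Y' \<longleftrightarrow> Y' \<subseteq> Y \<and> a \<in> sqs (alg_generated F A (Z \<union> Y'))" for Y'
  have "P Y" using a gen by (simp add: P_def)
  \<comment> \<open>A smallest set of generators from Y whose algebra, together with Z, contains a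
    square root of a. Minimality forces each of them to occur essentially.\<close>
  then obtain Y' where Y': "P Y'" and min: "\<And>Y''. P Y'' \<Longrightarrow> card Y' \<le> card Y''"
    using ex_has_least_nat[of P Y card] by blast
  have "Y' \<noteq> {}" using Y' a unfolding P_def by auto
  then obtain y where y: "y \<in> Y'" by blast
  have fin: "finite Y'" using Y' Y finite_subset unfolding P_def by blast
  let ?X = "Z \<union> (Y' - {y})" and ?Xn = "Z \<union> (Y - {y})"
  have XS: "?X \<subseteq> S" and yS: "y \<in> S" using Y' Y Z y unfolding P_def by auto
  have ins: "insert y ?X = Z \<union> Y'" using y by auto
  obtain x where x: "a = x \<otimes> x" "x \<in> alg_generated F A (insert y ?X)"
    using Y' unfolding P_def sqs_def ins by auto
  then obtain u v where uv: "x = u \<oplus> v \<otimes> y" "u \<in> alg_generated F A ?X" "v \<in> alg_generated F A ?X"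
    unfolding gen_insert[OF XS yS] by blast
  have S': "u \<in> S" "v \<in> S" using uv gen_S[OF XS] by auto
  have car: "u \<in> carrier A" "v \<in> carrier A" "y \<in> carrier A" using S' yS SD by auto
  have xS: "x \<in> S" using uv S' yS SD by auto
  \<comment> \<open>v may be a nonzero nilpotent, so its square has to be tested. If that vanished,
    u would be a square root of a without y, against minimality.\<close>
  have v2: "v \<otimes> v \<noteq> \<zero>"
  proof
    assume 0: "v \<otimes> v = \<zero>"
    have "(v \<otimes> y) \<otimes> (v \<otimes> y) = \<zero>"
      unfolding square_mult[OF car(2,3) comm[OF S'(2) yS]] using 0 car by simp
    then have "x \<otimes> x = u \<otimes> u"
      unfolding uv(1) using car square_add[OF car(1) _ comm[OF S'(1) SD(5)[OF S'(2) yS]]] by simp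
    then have "P (Y' - {y})" using x uv Y' unfolding P_def sqs_def by auto
    then have "card Y' \<le> card (Y' - {y})" by (rule min)
    then show False using card_Diff1_less[OF fin y] by linarith
  qed
  \<comment> \<open>A nonzero scalar square makes v invertible with inverse t v, and x = u + v y can
    be solved for y.\<close>
  then obtain t where t: "t \<in> scal" "v \<otimes> v \<otimes> t = \<one>" using scal_inverse sq S' by blast
  have tc: "t \<in> carrier A" using t scal_closed by auto
  let ?G = "alg_generated F A (insert x ?Xn)"
  have G: "subalg F A ?G" using xS Z Y by (intro gen_subalg) auto
  have XG: "?X \<subseteq> insert x ?Xn" using Y' unfolding P_def by auto
  have "u \<in> ?G" "v \<in> ?G" using uv alg_generated_mono[OF XG] by auto
  moreover have "x \<in> ?G" using alg_generated_incl[of "insert x ?Xn"] by auto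
  moreover have "t \<in> ?G" using t scal_subset[OF G] by auto
  moreover have "y = t \<otimes> (v \<otimes> (x \<oplus> u))"
  proof -
    have "x \<oplus> u = v \<otimes> y" using uv(1) car by (simp add: A.a_ac)
    then have "t \<otimes> (v \<otimes> (x \<oplus> u)) = (v \<otimes> v \<otimes> t) \<otimes> y"
      using car tc scal_commute[OF t(1), of "v \<otimes> v"] by (simp add: A.m_assoc[symmetric])
    then show ?thesis using t car by simp
  qed
  ultimately have "y \<in> ?G" using subalgD[OF G] by metis
  then have "Z \<union> Y \<subseteq> ?G" using alg_generated_incl[of "insert x ?Xn"] by auto
  then have "S \<subseteq> ?G" unfolding gen[symmetric] by (intro alg_generated_minimal G)
  moreover have "?G \<subseteq> S" using xS Z Y by (intro gen_S) auto
  ultimately show ?thesis using xS x y Y' unfolding P_def by blast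
qed

text \<open>Exchanging may stop early, since the a i can be dependent: it stops when every a j lies
  in the field generated by the squares already realised. Then every square of S has a root in the
  part already replaced, and adding suitable elements of that part gives the leftover generators the
  missing squares.\<close>

lemma exchange:
  fixes a :: "nat \<Rightarrow> 'a"
  assumes Y: "finite Y" "card Y = n" "Y \<subseteq> S" "alg_generated F A Y = S"
    and a: "sq_closure (a ` {..<n}) = sqs S"
  shows "\<exists>z. (\<forall>i<n. z i \<in> S \<and> z i \<otimes> z i = a i) \<and> alg_generated F A (z ` {..<n}) = S"
proof -
  define P where "P k \<longleftrightarrow> (\<exists>I z Y'. I \<subseteq> {..<n} \<and> card I = k \<and> finite Y' \<and> Y' \<subseteq> S \<and> k + card Y' \<le> n
      \<and> (\<forall>i\<in>I. z i \<in> S \<and> z i \<otimes> z i = a i) \<and> alg_generated F A (z ` I \<union> Y') = S)" for k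
  have "P 0" unfolding P_def using Y by (intro exI[of _ "{}"] exI[of _ "\<lambda>_. \<zero>"] exI[of _ Y]) auto
  moreover have bound: "k \<le> n" if "P k" for k using that unfolding P_def by auto
  ultimately obtain k where k: "P k" and max: "\<And>l. P l \<Longrightarrow> l \<le> k"
    using GreatestI_nat[of P 0 n] Greatest_le_nat[of P _ n] by blast
  obtain I z Y' where I: "I \<subseteq> {..<n}" "card I = k" and Y': "finite Y'" "Y' \<subseteq> S" "k + card Y' \<le> n"
    and z: "\<And>i. i \<in> I \<Longrightarrow> z i \<in> S" "\<And>i. i \<in> I \<Longrightarrow> z i \<otimes> z i = a i"
    and gen: "alg_generated F A (z ` I \<union> Y') = S"
    using k unfolding P_def by blast
  have finI: "finite I" using I finite_subset by blast
  have zI: "z ` I \<subseteq> S" using z by auto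
  have a_sqs: "a j \<in> sqs S" if "j < n" for j using that a sq_closure.base[of "a j" "a ` {..<n}"] by auto
  have sq_zI: "sqs (alg_generated F A (z ` I)) = sq_closure (a ` I)"
    unfolding sqs_generated[OF zI] image_image using z by (auto cong: image_cong)
  \<comment> \<open>Otherwise a root of a j could be exchanged for a member of Y', contradicting the
    maximality of I.\<close>
  have all: "a j \<in> sq_closure (a ` I)" if j: "j < n" for j
  proof (rule ccontr)
    assume n: "a j \<notin> sq_closure (a ` I)"
    then have jI: "j \<notin> I" by (auto intro: sq_closure.base)
    obtain x y where xy: "x \<in> S" "y \<in> Y'" "x \<otimes> x = a j"
      "alg_generated F A (insert x (z ` I \<union> (Y' - {y}))) = S"
      using exchange_step[OF zI Y'(1,2) gen a_sqs[OF j]] n sq_zI by blast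
    have im: "(z(j := x)) ` insert j I \<union> (Y' - {y}) = insert x (z ` I \<union> (Y' - {y}))"
      using jI by auto
    have "insert j I \<subseteq> {..<n}" using I(1) j by simp
    moreover have "card (insert j I) = Suc k" using I(2) finI jI by simp
    moreover have "finite (Y' - {y})" "Y' - {y} \<subseteq> S" using Y' by auto
    moreover have "Suc k + card (Y' - {y}) \<le> n" using Y'(3) card_Suc_Diff1[OF Y'(1) xy(2)] by linarith
    moreover have "\<forall>i\<in>insert j I. (z(j := x)) i \<in> S \<and> (z(j := x)) i \<otimes> (z(j := x)) i = a i"
      using z xy(1,3) by simp
    moreover have "alg_generated F A ((z(j := x)) ` insert j I \<union> (Y' - {y})) = S" unfolding im by (rule xy(4))
    ultimately have "P (Suc k)" unfolding P_def by blast
    then show False using max by fastforce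
  qed
  have eq: "sqs S = sqs (alg_generated F A (z ` I))"
  proof
    show "sqs S \<subseteq> sqs (alg_generated F A (z ` I))"
      unfolding sq_zI a[symmetric] using all by (intro sq_closure_least) auto
    show "sqs (alg_generated F A (z ` I)) \<subseteq> sqs S" using gen_S[OF zI] by (auto simp: sqs_def)
  qed
  let ?J = "{..<n} - I"
  have "card Y' \<le> card ?J" using I Y' finI by (simp add: card_Diff_subset)
  then obtain g where g: "g ` Y' \<subseteq> ?J" "inj_on g Y'" using card_le_inj[of Y' ?J] Y' by auto
  \<comment> \<open>The leftover generators are placed injectively at the free indices. There may be
    more indices than generators; the surplus ones receive zero.\<close>
  define w where "w j = (if j \<in> g ` Y' then inv_into Y' g j else \<zero>)" for j
  have w: "w j \<in> S" for j
    using subsetD[OF Y'(2) inv_into_into[of j g Y']] SD(2) unfolding w_def by presburger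
  have wg: "w (g y) = y" if "y \<in> Y'" for y using that g by (simp add: w_def)
  \<comment> \<open>The discrepancy between the wanted and the actual square is itself a square from
    the replaced part; adding its root l to w corrects the square without losing w as a
    generator.\<close>
  have "\<exists>l\<in>alg_generated F A (z ` I). l \<otimes> l = a j \<oplus> w j \<otimes> w j" if "j < n" for j
  proof -
    have "w j \<otimes> w j \<in> sqs S" using w by (auto simp: sqs_def)
    then have "a j \<oplus> w j \<otimes> w j \<in> sqs S" using a_sqs[OF that] by (intro sqs_subalg_closed(1) S) auto
    then show ?thesis unfolding eq by (auto simp: sqs_def)
  qed
  then obtain l where l: "\<And>j. j < n \<Longrightarrow> l j \<in> alg_generated F A (z ` I)"
    "\<And>j. j < n \<Longrightarrow> l j \<otimes> l j = a j \<oplus> w j \<otimes> w j" by metis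
  have lS: "l j \<in> S" if "j < n" for j using l(1)[OF that] gen_S[OF zI] by auto
  define z' where "z' j = (if j \<in> I then z j else w j \<oplus> l j)" for j
  have z': "z' j \<in> S \<and> z' j \<otimes> z' j = a j" if j: "j < n" for j
  proof (cases "j \<in> I")
    case False
    have car: "w j \<in> carrier A" "l j \<in> carrier A" "a j \<in> carrier A"
      using w lS[OF j] SD(7) a_sqs[OF j] by (auto simp: sqs_def)
    have "(w j \<oplus> l j) \<otimes> (w j \<oplus> l j) = a j"
      using square_add[OF car(1,2) comm[OF w lS[OF j]]] l(2)[OF j] car by (simp add: A.a_ac)
    then show ?thesis using False w lS[OF j] SD(4) by (simp add: z'_def)
  qed (use z in \<open>auto simp: z'_def\<close>)
  let ?G = "alg_generated F A (z' ` {..<n})"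
  have z'S: "z' ` {..<n} \<subseteq> S" using z' by auto
  have G: "subalg F A ?G" by (rule gen_subalg[OF z'S])
  have zG: "z ` I \<subseteq> ?G"
  proof
    fix x assume "x \<in> z ` I"
    then obtain i where "i \<in> I" "x = z' i" by (auto simp: z'_def)
    then show "x \<in> ?G" using I alg_generated_incl[of "z' ` {..<n}"] by auto
  qed
  then have lG: "l j \<in> ?G" if "j < n" for j
    using l(1)[OF that] alg_generated_minimal[OF G zG] by auto
  have "Y' \<subseteq> ?G"
  proof
    fix y assume y: "y \<in> Y'"
    then have j: "g y < n" "g y \<notin> I" using g by auto
    have yc: "y \<in> carrier A" using y Y' SD by auto
    have "z' (g y) \<in> ?G" using j alg_generated_incl[of "z' ` {..<n}"] by auto
    then have "z' (g y) \<oplus> l (g y) \<in> ?G" using lG[OF j(1)] subalgD(4)[OF G] by auto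
    moreover have "z' (g y) \<oplus> l (g y) = y"
      using j wg[OF y] yc lS[OF j(1)] SD(7) by (simp add: z'_def A.a_assoc)
    ultimately show "y \<in> ?G" by simp
  qed
  then have "S \<subseteq> ?G" unfolding gen[symmetric] using zG by (intro alg_generated_minimal G) auto
  then have "?G = S" using gen_S[OF z'S] by auto
  then show ?thesis using z' by blast
qed

text \<open>The values of \<open>a \<mapsto> T (\<sigma> a a)\<close> form a one-dimensional space over the field \<open>sqs S\<close>,
  which is therefore recovered from \<open>T\<close> and \<open>\<sigma>\<close> alone.\<close>
lemma sqs_characterization:
  assumes \<sigma>: "\<And>a. a \<in> carrier A \<Longrightarrow> \<sigma> a \<in> carrier A"
      "\<And>a b. \<lbrakk>a \<in> carrier A; b \<in> carrier A\<rbrakk> \<Longrightarrow> \<sigma> (a \<oplus> b) = \<sigma> a \<oplus> \<sigma> b"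
      "\<And>a b. \<lbrakk>a \<in> carrier A; b \<in> carrier A\<rbrakk> \<Longrightarrow> \<sigma> (a \<otimes> b) = \<sigma> b \<otimes> \<sigma> a"
      "\<And>a. a \<in> carrier A \<Longrightarrow> \<sigma> (\<sigma> a) = a"
    and T: "\<And>a. a \<in> carrier A \<Longrightarrow> T a \<in> scal"
      "\<And>a b. \<lbrakk>a \<in> carrier A; b \<in> carrier A\<rbrakk> \<Longrightarrow> T (a \<oplus> b) = T a \<oplus> T b"
      "\<And>c a. \<lbrakk>c \<in> scal; a \<in> carrier A\<rbrakk> \<Longrightarrow> T (c \<otimes> a) = c \<otimes> T a"
      "\<And>a b. \<lbrakk>a \<in> carrier A; b \<in> carrier A\<rbrakk> \<Longrightarrow> T (a \<otimes> b) = T (b \<otimes> a)"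
      "\<And>a. a \<in> carrier A \<Longrightarrow> T (\<sigma> a) = T a"
    and nz: "h \<in> carrier A" "T (\<sigma> h \<otimes> h) \<noteq> \<zero>"
    and fixed: "\<And>s. s \<in> S \<Longrightarrow> \<sigma> s = s"
    and g: "g \<in> carrier A" "carrier A = bimod S g"
  shows "sqs S = {c \<in> scal. \<forall>a\<in>carrier A. \<exists>a'\<in>carrier A. c \<otimes> T (\<sigma> a \<otimes> a) = T (\<sigma> a' \<otimes> a')}"
proof -
  define Q where "Q a = T (\<sigma> a \<otimes> a)" for a
  define e where "e = Q g"
  have Qs: "Q a \<in> scal" if "a \<in> carrier A" for a unfolding Q_def using that \<sigma> by (intro T(1)) auto
  then have Qc: "Q a \<in> carrier A" if "a \<in> carrier A" for a using that scal_closed by auto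
  have Q_add: "Q (a \<oplus> b) = Q a \<oplus> Q b" if ab: "a \<in> carrier A" "b \<in> carrier A" for a b
  proof -
    \<comment> \<open>\<open>\<sigma>\<close> maps the product on the right to the one on the left
      and preserves T, so the mixed terms of Q (a + b) cancel.\<close>
    have "T (\<sigma> b \<otimes> a) = T (\<sigma> a \<otimes> b)"
      using T(5)[of "\<sigma> a \<otimes> b"] \<sigma> ab by simp
    moreover have "Q (a \<oplus> b) = Q a \<oplus> T (\<sigma> a \<otimes> b) \<oplus> (T (\<sigma> b \<otimes> a) \<oplus> Q b)"
      unfolding Q_def using ab \<sigma> T(1)[THEN scal_closed] by (simp add: A.l_distr A.r_distr T(2) A.a_ac)
    moreover have "T (\<sigma> a \<otimes> b) \<in> carrier A" using ab \<sigma> T(1)[THEN scal_closed] by simp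
    ultimately show ?thesis using Qc ab by (simp add: A.a_assoc)
  qed
  have Q_sgt: "Q (s \<otimes> g \<otimes> t) = (s \<otimes> s) \<otimes> (t \<otimes> t) \<otimes> e" if st: "s \<in> S" "t \<in> S" for s t
  proof -
    have car: "s \<in> carrier A" "t \<in> carrier A" "\<sigma> g \<in> carrier A" using st SD \<sigma> g by auto
    note gc = g(1)
    \<comment> \<open>Both s and t are fixed by \<open>\<sigma>\<close>, so the two copies of s meet
      in a central square. The trace property then brings the two outer copies of t
      together.\<close>
    have "\<sigma> (s \<otimes> g \<otimes> t) \<otimes> (s \<otimes> g \<otimes> t) = t \<otimes> (\<sigma> g \<otimes> ((s \<otimes> s) \<otimes> (g \<otimes> t)))"
      using car gc st fixed \<sigma> by (simp add: A.m_assoc)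
    also have "\<dots> = t \<otimes> ((s \<otimes> s) \<otimes> (\<sigma> g \<otimes> (g \<otimes> t)))"
      using car gc scal_commute[OF sq[OF st(1)], of "\<sigma> g"] by (simp flip: A.m_assoc)
    also have "\<dots> = (s \<otimes> s) \<otimes> (t \<otimes> (\<sigma> g \<otimes> (g \<otimes> t)))"
      using car gc scal_commute[OF sq[OF st(1)], of t] by (simp flip: A.m_assoc)
    finally have "Q (s \<otimes> g \<otimes> t) = (s \<otimes> s) \<otimes> T (t \<otimes> (\<sigma> g \<otimes> (g \<otimes> t)))"
      unfolding Q_def using car gc T(3)[OF sq[OF st(1)]] by simp
    also have "T (t \<otimes> (\<sigma> g \<otimes> (g \<otimes> t))) = T ((\<sigma> g \<otimes> (g \<otimes> t)) \<otimes> t)"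
      using car gc by (intro T(4)) auto
    also have "(\<sigma> g \<otimes> (g \<otimes> t)) \<otimes> t = (t \<otimes> t) \<otimes> (\<sigma> g \<otimes> g)"
      using car gc scal_commute[OF sq[OF st(2)], of "\<sigma> g \<otimes> g"] by (simp add: A.m_assoc)
    also have "T \<dots> = (t \<otimes> t) \<otimes> e"
      unfolding e_def Q_def using car gc by (intro T(3) sq st) auto
    finally show ?thesis using car Qc[OF gc] by (simp add: e_def A.m_assoc)
  qed
  have ec: "e \<in> carrier A" "e \<in> scal" using Qc Qs g by (auto simp: e_def)
  have sqsc: "k \<in> carrier A" if "k \<in> sqs S" for k using that SD by (auto simp: sqs_def)
  have Q_img: "\<exists>k\<in>sqs S. Q a = k \<otimes> e" if "a \<in> carrier A" for a
    using that unfolding g(2)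
  proof (induction rule: bimod.induct)
    case (base s t)
    have "s \<otimes> s \<in> sqs S" "t \<otimes> t \<in> sqs S" using base by (auto simp: sqs_def)
    then have "(s \<otimes> s) \<otimes> (t \<otimes> t) \<in> sqs S" by (rule sqs_subalg_closed(2)[OF S order_refl])
    then show ?case using Q_sgt[OF base] by blast
  next
    case (add a b)
    then obtain k l where kl: "k \<in> sqs S" "Q a = k \<otimes> e" "l \<in> sqs S" "Q b = l \<otimes> e" by blast
    have "Q (a \<oplus> b) = (k \<oplus> l) \<otimes> e" using Q_add add(1,2) kl sqsc ec g(2) by (simp add: A.l_distr)
    then show ?case using sqs_subalg_closed(1)[OF S _ kl(1,3)] by blast
  qed
  have Q_pre: "\<exists>a\<in>carrier A. k \<otimes> e = Q a" if k: "k \<in> sqs S" for k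
  proof -
    obtain s where s: "s \<in> S" "k = s \<otimes> s" using k by (auto simp: sqs_def)
    have "Q (s \<otimes> g \<otimes> \<one>) = k \<otimes> e" using Q_sgt[OF s(1) SD(3)] s SD(7) by simp
    then show ?thesis using s SD g by (metis A.m_closed A.one_closed)
  qed
  \<comment> \<open>All values of Q are multiples of e, and the value at h is not zero.\<close>
  have e0: "e \<noteq> \<zero>" using Q_img[OF nz(1)] nz(2) sqsc by (auto simp: Q_def)
  then obtain e' where e': "e' \<in> scal" "e \<otimes> e' = \<one>" using scal_inverse ec by blast
  show ?thesis
  proof (intro equalityI subsetI)
    fix c assume c: "c \<in> sqs S"
    have "\<exists>a'\<in>carrier A. c \<otimes> T (\<sigma> a \<otimes> a) = T (\<sigma> a' \<otimes> a')" if a: "a \<in> carrier A" for a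
    proof -
      obtain k where k: "k \<in> sqs S" "Q a = k \<otimes> e" using Q_img[OF a] by blast
      have "c \<otimes> k \<in> sqs S" by (rule sqs_subalg_closed(2)[OF S _ c k(1)]) simp
      then obtain a' where "a' \<in> carrier A" "(c \<otimes> k) \<otimes> e = Q a'" using Q_pre by blast
      then show ?thesis using k sqsc c ec by (auto simp: Q_def A.m_assoc intro!: bexI[of _ a'])
    qed
    moreover have "c \<in> scal" using c sq by (auto simp: sqs_def)
    ultimately show "c \<in> {c \<in> scal. \<forall>a\<in>carrier A. \<exists>a'\<in>carrier A. c \<otimes> T (\<sigma> a \<otimes> a) = T (\<sigma> a' \<otimes> a')}" by auto
  next
    fix c assume "c \<in> {c \<in> scal. \<forall>a\<in>carrier A. \<exists>a'\<in>carrier A. c \<otimes> T (\<sigma> a \<otimes> a) = T (\<sigma> a' \<otimes> a')}"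
    then obtain a' where c: "c \<in> scal" and a': "a' \<in> carrier A" "c \<otimes> e = Q a'"
      using g(1) unfolding e_def Q_def by auto
    \<comment> \<open>A scalar c that stabilises the set of values sends e to some k e, and e can be
      cancelled.\<close>
    obtain k where k: "k \<in> sqs S" "c \<otimes> e = k \<otimes> e" using Q_img a' by metis
    have "c = c \<otimes> (e \<otimes> e')" using e' scal_closed[OF c] by simp
    also have "\<dots> = k \<otimes> (e \<otimes> e')"
      using k(2) ec(1) scal_closed[OF e'(1)] scal_closed[OF c] sqsc[OF k(1)] by (simp flip: A.m_assoc)
    finally have "c = k" using e' sqsc k by simp
    then show "c \<in> sqs S" using k by simp
  qed
qed

end

section \<open>The canonical involution and the trace\<close>

text \<open>Taking centralizers twice spreads commutativity from X to the generated algebra; there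
  squaring respects sums and products, which spreads scalar squares as well.\<close>

lemma (in assoc_alg2) sq_alg_generated:
  assumes X: "X \<subseteq> carrier A" and comm: "\<And>x y. \<lbrakk>x \<in> X; y \<in> X\<rbrakk> \<Longrightarrow> x \<otimes> y = y \<otimes> x"
    and sq: "\<And>x. x \<in> X \<Longrightarrow> x \<otimes> x \<in> scal"
  shows "sq_alg F A (alg_generated F A X)"
proof -
  let ?S = "alg_generated F A X"
  have S: "subalg F A ?S" by (rule subalg_alg_generated[OF X])
  note SD = subalgD[OF S]
  have "X \<subseteq> alg_centralizer A ?S"
    unfolding alg_centralizer_generated[OF X] using X comm by (auto simp: alg_centralizer_def)
  then have "?S \<subseteq> alg_centralizer A ?S" by (intro alg_generated_minimal subalg_centralizer SD(1))
  then have c: "u \<otimes> v = v \<otimes> u" if "u \<in> ?S" "v \<in> ?S" for u v using that by (auto simp: alg_centralizer_def)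
  have "subalg F A {a \<in> ?S. a \<otimes> a \<in> scal}"
  proof (rule subalgI)
    fix a b assume "a \<in> {a \<in> ?S. a \<otimes> a \<in> scal}" "b \<in> {a \<in> ?S. a \<otimes> a \<in> scal}"
    then have ab: "a \<in> ?S" "b \<in> ?S" "a \<otimes> a \<in> scal" "b \<otimes> b \<in> scal" by auto
    note car = SD(7)[OF ab(1)] SD(7)[OF ab(2)] c[OF ab(1,2)]
    show "a \<oplus> b \<in> {a \<in> ?S. a \<otimes> a \<in> scal}" "a \<otimes> b \<in> {a \<in> ?S. a \<otimes> a \<in> scal}"
      using ab SD(4,5) subalgD(4,5)[OF subalg_scal]
      unfolding mem_Collect_eq square_add[OF car] square_mult[OF car] by blast+
  qed (use SD subalgD[OF subalg_scal] in \<open>auto simp: smult_mult_l smult_mult_r\<close>)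
  then have "?S \<subseteq> {a \<in> ?S. a \<otimes> a \<in> scal}"
    using sq alg_generated_incl[of X] by (intro alg_generated_minimal) auto
  then show ?thesis
    using S c by unfold_locales auto
qed

text \<open>Turns anti-automorphisms into homomorphisms, so that the universal property of the
  Clifford algebra applies to involutions.\<close>

definition op_alg :: "('f, 'a) module \<Rightarrow> ('f, 'a) module" where
  "op_alg A = A\<lparr>mult := \<lambda>x y. y \<otimes>\<^bsub>A\<^esub> x\<rparr>"

lemma op_alg_simps [simp]:
  "carrier (op_alg A) = carrier A" "\<one>\<^bsub>op_alg A\<^esub> = \<one>\<^bsub>A\<^esub>" "\<zero>\<^bsub>op_alg A\<^esub> = \<zero>\<^bsub>A\<^esub>"
  "x \<oplus>\<^bsub>op_alg A\<^esub> y = x \<oplus>\<^bsub>A\<^esub> y" "c \<odot>\<^bsub>op_alg A\<^esub> x = c \<odot>\<^bsub>A\<^esub> x" "x \<otimes>\<^bsub>op_alg A\<^esub> y = y \<otimes>\<^bsub>A\<^esub> x"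
  by (simp_all add: op_alg_def)

context assoc_alg
begin

lemma assoc_alg_op: "assoc_alg F (op_alg A)"
proof -
  have ab: "abelian_group (op_alg A)"
    by (rule abelian_groupI) (auto simp: A.a_ac intro: A.l_neg)
  have "ring (op_alg A)"
    using ab by (rule ringI) (auto simp: A.m_assoc A.l_distr A.r_distr intro!: monoidI)
  moreover have "module F (op_alg A)"
    using F.is_cring ab by (rule moduleI) (auto simp: VS.smult_l_distr VS.smult_r_distr VS.smult_assoc1)
  ultimately show ?thesis
    using F.field_axioms by (intro assoc_algI vectorspace.intro) (auto simp: smult_mult_l smult_mult_r)
qed

lemma alg_involutionD:
  assumes "alg_involution F A \<sigma>"
  shows "\<And>a. a \<in> carrier A \<Longrightarrow> \<sigma> a \<in> carrier A"
    "\<And>a b. \<lbrakk>a \<in> carrier A; b \<in> carrier A\<rbrakk> \<Longrightarrow> \<sigma> (a \<oplus> b) = \<sigma> a \<oplus> \<sigma> b"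
    "\<And>c a. \<lbrakk>c \<in> carrier F; a \<in> carrier A\<rbrakk> \<Longrightarrow> \<sigma> (c \<odot> a) = c \<odot> \<sigma> a"
    "\<And>a b. \<lbrakk>a \<in> carrier A; b \<in> carrier A\<rbrakk> \<Longrightarrow> \<sigma> (a \<otimes> b) = \<sigma> b \<otimes> \<sigma> a"
    "\<And>a. a \<in> carrier A \<Longrightarrow> \<sigma> (\<sigma> a) = a"
    "\<sigma> \<one> = \<one>"
    "alg_hom F A (op_alg A) \<sigma>"
proof -
  show *: "\<And>a. a \<in> carrier A \<Longrightarrow> \<sigma> a \<in> carrier A"
    "\<And>a b. \<lbrakk>a \<in> carrier A; b \<in> carrier A\<rbrakk> \<Longrightarrow> \<sigma> (a \<oplus> b) = \<sigma> a \<oplus> \<sigma> b"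
    "\<And>c a. \<lbrakk>c \<in> carrier F; a \<in> carrier A\<rbrakk> \<Longrightarrow> \<sigma> (c \<odot> a) = c \<odot> \<sigma> a"
    "\<And>a b. \<lbrakk>a \<in> carrier A; b \<in> carrier A\<rbrakk> \<Longrightarrow> \<sigma> (a \<otimes> b) = \<sigma> b \<otimes> \<sigma> a"
    "\<And>a. a \<in> carrier A \<Longrightarrow> \<sigma> (\<sigma> a) = a"
    using assms by (auto simp: alg_involution_def module_hom_def)
  have "\<sigma> (\<sigma> \<one> \<otimes> \<one>) = \<sigma> \<one> \<otimes> \<sigma> (\<sigma> \<one>)" using *(1) by (intro *(4)) auto
  then show one: "\<sigma> \<one> = \<one>" using *(1,5) by simp
  show "alg_hom F A (op_alg A) \<sigma>" using * one by (intro alg_homI) auto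
qed

end

context quadratic_char2
begin

sublocale Cl: clifford F V q
  by unfold_locales auto

abbreviation "C \<equiv> clifford_alg F V q"
abbreviation "\<iota> \<equiv> clifford_in F V q"

sublocale A: assoc_alg2 F "clifford_alg F V q"
  using Cl.C.assoc_alg_axioms char2 by (intro assoc_alg2.intro assoc_alg2_axioms.intro)

text \<open>Polarisation of the Clifford relation: the mixed terms in the square of u + v are the
  anticommutator, hence \<open>ad\<close>.\<close>

lemma ad_iota:
  assumes "u \<in> carrier V" "v \<in> carrier V"
  shows "A.ad (\<iota> u) (\<iota> v) = b u v \<odot>\<^bsub>C\<^esub> \<one>\<^bsub>C\<^esub>"
proof -
  note cl = Cl.iota_closed[OF assms(1)] Cl.iota_closed[OF assms(2)]
  have "\<iota> (u \<oplus>\<^bsub>V\<^esub> v) \<otimes>\<^bsub>C\<^esub> \<iota> (u \<oplus>\<^bsub>V\<^esub> v)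
      = (\<iota> u \<otimes>\<^bsub>C\<^esub> \<iota> u \<oplus>\<^bsub>C\<^esub> \<iota> v \<otimes>\<^bsub>C\<^esub> \<iota> v) \<oplus>\<^bsub>C\<^esub> A.ad (\<iota> u) (\<iota> v)"
    using assms cl by (simp add: Cl.iota_add A.ad_def Cl.C.A.l_distr Cl.C.A.r_distr Cl.C.A.a_ac)
  moreover have "\<iota> (u \<oplus>\<^bsub>V\<^esub> v) \<otimes>\<^bsub>C\<^esub> \<iota> (u \<oplus>\<^bsub>V\<^esub> v)
      = (q u \<odot>\<^bsub>C\<^esub> \<one>\<^bsub>C\<^esub> \<oplus>\<^bsub>C\<^esub> q v \<odot>\<^bsub>C\<^esub> \<one>\<^bsub>C\<^esub>) \<oplus>\<^bsub>C\<^esub> b u v \<odot>\<^bsub>C\<^esub> \<one>\<^bsub>C\<^esub>"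
    using assms by (simp add: Cl.iota_square q_add Cl.C.VS.smult_l_distr)
  ultimately show ?thesis
    using assms cl by (simp add: Cl.iota_square)
qed

lemma iota_scal: "u \<in> carrier V \<Longrightarrow> \<iota> u \<otimes>\<^bsub>C\<^esub> \<iota> u \<in> Cl.C.scal"
  "\<lbrakk>u \<in> carrier V; v \<in> carrier V\<rbrakk> \<Longrightarrow> A.ad (\<iota> u) (\<iota> v) \<in> Cl.C.scal"
  by (auto simp: Cl.iota_square ad_iota Cl.C.scal_def)

lemma iota_submodule:
  assumes "subalg F C S"
  shows "submodule F {v \<in> carrier V. \<iota> v \<in> S} V"
  unfolding submodule_def using V.module_axioms Cl.C.subalgD[OF assms]
  by (auto simp: Cl.iota_add Cl.iota_smult Cl.iota_zero)

end

section \<open>The canonical involution of the Clifford algebra\<close>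

context quad_involution
begin

abbreviation "J \<equiv> clifford_inv F V q \<tau>"

lemma clifford_involution_unique:
  assumes "alg_involution F C J1" "\<And>v. v \<in> carrier V \<Longrightarrow> J1 (\<iota> v) = \<iota> (\<tau> v)"
    and "alg_involution F C J2" "\<And>v. v \<in> carrier V \<Longrightarrow> J2 (\<iota> v) = \<iota> (\<tau> v)" and "a \<in> carrier C"
  shows "J1 a = J2 a"
  by (rule Cl.hom_unique[OF Cl.C.assoc_alg_op Cl.C.alg_involutionD(7)[OF assms(1)] Cl.C.alg_involutionD(7)[OF assms(3)]])
    (use assms in auto)

text \<open>As \<open>\<tau>\<close> preserves q, it extends to a homomorphism into the opposite
  algebra. Applied twice, this is an endomorphism fixing all vectors, hence the identity.\<close>

lemma clifford_involution_exists:
  "\<exists>h. alg_involution F C h \<and> (\<forall>v\<in>carrier V. h (\<iota> v) = \<iota> (\<tau> v))"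
proof -
  have "(\<lambda>v. \<iota> (\<tau> v)) \<in> module_hom F V (op_alg C)"
    by (auto simp: module_hom_def Cl.iota_closed tau_add tau_smult Cl.iota_add Cl.iota_smult)
  then obtain h where h: "alg_hom F C (op_alg C) h" "\<And>v. v \<in> carrier V \<Longrightarrow> h (\<iota> v) = \<iota> (\<tau> v)"
    using Cl.universal[OF Cl.C.assoc_alg_op, of "\<lambda>v. \<iota> (\<tau> v)"] by (auto simp: Cl.iota_square q_tau)
  note hD = alg_homD[OF h(1), simplified]
  have hh: "alg_hom F C C (\<lambda>a. h (h a))" by (rule alg_homI) (auto simp: hD)
  have idh: "alg_hom F C C (\<lambda>a. a)" by (rule alg_homI) auto
  have "h (h a) = a" if "a \<in> carrier C" for a
    by (rule Cl.hom_unique[OF Cl.C.assoc_alg_axioms hh idh _ that]) (simp add: h(2) involution)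
  then have "alg_involution F C h" by (auto simp: alg_involution_def module_hom_def hD)
  then show ?thesis using h by blast
qed

lemma clifford_inv: "alg_involution F C J" "\<And>v. v \<in> carrier V \<Longrightarrow> J (\<iota> v) = \<iota> (\<tau> v)"
proof -
  obtain h where h: "alg_involution F C h" "\<And>v. v \<in> carrier V \<Longrightarrow> h (\<iota> v) = \<iota> (\<tau> v)"
    using clifford_involution_exists by blast
  let ?h = "restrict h (carrier C)"
  note hD = Cl.C.alg_involutionD[OF h(1)]
  have rh: "alg_involution F C ?h" using hD by (auto simp: alg_involution_def module_hom_def)
  have ri: "\<And>v. v \<in> carrier V \<Longrightarrow> ?h (\<iota> v) = \<iota> (\<tau> v)" using h by (simp add: Cl.iota_closed)
  have "J = ?h"
    unfolding clifford_inv_def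
  proof (rule the_equality)
    show "?h \<in> extensional (carrier C) \<and> alg_involution F C ?h \<and> (\<forall>v\<in>carrier V. ?h (\<iota> v) = \<iota> (\<tau> v))"
      using rh ri by blast
    fix J' assume J': "J' \<in> extensional (carrier C) \<and> alg_involution F C J' \<and> (\<forall>v\<in>carrier V. J' (\<iota> v) = \<iota> (\<tau> v))"
    show "J' = ?h"
    proof (rule extensionalityI[of _ "carrier C"])
      show "J' a = ?h a" if "a \<in> carrier C" for a
        using clifford_involution_unique[of J' ?h a] J' rh ri that by blast
    qed (use J' in auto)
  qed
  then show "alg_involution F C J" "\<And>v. v \<in> carrier V \<Longrightarrow> J (\<iota> v) = \<iota> (\<tau> v)" using rh ri by auto
qed

lemmas J = Cl.C.alg_involutionD[OF clifford_inv(1)]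

text \<open>Reversing products does not affect x a + a x, so J only exchanges v with
  \<open>\<tau>\<close> v.\<close>

lemma J_ad:
  assumes "v \<in> carrier V" "a \<in> carrier C"
  shows "A.ad (\<iota> v) (J a) = J (A.ad (\<iota> (\<tau> v)) a)"
proof -
  have "J (\<iota> (\<tau> v)) = \<iota> v" using assms clifford_inv(2)[of "\<tau> v"] by (simp add: involution)
  then show ?thesis using assms Cl.iota_closed[of v] Cl.iota_closed[of "\<tau> v"]
    by (simp add: A.ad_def J Cl.C.A.a_comm)
qed

end

section \<open>The representative generated by the residual space\<close>

context quad_involution_basis
begin

lemma nontrivial: "\<one>\<^bsub>C\<^esub> \<noteq> \<zero>\<^bsub>C\<^esub>"
proof -
  obtain \<beta> where "bilinear_form F V \<beta>" "\<forall>v\<in>carrier V. \<beta> v v = q v" using exists_bilinear_diag by blast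
  then interpret clifford_contraction F V q \<beta> using char2 by unfold_locales auto
  show ?thesis by (rule clifford_nontrivial)
qed

sublocale D: dual_generators F "clifford_alg F V q" "n + n" "\<lambda>i. \<iota> (y i)" "\<lambda>i. \<iota> (ys i)"
  using nontrivial y_closed ys_closed iota_scal
  by unfold_locales (auto simp: Cl.iota_closed ad_iota ys_y)

lemma H_total: "D.H (n + n) = carrier C"
proof (rule Cl.generated)
  show S: "subalg F C (D.H (n + n))" by (rule D.H_subalg) simp
  show "\<iota> ` carrier V \<subseteq> D.H (n + n)"
  proof (clarify)
    fix v assume v: "v \<in> carrier V"
    have "lsum (\<lambda>j. b (ys j) v) y (n + n) \<in> {v \<in> carrier V. \<iota> v \<in> D.H (n + n)}"
      using y_closed ys_closed v Cl.C.alg_generated_incl[of "(\<lambda>i. \<iota> (y i)) ` {..<n + n}"]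
      by (intro lsum_submodule[OF iota_submodule[OF S]]) auto
    then show "\<iota> v \<in> D.H (n + n)" using expand_y[OF v] by simp
  qed
qed

lemma has_dim_C: "has_dim F C ((2 ^ n)\<^sup>2)"
  using D.H_has_dim[of "n + n"] by (simp add: H_total power2_eq_square power_add)

definition S0 :: "('v list \<Rightarrow> 'f) set set set" where
  "S0 = alg_generated F C ((\<lambda>i. \<iota> (rho i)) ` {..<n})"

lemma S0_H: "S0 = D.H n"
proof -
  have "(\<lambda>i. \<iota> (rho i)) ` {..<n} = (\<lambda>i. \<iota> (y i)) ` {..<n}" by (auto simp: y_def)
  then show ?thesis by (simp add: S0_def)
qed

sublocale S0: sq_alg F "clifford_alg F V q" S0
  unfolding S0_def
proof (rule A.sq_alg_generated)
  fix a c assume "a \<in> (\<lambda>i. \<iota> (rho i)) ` {..<n}" "c \<in> (\<lambda>i. \<iota> (rho i)) ` {..<n}"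
  then obtain i j where ij: "a = \<iota> (rho i)" "c = \<iota> (rho j)" "i < n" "j < n" by auto
  have "A.ad a c = \<zero>\<^bsub>C\<^esub>" using ij rho_R rho_closed by (simp add: ad_iota R_isotropic)
  then show "a \<otimes>\<^bsub>C\<^esub> c = c \<otimes>\<^bsub>C\<^esub> a" using ij rho_closed Cl.iota_closed A.ad_eq_zero by auto
qed (use rho_closed Cl.iota_closed iota_scal in auto)

text \<open>An element commuting with \<open>S0\<close> commutes with all of R, in particular with
  the \<open>fs\<close>. These are the dual vectors of the last n generators, so the element
  involves only the first n.\<close>

lemma S0_self_centralizing: "alg_centralizer C S0 = S0"
proof
  show "S0 \<subseteq> alg_centralizer C S0"
    using S0.SD(1) S0.comm unfolding alg_centralizer_def by blast
  show "alg_centralizer C S0 \<subseteq> S0"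
  proof
    fix a assume a: "a \<in> alg_centralizer C S0"
    then have ac: "a \<in> carrier C" by (auto simp: alg_centralizer_def)
    have "\<iota> r \<in> S0" if r: "r \<in> R" for r
    proof -
      have rc: "r \<in> carrier V" using r R_closed by auto
      have "lsum (\<lambda>i. b (rs i) r) rho n \<in> {v \<in> carrier V. \<iota> v \<in> S0}"
        using rho_closed rs_closed rc Cl.C.alg_generated_incl[of "(\<lambda>i. \<iota> (rho i)) ` {..<n}"]
        by (intro lsum_submodule[OF iota_submodule[OF S0.S]]) (auto simp: S0_def)
      then show ?thesis using expand_rho[OF r] by simp
    qed
    then have "A.ad (\<iota> (fs i)) a = \<zero>\<^bsub>C\<^esub>" if "i < n" for i
      using a ac fs_R[OF that] fs_closed[OF that]
      by (subst A.ad_eq_zero) (auto simp: alg_centralizer_def Cl.iota_closed)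
    then have "A.ad (\<iota> (ys j)) a = \<zero>\<^bsub>C\<^esub>" if "n \<le> j" "j < n + n" for j
      using that by (simp add: ys_def)
    then show "a \<in> S0" unfolding S0_H using ac by (intro D.H_kernels[of n "n + n"]) (auto simp: H_total)
  qed
qed

text \<open>On a commutative algebra the elements fixed by an anti-automorphism are closed under
  products, and the generators come from fixed vectors.\<close>

lemma S0_Sym: "S0 \<subseteq> Sym C J"
proof -
  have "subalg F C {a \<in> S0. J a = a}"
  proof (rule Cl.C.subalgI)
    fix a c assume "a \<in> {a \<in> S0. J a = a}" "c \<in> {a \<in> S0. J a = a}"
    then have ac: "a \<in> S0" "c \<in> S0" "J a = a" "J c = c" by auto
    then have "J (a \<otimes>\<^bsub>C\<^esub> c) = c \<otimes>\<^bsub>C\<^esub> a" using S0.SD(7) by (simp add: J)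
    then show "a \<otimes>\<^bsub>C\<^esub> c \<in> {a \<in> S0. J a = a}"
      using S0.comm[OF ac(2,1)] S0.SD(5)[OF ac(1,2)] by simp
  qed (use S0.SD in \<open>simp_all add: J Collect_subset subset_eq\<close>)
  then have "S0 \<subseteq> {a \<in> S0. J a = a}"
    unfolding S0_def using rho_closed Cl.C.alg_generated_incl[of "(\<lambda>i. \<iota> (rho i)) ` {..<n}"]
    by (intro Cl.C.alg_generated_minimal) (auto simp: clifford_inv tau_rho)
  then show ?thesis using S0.SD by (auto simp: Sym_def)
qed

text \<open>Ensures that the generating set has exactly n members, as a representative
  requires.\<close>

lemma iota_rho_inj: "inj_on (\<lambda>i. \<iota> (rho i)) {..<n}"
proof (rule inj_onI)
  fix i j assume ij: "i \<in> {..<n}" "j \<in> {..<n}" "\<iota> (rho i) = \<iota> (rho j)"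
  show "i = j"
  proof (rule ccontr)
    assume "i \<noteq> j"
    then have "A.ad (\<iota> (rs i)) (\<iota> (rho i)) = \<one>\<^bsub>C\<^esub>" "A.ad (\<iota> (rs i)) (\<iota> (rho j)) = \<zero>\<^bsub>C\<^esub>"
      using ij(1,2) by (simp_all add: ad_iota rs_closed rho_closed rs_rho)
    then show False using ij(3) nontrivial by simp
  qed
qed

lemma S0_representative: "S0 \<in> Phi_representatives F C J"
proof -
  have "\<forall>x\<in>S0. \<exists>c\<in>carrier F. x \<otimes>\<^bsub>C\<^esub> x = c \<odot>\<^bsub>C\<^esub> \<one>\<^bsub>C\<^esub>"
    using S0.sq by (auto simp: Cl.C.scal_def)
  moreover have "has_degree F C (2 ^ n)" using has_dim_C by (simp add: has_degree_def)
  moreover have "has_dim F (C\<lparr>carrier := S0\<rparr>) (2 ^ n)" using D.H_has_dim[of n] by (simp add: S0_H)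
  moreover have "\<exists>X. X \<subseteq> S0 \<and> finite X \<and> card X = n \<and> alg_generated F C X = S0"
    using card_image[OF iota_rho_inj] Cl.C.alg_generated_incl
    by (intro exI[of _ "(\<lambda>i. \<iota> (rho i)) ` {..<n}"]) (auto simp: S0_def)
  ultimately show ?thesis
    unfolding Phi_representatives_def using S0.S S0_Sym S0_self_centralizing by blast
qed

end

section \<open>The trace on C(q)\<close>

context quad_involution_basis
begin

abbreviation adi :: "'v \<Rightarrow> ('v list \<Rightarrow> 'f) set set \<Rightarrow> ('v list \<Rightarrow> 'f) set set" where
  "adi v \<equiv> A.ad (\<iota> v)"

lemma adi_closed: "\<lbrakk>v \<in> carrier V; a \<in> carrier C\<rbrakk> \<Longrightarrow> adi v a \<in> carrier C"
  by (simp add: Cl.iota_closed)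

lemma adi_adi: "\<lbrakk>v \<in> carrier V; a \<in> carrier C\<rbrakk> \<Longrightarrow> adi v (adi v a) = \<zero>\<^bsub>C\<^esub>"
  by (intro A.ad_ad_square iota_scal Cl.iota_closed)

lemma adi_commute:
  "\<lbrakk>u \<in> carrier V; v \<in> carrier V; a \<in> carrier C\<rbrakk> \<Longrightarrow> adi u (adi v a) = adi v (adi u a)"
  by (intro A.ad_ad_commute iota_scal Cl.iota_closed)

text \<open>Up to the identification of scalars with \<open>F\<close>, \<open>Tr n\<close> takes the coefficient of the top monomial
  with respect to \<open>rho, f\<close>. It kills every commutator with a vector and hence is a trace.\<close>
primrec Tr :: "nat \<Rightarrow> ('v list \<Rightarrow> 'f) set set \<Rightarrow> ('v list \<Rightarrow> 'f) set set" where
  "Tr 0 a = a"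
| "Tr (Suc k) a = Tr k (adi (rs k) (adi (fs k) a))"

lemma Tr_closed: "\<lbrakk>k \<le> n; a \<in> carrier C\<rbrakk> \<Longrightarrow> Tr k a \<in> carrier C"
  by (induction k arbitrary: a) (auto simp: adi_closed rs_closed fs_closed simp del: A.ad_closed)

lemma Tr_add: "\<lbrakk>k \<le> n; a \<in> carrier C; c \<in> carrier C\<rbrakk> \<Longrightarrow> Tr k (a \<oplus>\<^bsub>C\<^esub> c) = Tr k a \<oplus>\<^bsub>C\<^esub> Tr k c"
  by (induction k arbitrary: a c) (simp_all add: A.ad_add Cl.iota_closed rs_closed fs_closed)

lemma Tr_smult: "\<lbrakk>k \<le> n; c \<in> carrier F; a \<in> carrier C\<rbrakk> \<Longrightarrow> Tr k (c \<odot>\<^bsub>C\<^esub> a) = c \<odot>\<^bsub>C\<^esub> Tr k a"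
  by (induction k arbitrary: a) (simp_all add: A.ad_smult Cl.iota_closed rs_closed fs_closed)

lemma Tr_zero: "k \<le> n \<Longrightarrow> Tr k \<zero>\<^bsub>C\<^esub> = \<zero>\<^bsub>C\<^esub>"
  by (induction k) (simp_all add: Cl.iota_closed rs_closed fs_closed)

text \<open>Commutators with vectors commute with each other, since the commutator of two vectors is
  a scalar.\<close>

lemma adi_Tr: "\<lbrakk>k \<le> n; v \<in> carrier V; a \<in> carrier C\<rbrakk> \<Longrightarrow> adi v (Tr k a) = Tr k (adi v a)"
proof (induction k arbitrary: a)
  case (Suc k)
  have cl: "rs k \<in> carrier V" "fs k \<in> carrier V" using Suc.prems rs_closed fs_closed by auto
  have "adi v (Tr (Suc k) a) = Tr k (adi v (adi (rs k) (adi (fs k) a)))"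
    using Suc.prems cl by (simp add: Suc.IH Cl.iota_closed)
  also have "adi v (adi (rs k) (adi (fs k) a)) = adi (rs k) (adi (fs k) (adi v a))"
    using Suc.prems cl adi_commute[of v "rs k" "adi (fs k) a"] adi_commute[of v "fs k" a] adi_closed by simp
  finally show ?case by simp
qed simp

text \<open>The extra commutator can be moved next to its own copy inside \<open>Tr\<close>, and the
  two compose to zero.\<close>

lemma Tr_kills_basis:
  "\<lbrakk>k \<le> n; i < k; a \<in> carrier C\<rbrakk> \<Longrightarrow> Tr k (adi (fs i) a) = \<zero>\<^bsub>C\<^esub> \<and> Tr k (adi (rs i) a) = \<zero>\<^bsub>C\<^esub>"
proof (induction k arbitrary: a)
  case (Suc k)
  have cl: "rs k \<in> carrier V" "fs k \<in> carrier V" "rs i \<in> carrier V" "fs i \<in> carrier V"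
    using Suc.prems rs_closed fs_closed by auto
  have a: "a \<in> carrier C" "adi (fs k) a \<in> carrier C" using Suc.prems cl adi_closed by auto
  show ?case
  proof (cases "i = k")
    case True
    have "adi (rs k) (adi (fs k) (adi (rs k) a)) = adi (rs k) (adi (rs k) (adi (fs k) a))"
      using adi_commute[OF cl(2,1) a(1)] by simp
    also have "\<dots> = \<zero>\<^bsub>C\<^esub>" by (rule adi_adi[OF cl(1) a(2)])
    finally show ?thesis using True cl a adi_adi[OF cl(2) a(1)] Suc.prems
      by (simp add: Tr_zero Cl.iota_closed)
  next
    case False
    then have i: "i < k" using Suc.prems by simp
    have "adi (rs k) (adi (fs k) (adi v a)) = adi v (adi (rs k) (adi (fs k) a))" if "v \<in> carrier V" for v
      using adi_commute[OF cl(2) that a(1)] adi_commute[OF cl(1) that a(2)] by simp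
    then show ?thesis using Suc.IH[OF _ i, of "adi (rs k) (adi (fs k) a)"] Suc.prems(1) cl a adi_closed by simp
  qed
qed simp

text \<open>The condition is linear in v and the dual basis spans V.\<close>

lemma Tr_kills:
  assumes v: "v \<in> carrier V" and a: "a \<in> carrier C"
  shows "Tr n (adi v a) = \<zero>\<^bsub>C\<^esub>"
proof -
  have "submodule F {v \<in> carrier V. Tr n (adi v a) = \<zero>\<^bsub>C\<^esub>} V"
    unfolding submodule_def using V.module_axioms a
    by (simp add: subset_eq Cl.iota_add Cl.iota_smult Cl.iota_zero Cl.iota_closed A.ad_add_left A.ad_smult_left
        Tr_add Tr_smult Tr_zero)
  moreover have "ys i \<in> {v \<in> carrier V. Tr n (adi v a) = \<zero>\<^bsub>C\<^esub>}" if "i < n + n" for i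
    using Tr_kills_basis[of n "if i < n then i else i - n" a] that a ys_closed[OF that]
    by (cases "i < n") (simp_all add: ys_def)
  ultimately have "lsum (\<lambda>j. b (y j) v) ys (n + n) \<in> {v \<in> carrier V. Tr n (adi v a) = \<zero>\<^bsub>C\<^esub>}"
    using y_closed v by (intro lsum_submodule) auto
  then show ?thesis using expand_ys[OF v] by simp
qed

text \<open>All derivatives of the value vanish, so no generator is left in it.\<close>

lemma Tr_scal:
  assumes "a \<in> carrier C"
  shows "Tr n a \<in> Cl.C.scal"
proof -
  have "Tr n a \<in> D.H 0"
  proof (rule D.H_kernels[of 0 "n + n"])
    show "Tr n a \<in> D.H (n + n)" using assms by (simp add: H_total Tr_closed)
    show "A.ad (\<iota> (ys j)) (Tr n a) = \<zero>\<^bsub>C\<^esub>" if "j < n + n" for j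
      using that assms ys_closed by (simp add: adi_Tr Tr_kills)
  qed auto
  then show ?thesis by (simp add: Cl.C.alg_generated_empty)
qed

text \<open>Commuting with every c under the trace passes to products by cyclic rotation, so vectors
  suffice; for these the claim is that traces of commutators vanish.\<close>

lemma Tr_commute:
  assumes a: "a \<in> carrier C" and c: "c \<in> carrier C"
  shows "Tr n (a \<otimes>\<^bsub>C\<^esub> c) = Tr n (c \<otimes>\<^bsub>C\<^esub> a)"
proof -
  let ?S = "{a \<in> carrier C. \<forall>c\<in>carrier C. Tr n (a \<otimes>\<^bsub>C\<^esub> c) = Tr n (c \<otimes>\<^bsub>C\<^esub> a)}"
  have "subalg F C ?S"
  proof (rule Cl.C.subalgI)
    fix x z assume "x \<in> ?S" "z \<in> ?S"
    then have xz: "x \<in> carrier C" "z \<in> carrier C"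
      and comm: "\<And>c. c \<in> carrier C \<Longrightarrow> Tr n (x \<otimes>\<^bsub>C\<^esub> c) = Tr n (c \<otimes>\<^bsub>C\<^esub> x)"
        "\<And>c. c \<in> carrier C \<Longrightarrow> Tr n (z \<otimes>\<^bsub>C\<^esub> c) = Tr n (c \<otimes>\<^bsub>C\<^esub> z)" by blast+
    show "x \<oplus>\<^bsub>C\<^esub> z \<in> ?S" using xz comm by (simp add: Cl.C.A.l_distr Cl.C.A.r_distr Tr_add)
    have "Tr n (x \<otimes>\<^bsub>C\<^esub> z \<otimes>\<^bsub>C\<^esub> c) = Tr n (c \<otimes>\<^bsub>C\<^esub> (x \<otimes>\<^bsub>C\<^esub> z))" if c: "c \<in> carrier C" for c
    proof -
      have "Tr n (x \<otimes>\<^bsub>C\<^esub> z \<otimes>\<^bsub>C\<^esub> c) = Tr n (z \<otimes>\<^bsub>C\<^esub> c \<otimes>\<^bsub>C\<^esub> x)"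
        using comm(1)[of "z \<otimes>\<^bsub>C\<^esub> c"] xz c by (simp add: Cl.C.A.m_assoc)
      also have "\<dots> = Tr n (c \<otimes>\<^bsub>C\<^esub> x \<otimes>\<^bsub>C\<^esub> z)"
        using comm(2)[of "c \<otimes>\<^bsub>C\<^esub> x"] xz c by (simp add: Cl.C.A.m_assoc)
      finally show ?thesis using xz c by (simp add: Cl.C.A.m_assoc)
    qed
    then show "x \<otimes>\<^bsub>C\<^esub> z \<in> ?S" using xz by simp
  next
    fix d x assume "d \<in> carrier F" "x \<in> ?S"
    then show "d \<odot>\<^bsub>C\<^esub> x \<in> ?S" by (simp add: Cl.C.smult_mult_l Cl.C.smult_mult_r Tr_smult)
  qed auto
  moreover have "\<iota> ` carrier V \<subseteq> ?S"
  proof (rule image_subsetI)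
    fix v assume v: "v \<in> carrier V"
    have "Tr n (\<iota> v \<otimes>\<^bsub>C\<^esub> c) = Tr n (c \<otimes>\<^bsub>C\<^esub> \<iota> v)" if c: "c \<in> carrier C" for c
    proof -
      have "Tr n (\<iota> v \<otimes>\<^bsub>C\<^esub> c) \<oplus>\<^bsub>C\<^esub> Tr n (c \<otimes>\<^bsub>C\<^esub> \<iota> v) = \<zero>\<^bsub>C\<^esub>"
        using Tr_kills[OF v c] v c Cl.iota_closed by (simp add: A.ad_def Tr_add)
      then show ?thesis using v c Cl.iota_closed Tr_closed by (simp add: A.add_eq_zero_iff)
    qed
    then show "\<iota> v \<in> ?S" using v Cl.iota_closed by simp
  qed
  ultimately have "?S = carrier C" by (rule Cl.generated)
  then show ?thesis using a c by blast
qed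

lemma J_scal: "c \<in> Cl.C.scal \<Longrightarrow> J c = c"
  by (auto simp: Cl.C.scal_def J)

text \<open>J turns the commutator with \<open>rs k\<close> into that with \<open>rs k\<close> +
  \<open>fs k\<close>, and the extra term vanishes because the commutator with \<open>fs k\<close>
  has already been applied. The value is a scalar, which J fixes.\<close>

lemma Tr_J:
  assumes "a \<in> carrier C"
  shows "Tr n (J a) = Tr n a"
proof -
  have "Tr k (J a) = J (Tr k a)" if "k \<le> n" "a \<in> carrier C" for k a
    using that
  proof (induction k arbitrary: a)
    case (Suc k)
    have cl: "rs k \<in> carrier V" "fs k \<in> carrier V" using Suc.prems rs_closed fs_closed by auto
    have k: "k < n" "k \<le> n" using Suc.prems by auto
    note a = Suc.prems(2)
    have fa: "adi (fs k) a \<in> carrier C" using a cl adi_closed by auto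
    have "adi (rs k) (adi (fs k) (J a)) = J (adi (\<tau> (rs k)) (adi (fs k) a))"
      using J_ad[OF cl(2) a] J_ad[OF cl(1) fa] by (simp add: tau_fs[OF k(1)])
    also have "adi (\<tau> (rs k)) (adi (fs k) a) = adi (rs k) (adi (fs k) a)"
      using cl a fa adi_adi[OF cl(2) a] by (simp add: tau_rs[OF k(1)] Cl.iota_add Cl.iota_closed A.ad_add_left)
    finally show ?case using Suc.IH[OF k(2) adi_closed[OF cl(1) fa]] by simp
  qed simp
  then show ?thesis using assms Tr_scal J_scal by simp
qed

text \<open>The witness that a |-> Tr (J a a) is not zero: J reverses the product and replaces each
  f i by f i + rho i, so every f i and every rho i occurs in J (fprod n) times
  \<open>fprod n\<close>.\<close>

primrec fprod :: "nat \<Rightarrow> ('v list \<Rightarrow> 'f) set set" where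
  "fprod 0 = \<one>\<^bsub>C\<^esub>"
| "fprod (Suc k) = fprod k \<otimes>\<^bsub>C\<^esub> \<iota> (f k)"

lemma fprod_closed: "k \<le> n \<Longrightarrow> fprod k \<in> carrier C"
  by (induction k) (auto simp: f_closed Cl.iota_closed)

lemma J_fprod:
  "k < n \<Longrightarrow> J (fprod (Suc k)) \<otimes>\<^bsub>C\<^esub> fprod (Suc k)
    = \<iota> (\<tau> (f k)) \<otimes>\<^bsub>C\<^esub> (J (fprod k) \<otimes>\<^bsub>C\<^esub> fprod k) \<otimes>\<^bsub>C\<^esub> \<iota> (f k)"
  using fprod_closed[of k] f_closed[of k] by (simp add: J clifford_inv Cl.iota_closed Cl.C.A.m_assoc)

text \<open>Only f i and rho i with i < k occur in the product, and the dual vectors of index j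
  \<ge> k are orthogonal to them.\<close>

lemma adi_JG_zero:
  assumes "k \<le> j" "j < n"
  shows "adi (fs j) (J (fprod k) \<otimes>\<^bsub>C\<^esub> fprod k) = \<zero>\<^bsub>C\<^esub> \<and> adi (rs j) (J (fprod k) \<otimes>\<^bsub>C\<^esub> fprod k) = \<zero>\<^bsub>C\<^esub>"
  using assms
proof (induction k)
  case 0
  then show ?case by (simp add: J A.ad_one Cl.iota_closed fs_closed rs_closed)
next
  case (Suc k)
  let ?w = "J (fprod k) \<otimes>\<^bsub>C\<^esub> fprod k"
  have k: "k < n" "k \<noteq> j" using Suc.prems by auto
  have cl: "f k \<in> carrier V" "rho k \<in> carrier V" "fs j \<in> carrier V" "rs j \<in> carrier V"
    using k Suc.prems f_closed rho_closed fs_closed rs_closed by auto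
  have w: "?w \<in> carrier C" using fprod_closed[of k] k by (simp add: J)
  have "b (fs j) (f k) = \<zero>" "b (fs j) (rho k) = \<zero>" "b (rs j) (f k) = \<zero>" "b (rs j) (rho k) = \<zero>"
    using k Suc.prems by (simp_all add: fs_f fs_rho rs_f rs_rho)
  then have "adi (fs j) (\<iota> (f k)) = \<zero>\<^bsub>C\<^esub>" "adi (fs j) (\<iota> (\<tau> (f k))) = \<zero>\<^bsub>C\<^esub>"
    "adi (rs j) (\<iota> (f k)) = \<zero>\<^bsub>C\<^esub>" "adi (rs j) (\<iota> (\<tau> (f k))) = \<zero>\<^bsub>C\<^esub>"
    using cl by (simp_all add: ad_iota tau_f[OF k(1)] b_add)
  then show ?case
    unfolding J_fprod[OF k(1)] using Suc w cl by (simp add: A.ad_mult Cl.iota_closed)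
qed

text \<open>The commutator with \<open>fs k\<close> strips the outer factor on either side, leaving
  two terms; the one with \<open>rs k\<close> is sensitive only to the rho k inside
  \<open>\<tau>\<close> (f k), so exactly one of them survives.\<close>

lemma Tr_JG: "k \<le> n \<Longrightarrow> Tr k (J (fprod k) \<otimes>\<^bsub>C\<^esub> fprod k) = \<one>\<^bsub>C\<^esub>"
proof (induction k)
  case 0
  then show ?case by (simp add: J)
next
  case (Suc k)
  let ?w = "J (fprod k) \<otimes>\<^bsub>C\<^esub> fprod k"
  have k: "k < n" using Suc.prems by auto
  have cl: "f k \<in> carrier V" "rho k \<in> carrier V" "fs k \<in> carrier V" "rs k \<in> carrier V"
    using k f_closed rho_closed fs_closed rs_closed by auto
  have w: "?w \<in> carrier C" using fprod_closed[of k] k by (simp add: J)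
  have 0: "adi (fs k) ?w = \<zero>\<^bsub>C\<^esub>" "adi (rs k) ?w = \<zero>\<^bsub>C\<^esub>" using adi_JG_zero[of k k] k by auto
  have bs: "b (fs k) (f k) = \<one>" "b (fs k) (rho k) = \<zero>" "b (rs k) (f k) = \<zero>" "b (rs k) (rho k) = \<one>"
    using k by (simp_all add: fs_f fs_rho rs_f rs_rho)
  have ads: "adi (fs k) (\<iota> (f k)) = \<one>\<^bsub>C\<^esub>" "adi (fs k) (\<iota> (\<tau> (f k))) = \<one>\<^bsub>C\<^esub>"
    "adi (rs k) (\<iota> (f k)) = \<zero>\<^bsub>C\<^esub>" "adi (rs k) (\<iota> (\<tau> (f k))) = \<one>\<^bsub>C\<^esub>"
    using cl bs by (simp_all add: ad_iota tau_f[OF k] b_add)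
  have "adi (fs k) (\<iota> (\<tau> (f k)) \<otimes>\<^bsub>C\<^esub> ?w \<otimes>\<^bsub>C\<^esub> \<iota> (f k)) = ?w \<otimes>\<^bsub>C\<^esub> \<iota> (f k) \<oplus>\<^bsub>C\<^esub> \<iota> (\<tau> (f k)) \<otimes>\<^bsub>C\<^esub> ?w"
    using w cl 0 ads by (simp add: A.ad_mult Cl.iota_closed)
  moreover have "adi (rs k) (?w \<otimes>\<^bsub>C\<^esub> \<iota> (f k) \<oplus>\<^bsub>C\<^esub> \<iota> (\<tau> (f k)) \<otimes>\<^bsub>C\<^esub> ?w) = ?w"
    using w cl 0 ads by (simp add: A.ad_mult A.ad_add Cl.iota_closed)
  ultimately show ?case
    unfolding J_fprod[OF k] Tr.simps using Suc k by simp
qed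

section \<open>Generators of an arbitrary representative\<close>

lemma representative_sq_alg:
  assumes "S \<in> Phi_representatives F C J"
  shows "sq_alg F C S"
proof -
  have S: "subalg F C S" and c: "alg_centralizer C S = S"
    and sq: "\<forall>x\<in>S. \<exists>c\<in>carrier F. x \<otimes>\<^bsub>C\<^esub> x = c \<odot>\<^bsub>C\<^esub> \<one>\<^bsub>C\<^esub>"
    using assms by (auto simp: Phi_representatives_def)
  have "u \<otimes>\<^bsub>C\<^esub> v = v \<otimes>\<^bsub>C\<^esub> u" if "u \<in> S" "v \<in> S" for u v
    using c that unfolding alg_centralizer_def by blast
  moreover have "u \<otimes>\<^bsub>C\<^esub> u \<in> Cl.C.scal" if "u \<in> S" for u
    using sq that unfolding Cl.C.scal_def by auto
  ultimately show ?thesis using S by unfold_locales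
qed

lemma representative_degree:
  assumes "has_degree F C (2 ^ m)"
  shows "m = n"
proof -
  have "((2::nat) ^ m)\<^sup>2 = (2 ^ n)\<^sup>2" using assms has_dim_C unfolding has_degree_def has_dim_def by simp
  then have "(2::nat) ^ m = 2 ^ n" by (metis power2_eq_iff_nonneg zero_le)
  then show ?thesis by simp
qed

text \<open>The right-hand side does not mention S, so all representatives have the same squares.
  The two elements required are \<open>fprod n\<close>, where the form takes the value 1, and the
  bimodule generator of C(q) over S.\<close>

lemma representative_sqs:
  assumes "S \<in> Phi_representatives F C J"
  shows "A.sqs S = {c \<in> Cl.C.scal. \<forall>a\<in>carrier C. \<exists>a'\<in>carrier C.
    c \<otimes>\<^bsub>C\<^esub> Tr n (J a \<otimes>\<^bsub>C\<^esub> a) = Tr n (J a' \<otimes>\<^bsub>C\<^esub> a')}"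
proof -
  interpret S: sq_alg F C S by (rule representative_sq_alg[OF assms])
  obtain m X where m: "has_degree F C (2 ^ m)" "has_dim F (C\<lparr>carrier := S\<rparr>) (2 ^ m)"
    and X: "X \<subseteq> S" "finite X" "card X = m" "alg_generated F C X = S"
    and c: "alg_centralizer C S = S" and sym: "S \<subseteq> Sym C J"
    using assms unfolding Phi_representatives_def by blast
  obtain g where g: "g \<in> carrier C" "carrier C = A.bimod S g"
    using A.bimod_total[OF m(1)[unfolded has_degree_def] S.S c S.sq m(2) X] by blast
  show ?thesis
  proof (rule S.sqs_characterization[where h = "fprod n" and g = g])
    show "Tr n (J (fprod n) \<otimes>\<^bsub>C\<^esub> fprod n) \<noteq> \<zero>\<^bsub>C\<^esub>" using Tr_JG[of n] nontrivial by simp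
    show "Tr n (c \<otimes>\<^bsub>C\<^esub> a) = c \<otimes>\<^bsub>C\<^esub> Tr n a" if "c \<in> Cl.C.scal" "a \<in> carrier C" for c a
      using that by (auto simp: Cl.C.scal_def Cl.C.smult_mult_l Tr_smult Tr_closed)
    show "Tr n (J a) = Tr n a" if "a \<in> carrier C" for a by (rule Tr_J[OF that])
    show "Tr n (a \<otimes>\<^bsub>C\<^esub> c) = Tr n (c \<otimes>\<^bsub>C\<^esub> a)" if "a \<in> carrier C" "c \<in> carrier C" for a c
      by (rule Tr_commute[OF that])
    show "J s = s" if "s \<in> S" for s using sym that by (auto simp: Sym_def)
    show "carrier C = A.bimod S g" by (rule g(2))
  qed (simp_all add: J Tr_scal Tr_add fprod_closed g(1))
qed

text \<open>The squares of the rho i generate the squares of \<open>S0\<close>, which are those of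
  S, so the exchange can be carried out in S.\<close>

lemma representative_generators:
  assumes "S \<in> Phi_representatives F C J"
  shows "\<exists>z. (\<forall>i<n. z i \<in> S \<and> z i \<otimes>\<^bsub>C\<^esub> z i = q (rho i) \<odot>\<^bsub>C\<^esub> \<one>\<^bsub>C\<^esub>) \<and> alg_generated F C (z ` {..<n}) = S"
proof -
  interpret S: sq_alg F C S by (rule representative_sq_alg[OF assms])
  obtain m X where m: "has_degree F C (2 ^ m)"
    and X: "X \<subseteq> S" "finite X" "card X = m" "alg_generated F C X = S"
    using assms unfolding Phi_representatives_def by blast
  have S0: "(\<lambda>i. \<iota> (rho i)) ` {..<n} \<subseteq> S0" unfolding S0_def by (rule Cl.C.alg_generated_incl)
  have "A.sq_closure ((\<lambda>i. \<iota> (rho i) \<otimes>\<^bsub>C\<^esub> \<iota> (rho i)) ` {..<n}) = A.sqs S0"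
    using S0.sqs_generated[OF S0] by (simp add: S0_def[symmetric] image_image)
  also have "\<dots> = A.sqs S"
    using representative_sqs[OF S0_representative] representative_sqs[OF assms] by simp
  finally have "\<exists>z. (\<forall>i<n. z i \<in> S \<and> z i \<otimes>\<^bsub>C\<^esub> z i = \<iota> (rho i) \<otimes>\<^bsub>C\<^esub> \<iota> (rho i))
      \<and> alg_generated F C (z ` {..<n}) = S"
    using X representative_degree[OF m] by (intro S.exchange[of X]) auto
  then show ?thesis using rho_closed by (auto simp: Cl.iota_square)
qed

end

section \<open>Comparison of the algebras\<close>

lemma (in assoc_alg) assoc_alg_subalg:
  assumes "subalg F A S"
  shows "assoc_alg F (A\<lparr>carrier := S\<rparr>)"
proof (rule assoc_algI)
  show "vectorspace F (A\<lparr>carrier := S\<rparr>)" by (rule VS.subspace_is_vs[OF subalg_subspace[OF assms]])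
  show "ring (A\<lparr>carrier := S\<rparr>)" using assms by (intro A.subring_is_ring) (simp add: subalg_def)
qed (use subalgD(7)[OF assms] in \<open>auto simp: smult_mult_l smult_mult_r\<close>)

lemma alg_isomorphic_refl: "alg_isomorphic F A A"
  unfolding alg_isomorphic_def
  by (rule bexI[of _ "\<lambda>x. x"]) (auto simp: ring_iso_def ring_hom_def module_hom_def bij_betw_def)

lemma alg_isomorphicI_inverse:
  assumes A: "assoc_alg F A" and h: "alg_hom F A B h" and bij: "bij_betw h (carrier A) (carrier B)"
  shows "alg_isomorphic F B A"
proof -
  interpret A: assoc_alg F A by fact
  let ?g = "inv_into (carrier A) h"
  note hD = alg_homD[OF h]
  have g: "?g y \<in> carrier A" "h (?g y) = y" if "y \<in> carrier B" for y
    using that bij by (auto simp: bij_betw_def inv_into_into f_inv_into_f)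
  have gh: "?g (h x) = x" if "x \<in> carrier A" for x
    using that bij by (simp add: bij_betw_def)
  have "?g (x \<otimes>\<^bsub>B\<^esub> y) = ?g x \<otimes>\<^bsub>A\<^esub> ?g y" "?g (x \<oplus>\<^bsub>B\<^esub> y) = ?g x \<oplus>\<^bsub>A\<^esub> ?g y"
    if "x \<in> carrier B" "y \<in> carrier B" for x y
    using gh[of "?g x \<otimes>\<^bsub>A\<^esub> ?g y"] gh[of "?g x \<oplus>\<^bsub>A\<^esub> ?g y"] g that by (simp_all add: hD)
  moreover have "?g (c \<odot>\<^bsub>B\<^esub> x) = c \<odot>\<^bsub>A\<^esub> ?g x" if "c \<in> carrier F" "x \<in> carrier B" for c x
    using gh[of "c \<odot>\<^bsub>A\<^esub> ?g x"] g that by (simp add: hD)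
  moreover have "?g \<one>\<^bsub>B\<^esub> = \<one>\<^bsub>A\<^esub>" using gh[of "\<one>\<^bsub>A\<^esub>"] by (simp add: hD)
  ultimately have "alg_hom F B A ?g" using g by (intro alg_homI) auto
  moreover have "bij_betw ?g (carrier B) (carrier A)" by (rule bij_betw_inv_into[OF bij])
  ultimately show ?thesis unfolding alg_isomorphic_def alg_hom_def ring_iso_def by blast
qed

lemma clifford_alg_cong:
  assumes "\<And>u. u \<in> carrier U \<Longrightarrow> \<psi> u = \<psi>' u"
  shows "clifford_alg F U \<psi> = clifford_alg F U \<psi>'"
proof -
  let ?T = "tensor_alg F U" and ?t = "tensor_in F U"
  have "{?t u \<otimes>\<^bsub>?T\<^esub> ?t u \<ominus>\<^bsub>?T\<^esub> \<psi> u \<odot>\<^bsub>?T\<^esub> \<one>\<^bsub>?T\<^esub> | u. u \<in> carrier U}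
      = {?t u \<otimes>\<^bsub>?T\<^esub> ?t u \<ominus>\<^bsub>?T\<^esub> \<psi>' u \<odot>\<^bsub>?T\<^esub> \<one>\<^bsub>?T\<^esub> | u. u \<in> carrier U}"
    using assms by force
  then show ?thesis by (simp add: clifford_alg_def clifford_ideal_def Let_def)
qed

text \<open>A space spanned by N elements has no room for a kernel if its image has dimension
  N.\<close>

lemma (in assoc_alg) surjection_bij:
  assumes sp: "spanned (carrier A) N" and B: "assoc_alg F B" and h: "alg_hom F A B h"
    and surj: "h ` carrier A = carrier B" and dim: "has_dim F B N"
  shows "bij_betw h (carrier A) (carrier B)"
proof -
  interpret B: assoc_alg F B by fact
  interpret L: linear_map F A B h
    using h by unfold_locales (auto simp: alg_hom_def)
  have fd: "vectorspace.fin_dim F A" and le: "vectorspace.dim F A \<le> N"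
    using spanned_dim[OF sp] by auto
  let ?K = "{x \<in> carrier A. h x = \<zero>\<^bsub>B\<^esub>}"
  have imT: "L.imT = carrier B" using surj by (simp add: L.im_def)
  have ker: "L.kerT = ?K" by (simp add: L.ker_def)
  have K: "subspace F ?K A" using L.kerT_is_subspace unfolding ker .
  interpret K: vectorspace F "A\<lparr>carrier := ?K\<rparr>" by (rule VS.subspace_is_vs[OF K])
  have "vectorspace.dim F (A\<lparr>carrier := ?K\<rparr>) = 0"
    using L.rank_nullity[OF fd] dim le unfolding imT ker has_dim_def by simp
  moreover have "vectorspace.fin_dim F (A\<lparr>carrier := ?K\<rparr>)"
    using fd by (intro dim_subspace_fin(1)[OF subalg_subspace[OF subalg_carrier] K]) auto
  ultimately obtain b where b: "finite b" "K.basis b" "card b = 0"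
    using K.finite_basis_exists K.dim_basis by auto
  then have "K.span {} = ?K" by (simp add: K.basis_def)
  then have "?K = {\<zero>}" using K.span_empty by simp
  then have "inj_on h (carrier A)" using ker by (intro L.Ke0_imp_inj) simp
  then show ?thesis using surj by (simp add: bij_betw_def)
qed

section \<open>Mapping C(q|R) onto a representative\<close>

context quad_involution_basis
begin

primrec csum :: "(nat \<Rightarrow> 'f) \<Rightarrow> (nat \<Rightarrow> ('v list \<Rightarrow> 'f) set set) \<Rightarrow> nat \<Rightarrow> ('v list \<Rightarrow> 'f) set set" where
  "csum c z 0 = \<zero>\<^bsub>C\<^esub>"
| "csum c z (Suc k) = csum c z k \<oplus>\<^bsub>C\<^esub> c k \<odot>\<^bsub>C\<^esub> z k"

lemma csum_in:
  assumes S: "subalg F C S"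
  shows "\<lbrakk>\<And>i. i < k \<Longrightarrow> c i \<in> carrier F; \<And>i. i < k \<Longrightarrow> z i \<in> S\<rbrakk> \<Longrightarrow> csum c z k \<in> S"
  using Cl.C.subalgD[OF S] by (induction k) simp_all

lemma csum_closed:
  "\<lbrakk>\<And>i. i < k \<Longrightarrow> c i \<in> carrier F; \<And>i. i < k \<Longrightarrow> z i \<in> carrier C\<rbrakk> \<Longrightarrow> csum c z k \<in> carrier C"
  by (rule csum_in[OF Cl.C.subalg_carrier])

lemma csum_add:
  "\<lbrakk>\<And>i. i < k \<Longrightarrow> c i \<in> carrier F; \<And>i. i < k \<Longrightarrow> d i \<in> carrier F; \<And>i. i < k \<Longrightarrow> z i \<in> carrier C\<rbrakk>
    \<Longrightarrow> csum (\<lambda>i. c i \<oplus> d i) z k = csum c z k \<oplus>\<^bsub>C\<^esub> csum d z k"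
proof (induction k)
  case (Suc k)
  then show ?case using csum_closed[of k c z] csum_closed[of k d z]
    by (simp add: Cl.C.VS.smult_l_distr Cl.C.A.a_ac)
qed simp

lemma csum_smult:
  "\<lbrakk>e \<in> carrier F; \<And>i. i < k \<Longrightarrow> c i \<in> carrier F; \<And>i. i < k \<Longrightarrow> z i \<in> carrier C\<rbrakk>
    \<Longrightarrow> csum (\<lambda>i. e \<otimes> c i) z k = e \<odot>\<^bsub>C\<^esub> csum c z k"
proof (induction k)
  case (Suc k)
  then show ?case using csum_closed[of k c z]
    by (simp add: Cl.C.VS.smult_r_distr Cl.C.VS.smult_assoc1)
qed simp

lemma csum_cong: "(\<And>i. i < k \<Longrightarrow> c i = d i) \<Longrightarrow> csum c z k = csum d z k"
  by (induction k) auto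

lemma csum_delta:
  "\<lbrakk>\<And>i. i < k \<Longrightarrow> z i \<in> carrier C\<rbrakk>
    \<Longrightarrow> csum (\<lambda>i. if i = j then \<one> else \<zero>) z k = (if j < k then z j else \<zero>\<^bsub>C\<^esub>)"
  by (induction k) (auto simp: less_Suc_eq)

text \<open>Squares add on both sides: in S because it is commutative of characteristic 2, and in R
  because R is isotropic, so that q is additive on it.\<close>

lemma csum_square:
  assumes "sq_alg F C S"
  shows "\<lbrakk>k \<le> n; \<And>i. i < k \<Longrightarrow> c i \<in> carrier F; \<And>i. i < k \<Longrightarrow> z i \<in> S;
      \<And>i. i < k \<Longrightarrow> z i \<otimes>\<^bsub>C\<^esub> z i = q (rho i) \<odot>\<^bsub>C\<^esub> \<one>\<^bsub>C\<^esub>\<rbrakk>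
    \<Longrightarrow> csum c z k \<otimes>\<^bsub>C\<^esub> csum c z k = q (lsum c rho k) \<odot>\<^bsub>C\<^esub> \<one>\<^bsub>C\<^esub>"
proof (induction k)
  case 0
  show ?case by (simp add: q_zero)
next
  case (Suc k)
  interpret S: sq_alg F C S by fact
  have s: "csum c z k \<in> S" "c k \<odot>\<^bsub>C\<^esub> z k \<in> S"
    using csum_in[OF S.S, of k c z] S.SD(6) Suc.prems by auto
  have zc: "z k \<in> carrier C" using Suc.prems S.SD(7) by auto
  have L: "lsum c rho k \<in> R" "c k \<odot>\<^bsub>V\<^esub> rho k \<in> R"
    using Suc.prems rho_R by (auto intro: lsum_submodule[OF R_submodule] submodule.smult_closed[OF R_submodule])
  have zk: "(c k \<odot>\<^bsub>C\<^esub> z k) \<otimes>\<^bsub>C\<^esub> (c k \<odot>\<^bsub>C\<^esub> z k) = q (c k \<odot>\<^bsub>V\<^esub> rho k) \<odot>\<^bsub>C\<^esub> \<one>\<^bsub>C\<^esub>"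
    using Suc.prems zc rho_closed[of k]
    by (simp add: Cl.C.smult_mult_l Cl.C.smult_mult_r q_smult Cl.C.VS.smult_assoc1)
  have "csum c z (Suc k) \<otimes>\<^bsub>C\<^esub> csum c z (Suc k)
      = csum c z k \<otimes>\<^bsub>C\<^esub> csum c z k \<oplus>\<^bsub>C\<^esub> (c k \<odot>\<^bsub>C\<^esub> z k) \<otimes>\<^bsub>C\<^esub> (c k \<odot>\<^bsub>C\<^esub> z k)"
    unfolding csum.simps by (rule A.square_add[OF S.SD(7)[OF s(1)] S.SD(7)[OF s(2)] S.comm[OF s]])
  also have "\<dots> = (q (lsum c rho k) \<oplus> q (c k \<odot>\<^bsub>V\<^esub> rho k)) \<odot>\<^bsub>C\<^esub> \<one>\<^bsub>C\<^esub>"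
    using Suc zk R_closed[OF L(1)] R_closed[OF L(2)] by (simp add: Cl.C.VS.smult_l_distr)
  also have "q (lsum c rho k) \<oplus> q (c k \<odot>\<^bsub>V\<^esub> rho k) = q (lsum c rho (Suc k))"
    using R_closed[OF L(1)] R_closed[OF L(2)] R_isotropic[OF L] by (simp add: q_add)
  finally show ?case .
qed

abbreviation "U \<equiv> V\<lparr>carrier := R\<rparr>"

sublocale QU: quadratic_char2 F U q
proof -
  have "submodule F R V" by (rule R_submodule)
  then interpret U: vectorspace F U
    using V.vectorspace_axioms by (intro V.subspace_is_vs) (auto simp: subspace_def)
  have "quadratic_form F U q"
    unfolding quadratic_form_def bilinear_form_def
    using R_closed submodule.m_closed[OF R_submodule] submodule.smult_closed[OF R_submodule] b_closed b_add b_smult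
    by (simp add: q_smult) (simp add: polar_def)
  then show "quadratic_char2 F U q" using char2 by unfold_locales
qed

text \<open>Only the upper bound is proved here; the matching lower bound comes from the surjection
  onto a representative.\<close>

lemma spanned_CU: "QU.Cl.C.spanned (carrier (clifford_alg F U q)) (2 ^ n)"
proof -
  let ?i = "clifford_in F U q" and ?CU = "clifford_alg F U q"
  let ?G = "alg_generated F ?CU ((\<lambda>i. ?i (rho i)) ` {..<n})"
  have car: "(\<lambda>i. ?i (rho i)) ` {..<n} \<subseteq> carrier ?CU" using QU.Cl.iota_closed rho_R by auto
  have G: "subalg F ?CU ?G" by (rule QU.Cl.C.subalg_alg_generated[OF car])
  have sm: "submodule F {v \<in> R. ?i v \<in> ?G} V"
    using QU.iota_submodule[OF G] R_closed V.module_axioms unfolding submodule_def by auto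
  have "?G = carrier ?CU"
  proof (rule QU.Cl.generated[OF G], clarify)
    fix r assume "r \<in> carrier U"
    then have r: "r \<in> R" by simp
    have "lsum (\<lambda>i. b (rs i) r) rho n \<in> {v \<in> R. ?i v \<in> ?G}"
      using rs_closed R_closed[OF r] rho_R QU.Cl.C.alg_generated_incl[of "(\<lambda>i. ?i (rho i)) ` {..<n}"]
      by (intro lsum_submodule[OF sm]) auto
    then show "?i r \<in> ?G" using expand_rho[OF r] by simp
  qed
  moreover have "QU.Cl.C.spanned ?G (2 ^ n)"
    using rho_R QU.Cl.iota_closed QU.iota_scal by (intro QU.A.spanned_alg_generated) auto
  ultimately show ?thesis by simp
qed

text \<open>The linear map with rho i |-> z i respects squares, so it extends to C(q|R). It is onto
  because the z i generate S, and bijective because both sides have room for only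
  \<open>2 ^ n\<close> dimensions.\<close>

lemma representative_isomorphic:
  assumes "S \<in> Phi_representatives F C J"
  shows "alg_isomorphic F (C\<lparr>carrier := S\<rparr>) (clifford_alg F U q)"
proof -
  let ?i = "clifford_in F U q" and ?CU = "clifford_alg F U q" and ?B = "C\<lparr>carrier := S\<rparr>"
  interpret S: sq_alg F C S by (rule representative_sq_alg[OF assms])
  obtain m where m: "has_degree F C (2 ^ m)" "has_dim F ?B (2 ^ m)"
    using assms unfolding Phi_representatives_def by blast
  have dimS: "has_dim F ?B (2 ^ n)" using m representative_degree by auto
  obtain z where z: "\<And>i. i < n \<Longrightarrow> z i \<in> S" "\<And>i. i < n \<Longrightarrow> z i \<otimes>\<^bsub>C\<^esub> z i = q (rho i) \<odot>\<^bsub>C\<^esub> \<one>\<^bsub>C\<^esub>"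
    and gen: "alg_generated F C (z ` {..<n}) = S"
    using representative_generators[OF assms] by blast
  have zc: "\<And>i. i < n \<Longrightarrow> z i \<in> carrier C" using z S.SD(7) by auto
  have B: "assoc_alg F ?B" by (rule Cl.C.assoc_alg_subalg[OF S.S])
  \<comment> \<open>\<open>b (rs i) u\<close> is the coordinate of u along rho i.\<close>
  define g where "g u = csum (\<lambda>i. b (rs i) u) z n" for u
  have bc: "b (rs i) u \<in> carrier F" if "i < n" "u \<in> R" for i u using that rs_closed R_closed by auto
  have g_hom: "g \<in> module_hom F U ?B"
  proof -
    have "g u \<in> S" if "u \<in> R" for u unfolding g_def using that bc z by (intro csum_in[OF S.S]) auto
    moreover have "g (u \<oplus>\<^bsub>V\<^esub> v) = g u \<oplus>\<^bsub>C\<^esub> g v" if uv: "u \<in> R" "v \<in> R" for u v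
    proof -
      have "g (u \<oplus>\<^bsub>V\<^esub> v) = csum (\<lambda>i. b (rs i) u \<oplus> b (rs i) v) z n"
        unfolding g_def using uv rs_closed R_closed by (intro csum_cong) (simp add: b_add)
      then show ?thesis unfolding g_def using uv bc zc by (simp add: csum_add)
    qed
    moreover have "g (c \<odot>\<^bsub>V\<^esub> u) = c \<odot>\<^bsub>C\<^esub> g u" if cu: "c \<in> carrier F" "u \<in> R" for c u
    proof -
      have "g (c \<odot>\<^bsub>V\<^esub> u) = csum (\<lambda>i. c \<otimes> b (rs i) u) z n"
        unfolding g_def using cu rs_closed R_closed by (intro csum_cong) (simp add: b_smult)
      then show ?thesis unfolding g_def using cu bc zc by (simp add: csum_smult)
    qed
    ultimately show ?thesis by (simp add: module_hom_def)
  qed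
  have g_square: "g u \<otimes>\<^bsub>?B\<^esub> g u = q u \<odot>\<^bsub>?B\<^esub> \<one>\<^bsub>?B\<^esub>" if "u \<in> carrier U" for u
  proof -
    have u: "u \<in> R" using that by simp
    have "g u \<otimes>\<^bsub>C\<^esub> g u = q (lsum (\<lambda>i. b (rs i) u) rho n) \<odot>\<^bsub>C\<^esub> \<one>\<^bsub>C\<^esub>"
      unfolding g_def using u bc z by (intro csum_square[OF S.sq_alg_axioms]) auto
    then show ?thesis using expand_rho[OF u] by simp
  qed
  obtain h where h: "alg_hom F ?CU ?B h" "\<forall>u\<in>carrier U. h (?i u) = g u"
    using QU.Cl.universal[OF B g_hom g_square] by blast
  note hD = alg_homD[OF h(1), simplified]
  have g_rho: "g (rho j) = z j" if j: "j < n" for j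
  proof -
    have "g (rho j) = csum (\<lambda>i. if i = j then \<one> else \<zero>) z n"
      unfolding g_def using j rs_rho by (intro csum_cong) auto
    then show ?thesis using csum_delta[of n z j] zc j by simp
  qed
  have "subalg F C (h ` carrier ?CU)"
  proof (rule Cl.C.subalgI)
    show "h ` carrier ?CU \<subseteq> carrier C" using hD(1) S.SD(7) by blast
    have "h \<one>\<^bsub>?CU\<^esub> \<in> h ` carrier ?CU" by blast
    then show "\<one>\<^bsub>C\<^esub> \<in> h ` carrier ?CU" unfolding hD(5) .
    fix x w assume "x \<in> h ` carrier ?CU" "w \<in> h ` carrier ?CU"
    then obtain a c where ac: "x = h a" "w = h c" "a \<in> carrier ?CU" "c \<in> carrier ?CU" by blast
    show "x \<oplus>\<^bsub>C\<^esub> w \<in> h ` carrier ?CU"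
      using ac hD(3)[OF ac(3,4)] by (metis QU.Cl.C.A.a_closed imageI)
    show "x \<otimes>\<^bsub>C\<^esub> w \<in> h ` carrier ?CU"
      using ac hD(2)[OF ac(3,4)] by (metis QU.Cl.C.A.m_closed imageI)
  next
    fix e x assume e: "e \<in> carrier F" and "x \<in> h ` carrier ?CU"
    then obtain a where a: "x = h a" "a \<in> carrier ?CU" by blast
    then show "e \<odot>\<^bsub>C\<^esub> x \<in> h ` carrier ?CU"
      using hD(4)[OF e a(2)] e by (metis QU.Cl.C.VS.smult_closed imageI)
  qed
  moreover have "z ` {..<n} \<subseteq> h ` carrier ?CU"
  proof (rule image_subsetI)
    fix j assume "j \<in> {..<n}"
    then have "z j = h (?i (rho j))" "?i (rho j) \<in> carrier ?CU"
      using h(2) g_rho rho_R QU.Cl.iota_closed by auto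
    then show "z j \<in> h ` carrier ?CU" by blast
  qed
  ultimately have "S \<subseteq> h ` carrier ?CU" unfolding gen[symmetric] by (rule Cl.C.alg_generated_minimal)
  then have "h ` carrier ?CU = carrier ?B" using hD(1) by auto
  then have "bij_betw h (carrier ?CU) (carrier ?B)"
    by (rule QU.Cl.C.surjection_bij[OF spanned_CU B h(1) _ dimS])
  then show ?thesis by (rule alg_isomorphicI_inverse[OF QU.Cl.C.assoc_alg_axioms h(1)])
qed

end

theorem proposition4p6:
  fixes F :: "('f, 'm) ring_scheme" and V :: "('f, 'v) module"
    and q :: "'v \<Rightarrow> 'f" and \<tau> :: "'v \<Rightarrow> 'v" and \<phi> :: "'v \<Rightarrow> 'f"
  assumes "field F" and "\<one>\<^bsub>F\<^esub> \<oplus>\<^bsub>F\<^esub> \<one>\<^bsub>F\<^esub> = \<zero>\<^bsub>F\<^esub>"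
    and "quadratic_space F V q"
    and "\<tau> \<in> orthogonal_group F V q" and "\<forall>v\<in>carrier V. \<tau> (\<tau> v) = v"
    and "Res V \<tau> = Fix V \<tau>"
    and "\<forall>v\<in>Res V \<tau>. \<phi> v = wall_form F V q \<tau> v v"
  shows "Phi_isomorphic F (clifford_alg F V q) (clifford_inv F V q \<tau>)
           (clifford_alg F (V\<lparr>carrier := Res V \<tau>\<rparr>) \<phi>) \<and>
         alg_isomorphic F (clifford_alg F (V\<lparr>carrier := Res V \<tau>\<rparr>) \<phi>)
           (clifford_alg F (V\<lparr>carrier := Res V \<tau>\<rparr>) (restrict q (Res V \<tau>)))"
proof -
  have V: "vectorspace F V" "vectorspace.fin_dim F V" "quadratic_form F V q"
    and nd: "\<And>u. \<lbrakk>u \<in> carrier V; \<And>v. v \<in> carrier V \<Longrightarrow> polar F V q u v = \<zero>\<^bsub>F\<^esub>\<rbrakk> \<Longrightarrow> u = \<zero>\<^bsub>V\<^esub>"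
    using assms(3) unfolding quadratic_space_def by blast+
  interpret quad_involution F V q \<tau>
    using assms(1,2,4-6) V nd
    by (intro quad_involution.intro quadratic_char2.intro quadratic_char2_axioms.intro
        quad_involution_axioms.intro) auto
  obtain n f fs where "quad_involution_basis F V q \<tau> n f fs" using exists_basis by blast
  then interpret quad_involution_basis F V q \<tau> n f fs .
  have phi: "\<phi> v = q v" if "v \<in> R" for v using assms(7) wall_form_q that by auto
  \<comment> \<open>The Clifford algebra depends only on the values of the form on the underlying
    space. All three forms agree on R, so the algebras are equal and the second isomorphism is the
    identity.\<close>
  have C_phi: "clifford_alg F U \<phi> = clifford_alg F U q"
    using phi by (intro clifford_alg_cong) simp
  have C_restrict: "clifford_alg F U (restrict q R) = clifford_alg F U q"
    by (intro clifford_alg_cong) simp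
  show ?thesis
    unfolding C_phi C_restrict Phi_isomorphic_def
    using S0_representative representative_isomorphic alg_isomorphic_refl by blast
qed

end
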